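(* (a) For any even integer $N\ge 0$ the polynomial family $D_N(\lambda):\mathrm{Ind}_{P^{n+1}}^{G^{n+1}}(\xi_{\lambda})\rightarrow\mathrm{Ind}_{P^n}^{G^{n}}(\xi_{\lambda-N})$ defines a family of $G^n$-equivariant operators $$D_N^{\mathrm{c}}(\lambda):C^{\infty}(\mathrm{Ein}_n)_\lambda\rightarrow C^{\infty}(\mathrm{Ein}_{n-1})_{\lambda-N}.$$ (b) For any non-negative integer $N$ the polynomial family $\hat{D}_N(\lambda):\mathrm{Ind}_{\hat{P}^{n+1}}^{G^{n+1}}(\xi_{\lambda})\rightarrow\mathrm{Ind}_{\hat{P}^n}^{G^{n}}(\xi_{\lambda-N})$ defines a family of $G^n$-equivariant operators $$\hat{D}_N^{\mathrm{c}}(\lambda):C^{\infty}(\widehat{\mathrm{Ein}}_n)_\lambda\rightarrow C^{\infty}(\widehat{\mathrm{Ein}}_{n-1})_{\lambda-N}.$$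
   Context: Fix an integer $n\ge 4$. For $m\in\{n,n+1\}$ let $G^m=O(2,m-1)$ be the group of real $(m+1)\times(m+1)$ matrices preserving $-t_1^2-t_2^2+x_1^2+\dots+x_{m-1}^2$ (coordinates ordered $(t_1,t_2,x_1,\dots,x_{m-1})$), and $\mathfrak{g}_m=\mathfrak{o}(2,m-1)$ its Lie algebra. Let $E_{ab}$ be the elementary matrices. Put $H=E_{14}+E_{41}$, $H_2=E_{23}+E_{32}$, $Q_1^-=-E_{12}+E_{21}+E_{24}+E_{42}$, $Q_2^-=E_{13}+E_{31}+E_{34}-E_{43}$, and for $1\le i,j\le m-3$: $Y_j^-=E_{4+j,1}+E_{4+j,4}+E_{1,4+j}-E_{4,4+j}$, $Z_j^+=E_{2,4+j}+E_{3,4+j}+E_{4+j,2}-E_{4+j,3}$, $M_{ij}=E_{4+i,4+j}-E_{4+j,4+i}$. Let $Q_i^+=(Q_i^-)^t$, $Y_j^+=(Y_j^-)^t$, $Z_j^-=(Z_j^+)^t$. Put $\mathfrak{a}=\mathbb{R}H$, $\mathfrak{m}_m=\mathrm{span}(H_2,Z_j^\pm,M_{ij})\cong\mathfrak{so}(1,m-2)$, $\mathfrak{n}_m^\pm=\mathrm{span}(Q_1^\pm,Q_2^\pm,Y_j^\pm:1\le j\le m-3)$ (abelian). $\mathcal{U}(\cdot)$ denotes the complex universal enveloping algebra; $\mathfrak{g}_n\subset\mathfrak{g}_{n+1}$ via $X\mapsto\begin{pmatrix}X&0\\0&0\end{pmatrix}$. Groups: $K^m=O(2)\times O(m-1)$,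 $A=\exp\mathfrak{a}$, $(N^\pm)^m=\exp\mathfrak{n}_m^\pm$, $M_0^m$ is the analytic subgroup of $G^m$ with Lie algebra $\mathfrak{m}_m$, $w_1=\mathrm{diag}(1,-1,1,1,\dots,1)$, $w_2=\mathrm{diag}(1,1,-1,1,\dots,1)$, $J_{(m)}=-1\in G^m$, $\hat{M}^m=\langle w_1,w_2\rangle M_0^m$, $M^m=\{1,J_{(m)}\}\hat{M}^m$, $P^m=M^mA(N^+)^m$, $\hat{P}^m=\hat{M}^mA(N^+)^m$. $G^n$ is a subgroup of $G^{n+1}$ via $i(g)=\begin{pmatrix}g&0\\0&1\end{pmatrix}$, and $i^*:C^\infty(G^{n+1})\to C^\infty(G^n)$ is pullback along $i$. $\xi_\lambda(\exp(tH))=e^{\lambda t}$. $\mathrm{Ind}_{P^m}^{G^m}(\xi_\lambda)$ is the space of $u\in C^\infty(G^m)$ with $u(g\tilde m\tilde a\tilde n)=\xi_\lambda(\tilde a)u(g)$ for $\tilde m\tilde a\tilde n\in P^m$, with $G^m$ acting by left translation $(g\cdot u)(x)=u(g^{-1}x)$; similarly for $\hat P^m$. Elements of $\mathcal{U}(\mathfrak{g}_{n+1})$ act on $C^\infty(G^{n+1})$ by extending $(R(X)u)(x)=\frac{d}{dt}\big|_{t=0}u(x\exp(tX))$. The family $\mathcal{D}_N^0(\lambda)$: let $\Delta_{n-1}=-(Q_1^-)^2+(Q_2^-)^2+\sum_{j=1}^{n-3}(Y_j^-)^2\in\mathcal{U}(\mathfrak{n}_n^-)$ and $T_n=Y_{n-2}^-\in\mathfrak{n}_{n+1}^-$.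 Then for $k\ge 0$ $\mathcal{D}_{2k}^0(\lambda)=\sum_{j=0}^k a_j(\lambda)\Delta_{n-1}^jT_n^{2k-2j}$, with $a_k(\lambda)=1$ and $(k-j+1)(2k-2j+1)a_{j-1}(\lambda)+j(n-1+2\lambda-4k+2j)a_j(\lambda)=0$ for $j=1,\dots,k$; $\mathcal{D}_{2k+1}^0(\lambda)=\sum_{j=0}^k b_j(\lambda)\Delta_{n-1}^jT_n^{2k-2j+1}$, with $b_k(\lambda)=1$ and $(k-j+1)(2k-2j+3)b_{j-1}(\lambda)+j(n-3+2\lambda-4k+2j)b_j(\lambda)=0$ for $j=1,\dots,k$. The operators $D_N(\lambda)$ ($N$ even) and $\hat D_N(\lambda)$ (all $N$) are $i^*\circ R(\mathcal{D}_N^0(\lambda))$ on the indicated induced spaces. Geometry: let $C_m=\{-t_1^2-t_2^2+x_1^2+\dots+x_{m-1}^2=0\}\subset\mathbb{R}^{m+1}$. $\mathrm{Ein}_{m-1}$ (resp. $\widehat{\mathrm{Ein}}_{m-1}$) is the set of straight lines in $C_m$ through the origin (resp. rays in $C_m$ from the origin); $\mathrm{Ein}_{m-1}\simeq(S^1\times S^{m-2})/\{\pm1\}$ and $\widehat{\mathrm{Ein}}_{m-1}\simeq S^1\times S^{m-2}$. Identify $\mathrm{Ein}_{m-1}\simeq G^m/P^m\simeq K^m/(K^m\cap M^m)$ and $\widehat{\mathrm{Ein}}_{m-1}\simeq G^m/\hat P^m\simeq K^m/(K^m\cap\hat M^m)$ via $g\mapsto g(1,0,0,1,0,\dots,0)^t$.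 Compact realization: using $G^m=K^mM^mA(N^+)^m$ write $g=\kappa(g)\mu(g)a(g)\eta(g)$. Restriction to $K^m$ is a bijection $\delta:\mathrm{Ind}_{P^m}^{G^m}(\xi_\lambda)\to C^\infty(K^m)^{K^m\cap M^m}\simeq C^\infty(\mathrm{Ein}_{m-1})$ (right $K^m\cap M^m$-invariant functions), and $C^\infty(\mathrm{Ein}_{m-1})_\lambda$ is $C^\infty(\mathrm{Ein}_{m-1})$ with the transported action $(\pi^{\mathrm c}_\lambda(g)F)(k)=F(\kappa(g^{-1}k))\,\xi_\lambda(a(g^{-1}k))$. Likewise $\hat\delta$ and $C^\infty(\widehat{\mathrm{Ein}}_{m-1})_\lambda$, with $\hat M^m,\hat P^m$ in place of $M^m,P^m$. The operators "defined" by $D_N(\lambda)$ and $\hat D_N(\lambda)$ are $D_N^{\mathrm c}(\lambda)=\delta\circ D_N(\lambda)\circ\delta^{-1}$ and $\hat D_N^{\mathrm c}(\lambda)=\hat\delta\circ\hat D_N(\lambda)\circ\hat\delta^{-1}$. $C^\infty(\mathrm{Ein}_n)_\lambda$ and $C^\infty(\widehat{\mathrm{Ein}}_n)_\lambda$ are $G^n$-modules by restriction along $i$. *)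

theory Defs
  imports
    "HOL-Analysis.Analysis"
    "HOL-Algebra.QuotRing"
    "HOL-Algebra.Generated_Groups"
    "HOL-Library.Poly_Mapping"
begin

section \<open>Smooth functions\<close>

text \<open>\<open>D [v\<^sub>k, \<dots>, v\<^sub>1] x\<close> is the iterated Frechet derivative of \<open>f\<close> at \<open>x\<close> in the directions
  \<open>v\<^sub>1, \<dots>, v\<^sub>k\<close>; the set \<open>U\<close> is meant to be open.\<close>

definition smooth_on :: "'a::real_normed_vector set \<Rightarrow> ('a \<Rightarrow> 'b::real_normed_vector) \<Rightarrow> bool" where
  "smooth_on U f \<longleftrightarrow> (\<exists>D :: 'a list \<Rightarrow> 'a \<Rightarrow> 'b.
     (\<forall>x\<in>U. D [] x = f x) \<and>
     (\<forall>vs. \<forall>x\<in>U. (D vs has_derivative (\<lambda>v. D (v # vs) x)) (at x)))"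

text \<open>Complex smooth functions on an embedded submanifold \<open>S\<close> of a normed space: those which
  locally extend to smooth functions on the ambient space. Functions on \<open>S\<close> are represented by total
  functions vanishing outside \<open>S\<close>, here and for all function spaces below.\<close>

definition C_inf :: "'a::real_normed_vector set \<Rightarrow> ('a \<Rightarrow> complex) set" where
  "C_inf S = {u. (\<forall>x. x \<notin> S \<longrightarrow> u x = 0) \<and>
     (\<forall>x\<in>S. \<exists>U v. open U \<and> x \<in> U \<and> smooth_on U v \<and> (\<forall>y\<in>U \<inter> S. v y = u y))}"


section \<open>Matrices\<close>

text \<open>For a finite type \<open>'a\<close> with \<open>CARD('a) = m - 3\<close> the type \<open>'a coord\<close> indexes the \<open>m + 1\<close>
  coordinates \<open>(t\<^sub>1, t\<^sub>2, x\<^sub>1, \<dots>, x\<^sub>m\<^sub>-\<^sub>1)\<close>: the constructors \<open>Time1\<close>, \<open>Time2\<close>, \<open>Space1\<close>, \<open>Space2\<close> are the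
  positions 1, 2, 3, 4, and \<open>Space j\<close> is the position \<open>4 + j\<close>. As types are nonempty, \<open>m \<ge> 4\<close>.
  Passing from \<open>m\<close> to \<open>m + 1\<close> replaces \<open>'a\<close> by \<open>'a option\<close>, with \<open>Space None\<close> as last coordinate.\<close>

datatype 'a coord = Time1 | Time2 | Space1 | Space2 | Space 'a

instance coord :: (finite) finite
proof
  have "(UNIV :: 'a coord set) = {Time1, Time2, Space1, Space2} \<union> range Space"
    using coord.exhaust by blast
  then show "finite (UNIV :: 'a coord set)"
    by (metis finite.emptyI finite.insertI finite_UnI finite_class.finite_UNIV finite_imageI)
qed

type_synonym 'a vec_m = "real ^ 'a coord"
type_synonym 'a mat_m = "real ^ 'a coord ^ 'a coord"

definition elem_mat :: "'n::finite \<Rightarrow> 'n \<Rightarrow> real ^ 'n ^ 'n" where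
  "elem_mat a b = (\<chi> i j. if i = a \<and> j = b then 1 else 0)"

definition mat_exp :: "real ^ 'n ^ 'n \<Rightarrow> real ^ 'n ^ 'n" where
  "mat_exp X = suminf (\<lambda>k. (1 / fact k) *\<^sub>R (((**) X ^^ k) (mat 1)))"

definition set_mult :: "(real ^ 'n ^ 'n) set \<Rightarrow> (real ^ 'n ^ 'n) set \<Rightarrow> (real ^ 'n ^ 'n) set"
    (infixl "\<odot>" 70) where
  "S \<odot> T = {x ** y | x y. x \<in> S \<and> y \<in> T}"

definition GL :: "(real ^ 'n ^ 'n) monoid" where
  "GL = \<lparr>carrier = {g. invertible g}, monoid.mult = (**), one = mat 1\<rparr>"

definition lie_algebra_of :: "(real ^ 'n ^ 'n) set \<Rightarrow> (real ^ 'n ^ 'n) set" where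
  "lie_algebra_of G = {X. \<forall>t::real. mat_exp (t *\<^sub>R X) \<in> G}"

text \<open>The analytic (connected Lie) subgroup with Lie algebra \<open>\<hh>\<close> is the one generated by \<open>exp \<hh>\<close>.\<close>

definition analytic_subgroup :: "(real ^ 'n ^ 'n) set \<Rightarrow> (real ^ 'n ^ 'n) set" where
  "analytic_subgroup \<hh> = generate GL (mat_exp ` \<hh>)"


section \<open>The group O(2, m - 1) and its subgroups\<close>

definition qform :: "'a::finite vec_m \<Rightarrow> real" where
  "qform x = - (x $ Time1)\<^sup>2 - (x $ Time2)\<^sup>2 + (x $ Space1)\<^sup>2 + (x $ Space2)\<^sup>2
     + (\<Sum>j\<in>UNIV. (x $ Space j)\<^sup>2)"

definition G_grp :: "'a::finite mat_m set" where
  "G_grp = {g. \<forall>x. qform (g *v x) = qform x}"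

definition \<gg> :: "'a::finite mat_m set" where
  "\<gg> = lie_algebra_of G_grp"

text \<open>The suffixes \<open>m\<close> and \<open>p\<close> stand for the superscripts \<open>-\<close> and \<open>+\<close>; the opposite sign is the
  transpose.\<close>

definition H_mat :: "'a::finite mat_m" where
  "H_mat = elem_mat Time1 Space2 + elem_mat Space2 Time1"

definition H2 :: "'a::finite mat_m" where
  "H2 = elem_mat Time2 Space1 + elem_mat Space1 Time2"

definition Q1m :: "'a::finite mat_m" where
  "Q1m = - elem_mat Time1 Time2 + elem_mat Time2 Time1
     + elem_mat Time2 Space2 + elem_mat Space2 Time2"

definition Q2m :: "'a::finite mat_m" where
  "Q2m = elem_mat Time1 Space1 + elem_mat Space1 Time1
     + elem_mat Space1 Space2 - elem_mat Space2 Space1"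

definition Ym :: "'a::finite \<Rightarrow> 'a mat_m" where
  "Ym j = elem_mat (Space j) Time1 + elem_mat (Space j) Space2
     + elem_mat Time1 (Space j) - elem_mat Space2 (Space j)"

definition Zp :: "'a::finite \<Rightarrow> 'a mat_m" where
  "Zp j = elem_mat Time2 (Space j) + elem_mat Space1 (Space j)
     + elem_mat (Space j) Time2 - elem_mat (Space j) Space1"

definition Mij :: "'a::finite \<Rightarrow> 'a \<Rightarrow> 'a mat_m" where
  "Mij i j = elem_mat (Space i) (Space j) - elem_mat (Space j) (Space i)"

definition \<mm> :: "'a::finite mat_m set" where
  "\<mm> = span ({H2} \<union> range Zp \<union> range (\<lambda>j. transpose (Zp j)) \<union> {Mij i j | i j. True})"

definition \<nn>p :: "'a::finite mat_m set" where
  "\<nn>p = span ({transpose Q1m, transpose Q2m} \<union> range (\<lambda>j. transpose (Ym j)))"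

definition time_like :: "'a coord \<Rightarrow> bool" where
  "time_like a \<longleftrightarrow> a = Time1 \<or> a = Time2"

text \<open>\<open>O(2) \<times> O(m - 1)\<close>, as block diagonal matrices.\<close>

definition K_grp :: "'a::finite mat_m set" where
  "K_grp = {k. orthogonal_matrix k \<and> (\<forall>a b. time_like a \<noteq> time_like b \<longrightarrow> k $ a $ b = 0)}"

definition A_grp :: "'a::finite mat_m set" where
  "A_grp = mat_exp ` range (\<lambda>t. t *\<^sub>R H_mat)"

definition Np_grp :: "'a::finite mat_m set" where
  "Np_grp = mat_exp ` \<nn>p"

definition w1 :: "'a::finite mat_m" where
  "w1 = (\<chi> i j. if i = j then if i = Time2 then -1 else 1 else 0)"

definition w2 :: "'a::finite mat_m" where
  "w2 = (\<chi> i j. if i = j then if i = Space1 then -1 else 1 else 0)"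

definition M_hat :: "'a::finite mat_m set" where
  "M_hat = generate GL {w1, w2} \<odot> analytic_subgroup \<mm>"

definition M_grp :: "'a::finite mat_m set" where
  "M_grp = {mat 1, - mat 1} \<odot> M_hat"

definition \<xi> :: "complex \<Rightarrow> 'a::finite mat_m \<Rightarrow> complex" where
  "\<xi> l a = exp (l * of_real (THE t. a = mat_exp (t *\<^sub>R H_mat)))"


section \<open>Induced representations\<close>

text \<open>The parameter \<open>L\<close> is \<open>M_grp\<close> for induction from \<open>P\<close> and \<open>M_hat\<close> for induction from the
  subgroup \<open>M_hat \<odot> A_grp \<odot> Np_grp\<close>.\<close>

definition Ind :: "'a::finite mat_m set \<Rightarrow> complex \<Rightarrow> ('a mat_m \<Rightarrow> complex) set" where
  "Ind L l = {u \<in> C_inf G_grp. \<forall>g\<in>G_grp. \<forall>m\<in>L. \<forall>a\<in>A_grp. \<forall>\<eta>\<in>Np_grp.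
     u (g ** m ** a ** \<eta>) = \<xi> l a * u g}"


section \<open>Universal enveloping algebras\<close>

datatype 'g fword = FWord (letters: "'g list")

instantiation fword :: (type) monoid_add
begin

definition "0 = FWord []"
definition "v + w = FWord (letters v @ letters w)"

instance by standard (simp_all add: zero_fword_def plus_fword_def)

end

text \<open>The free associative complex algebra on a set \<open>\<hh>\<close> of matrices is the monoid algebra of the free
  monoid on \<open>\<hh>\<close>. Its quotient by the relations making \<open>\<hh> \<rightarrow> \<U>(\<hh>)\<close> real linear and compatible with
  the brackets is the complex enveloping algebra of \<open>\<hh>\<close>.\<close>

type_synonym 'n free_alg = "(real ^ 'n ^ 'n) fword \<Rightarrow>\<^sub>0 complex"

definition gen :: "real ^ 'n ^ 'n \<Rightarrow> 'n free_alg" where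
  "gen X = Poly_Mapping.single (FWord [X]) 1"

definition scal :: "complex \<Rightarrow> 'n free_alg" where
  "scal c = Poly_Mapping.single 0 c"

definition free_algebra :: "(real ^ 'n ^ 'n) set \<Rightarrow> 'n free_alg ring" where
  "free_algebra \<hh> = \<lparr>carrier = {p. \<forall>w\<in>Poly_Mapping.keys p. set (letters w) \<subseteq> \<hh>},
     monoid.mult = (*), one = 1, zero = 0, add = (+)\<rparr>"

definition uea_relations :: "(real ^ 'n ^ 'n) set \<Rightarrow> 'n free_alg set" where
  "uea_relations \<hh> =
     {gen (X + Y) - gen X - gen Y | X Y. X \<in> \<hh> \<and> Y \<in> \<hh>} \<union>
     {gen (r *\<^sub>R X) - scal (of_real r) * gen X | r X. X \<in> \<hh>} \<union>
     {gen X * gen Y - gen Y * gen X - gen (X ** Y - Y ** X) | X Y. X \<in> \<hh> \<and> Y \<in> \<hh>}"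

definition uea_ideal :: "(real ^ 'n ^ 'n) set \<Rightarrow> 'n free_alg set" where
  "uea_ideal \<hh> = genideal (free_algebra \<hh>) (uea_relations \<hh>)"

definition uea :: "(real ^ 'n ^ 'n) set \<Rightarrow> 'n free_alg set ring" where
  "uea \<hh> = free_algebra \<hh> Quot uea_ideal \<hh>"

definition uea_class :: "(real ^ 'n ^ 'n) set \<Rightarrow> 'n free_alg \<Rightarrow> 'n free_alg set" where
  "uea_class \<hh> p = a_r_coset (free_algebra \<hh>) (uea_ideal \<hh>) p"

lemma ring_free_algebra:
  fixes \<hh> :: "(real ^ 'n ^ 'n) set"
  shows "ring (free_algebra \<hh>)"
proof -
  have mult_closed: "set (letters w) \<subseteq> \<hh>"
    if p: "\<forall>w\<in>Poly_Mapping.keys p. set (letters w) \<subseteq> \<hh>"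
      and q: "\<forall>w\<in>Poly_Mapping.keys q. set (letters w) \<subseteq> \<hh>"
      and w: "w \<in> Poly_Mapping.keys (p * q)" for p q :: "'n free_alg" and w
  proof -
    obtain u v where "w = u + v" "u \<in> Poly_Mapping.keys p" "v \<in> Poly_Mapping.keys q"
      using w keys_mult[of p q] by auto
    with p q show ?thesis
      by (auto simp: plus_fword_def)
  qed
  show ?thesis
  proof (rule ringI)
    show "abelian_group (free_algebra \<hh>)"
    proof (rule abelian_groupI)
      fix p assume "p \<in> carrier (free_algebra \<hh>)"
      then show "\<exists>q\<in>carrier (free_algebra \<hh>). q \<oplus>\<^bsub>free_algebra \<hh>\<^esub> p = \<zero>\<^bsub>free_algebra \<hh>\<^esub>"
        by (intro bexI[of _ "- p"]) (auto simp: free_algebra_def)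
    qed (use keys_add in \<open>fastforce simp: free_algebra_def algebra_simps\<close>)+
    show "Group.monoid (free_algebra \<hh>)"
      by (rule monoidI)
        (auto simp: free_algebra_def mult.assoc zero_fword_def dest: mult_closed)
  qed (auto simp: free_algebra_def algebra_simps)
qed

lemma uea_class_in_uea:
  assumes "p \<in> carrier (free_algebra \<hh>)"
  shows "uea_class \<hh> p \<in> carrier (uea \<hh>)"
  using assms by (auto simp: uea_class_def uea_def FactRing_def A_RCOSETS_def' a_r_coset_def')

text \<open>The action \<open>R\<close>, first of matrices, then of noncommutative polynomials in them, and finally
  of elements of the enveloping algebra: the common action of all representatives.\<close>

definition R_mat :: "real ^ 'n ^ 'n \<Rightarrow> (real ^ 'n ^ 'n \<Rightarrow> complex) \<Rightarrow> real ^ 'n ^ 'n \<Rightarrow> complex" where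
  "R_mat X u x = vector_derivative (\<lambda>t. u (x ** mat_exp (t *\<^sub>R X))) (at 0)"

definition R_free :: "'n free_alg \<Rightarrow> (real ^ 'n ^ 'n \<Rightarrow> complex) \<Rightarrow> real ^ 'n ^ 'n \<Rightarrow> complex" where
  "R_free p u x = (\<Sum>w\<in>Poly_Mapping.keys p. Poly_Mapping.lookup p w * foldr R_mat (letters w) u x)"

definition R_uea ::
    "'n free_alg set \<Rightarrow> (real ^ 'n ^ 'n \<Rightarrow> complex) \<Rightarrow> real ^ 'n ^ 'n \<Rightarrow> complex" where
  "R_uea c u = (THE v. \<forall>p\<in>c. R_free p u = v)"


section \<open>The inclusion of dimension m in dimension m + 1\<close>

fun lower :: "'a option coord \<Rightarrow> 'a coord option" where
  "lower Time1 = Some Time1"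
| "lower Time2 = Some Time2"
| "lower Space1 = Some Space1"
| "lower Space2 = Some Space2"
| "lower (Space (Some j)) = Some (Space j)"
| "lower (Space None) = None"

definition block_emb :: "real \<Rightarrow> 'a::finite mat_m \<Rightarrow> 'a option mat_m" where
  "block_emb c g = (\<chi> a b. case (lower a, lower b) of
     (Some a', Some b') \<Rightarrow> g $ a' $ b' | (None, None) \<Rightarrow> c | _ \<Rightarrow> 0)"

abbreviation grp_emb :: "'a::finite mat_m \<Rightarrow> 'a option mat_m" where
  "grp_emb \<equiv> block_emb 1"

abbreviation lie_emb :: "'a::finite mat_m \<Rightarrow> 'a option mat_m" where
  "lie_emb \<equiv> block_emb 0"

definition pullback :: "('a::finite option mat_m \<Rightarrow> complex) \<Rightarrow> 'a mat_m \<Rightarrow> complex" where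
  "pullback u g = u (grp_emb g)"


section \<open>The families of differential operators\<close>

text \<open>The recursions determine the coefficients downwards from \<open>j = k\<close>; the auxiliary functions
  compute the coefficients with index \<open>j = k - i\<close>.\<close>

fun a_aux :: "nat \<Rightarrow> nat \<Rightarrow> complex \<Rightarrow> nat \<Rightarrow> complex" where
  "a_aux n k l 0 = 1"
| "a_aux n k l (Suc i) = - (of_nat k - of_nat i)
     * (of_nat n - 1 + 2 * l - 4 * of_nat k + 2 * (of_nat k - of_nat i))
     / ((of_nat i + 1) * (2 * of_nat i + 1)) * a_aux n k l i"

definition a_coeff :: "nat \<Rightarrow> nat \<Rightarrow> nat \<Rightarrow> complex \<Rightarrow> complex" where
  "a_coeff n k j l = a_aux n k l (k - j)"

fun b_aux :: "nat \<Rightarrow> nat \<Rightarrow> complex \<Rightarrow> nat \<Rightarrow> complex" where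
  "b_aux n k l 0 = 1"
| "b_aux n k l (Suc i) = - (of_nat k - of_nat i)
     * (of_nat n - 3 + 2 * l - 4 * of_nat k + 2 * (of_nat k - of_nat i))
     / ((of_nat i + 1) * (2 * of_nat i + 3)) * b_aux n k l i"

definition b_coeff :: "nat \<Rightarrow> nat \<Rightarrow> nat \<Rightarrow> complex \<Rightarrow> complex" where
  "b_coeff n k j l = b_aux n k l (k - j)"

lemma a_coeff_top: "a_coeff n k k l = 1"
  by (simp add: a_coeff_def)

lemma a_coeff_rec:
  assumes "1 \<le> j" "j \<le> k"
  shows "(of_nat k - of_nat j + 1) * (2 * of_nat k - 2 * of_nat j + 1) * a_coeff n k (j - 1) l
    + of_nat j * (of_nat n - 1 + 2 * l - 4 * of_nat k + 2 * of_nat j) * a_coeff n k j l = 0"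
proof -
  obtain i where i: "k = j + i"
    using assms(2) le_Suc_ex by blast
  have "k - (j - 1) = Suc i" "k - j = i"
    using assms(1) i by auto
  moreover have "(1 + of_nat i :: complex) \<noteq> 0" "(1 + 2 * of_nat i :: complex) \<noteq> 0"
    using of_nat_eq_0_iff[of "i + 1", where 'a = complex]
      of_nat_eq_0_iff[of "2 * i + 1", where 'a = complex] by auto
  ultimately show ?thesis
    by (simp add: a_coeff_def i add.commute[of _ 1])
qed

lemma b_coeff_top: "b_coeff n k k l = 1"
  by (simp add: b_coeff_def)

lemma b_coeff_rec:
  assumes "1 \<le> j" "j \<le> k"
  shows "(of_nat k - of_nat j + 1) * (2 * of_nat k - 2 * of_nat j + 3) * b_coeff n k (j - 1) l
    + of_nat j * (of_nat n - 3 + 2 * l - 4 * of_nat k + 2 * of_nat j) * b_coeff n k j l = 0"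
proof -
  obtain i where i: "k = j + i"
    using assms(2) le_Suc_ex by blast
  have "k - (j - 1) = Suc i" "k - j = i"
    using assms(1) i by auto
  moreover have "(1 + of_nat i :: complex) \<noteq> 0" "(2 * of_nat i + 3 :: complex) \<noteq> 0"
    using of_nat_eq_0_iff[of "i + 1", where 'a = complex]
      of_nat_eq_0_iff[of "2 * i + 3", where 'a = complex] by auto
  ultimately show ?thesis
    by (simp add: b_coeff_def i add.commute[of _ 1])
qed

definition Delta :: "'a::finite option coord free_alg" where
  "Delta = - (gen (lie_emb (Q1m :: 'a mat_m)))\<^sup>2 + (gen (lie_emb (Q2m :: 'a mat_m)))\<^sup>2
     + (\<Sum>j\<in>UNIV. (gen (lie_emb (Ym (j :: 'a))))\<^sup>2)"

definition T_last :: "'a::finite option coord free_alg" where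
  "T_last = gen (Ym None)"

text \<open>The element \<open>\<D>\<^sub>N\<^sup>0(\<lambda>)\<close> of \<open>\<U>(\<gg>\<^sub>n\<^sub>+\<^sub>1)\<close>, where \<open>k = N div 2\<close>.\<close>

definition D0 :: "nat \<Rightarrow> nat \<Rightarrow> complex \<Rightarrow> 'a::finite option coord free_alg set" where
  "D0 n N l = (let k = N div 2 in uea_class \<gg>
     (if even N
      then \<Sum>j\<le>k. scal (a_coeff n k j l) * Delta ^ j * T_last ^ (2 * k - 2 * j)
      else \<Sum>j\<le>k. scal (b_coeff n k j l) * Delta ^ j * T_last ^ (2 * k - 2 * j + 1)))"

definition polynomial_family :: "(real ^ 'n ^ 'n) set \<Rightarrow> (complex \<Rightarrow> 'n free_alg set) \<Rightarrow> bool" where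
  "polynomial_family \<hh> D \<longleftrightarrow> (\<exists>d c. (\<forall>i. c i \<in> carrier (free_algebra \<hh>)) \<and>
     (\<forall>l. D l = uea_class \<hh> (\<Sum>i\<le>d. scal (l ^ i) * c i)))"

definition D_op :: "nat \<Rightarrow> nat \<Rightarrow> complex \<Rightarrow>
    ('a::finite option mat_m \<Rightarrow> complex) \<Rightarrow> 'a mat_m \<Rightarrow> complex" where
  "D_op n N l u = pullback (R_uea (D0 n N l) u)"


section \<open>The Einstein universe and the compact realization\<close>

definition cone :: "'a::finite vec_m set" where
  "cone = {x. qform x = 0}"

definition ray :: "'a::finite vec_m \<Rightarrow> 'a vec_m set" where
  "ray x = {t *\<^sub>R x | t. 0 \<le> t}"

definition Ein :: "'a::finite vec_m set set" where
  "Ein = {span {x} | x. x \<in> cone \<and> x \<noteq> 0}"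

definition Ein_hat :: "'a::finite vec_m set set" where
  "Ein_hat = {ray x | x. x \<in> cone \<and> x \<noteq> 0}"

definition base_vec :: "'a::finite vec_m" where
  "base_vec = axis Time1 1 + axis Space2 1"

text \<open>The two situations (lines, rays) are treated together: \<open>L\<close> is \<open>M_grp\<close> or \<open>M_hat\<close>, \<open>E\<close> is
  \<open>Ein\<close> or \<open>Ein_hat\<close>, and \<open>e\<close> is the base point, i.e. the line or ray through \<open>base_vec\<close>.
  A function \<open>f\<close> on \<open>E\<close> is identified with the function \<open>k \<mapsto> f (k e)\<close> on \<open>K_grp\<close>; the smooth structure
  of \<open>E\<close> is that of the homogeneous space \<open>K_grp / (K_grp \<inter> L)\<close>.\<close>

definition K_lift :: "'a::finite vec_m set \<Rightarrow> ('a vec_m set \<Rightarrow> complex) \<Rightarrow> 'a mat_m \<Rightarrow> complex" where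
  "K_lift e f k = (if k \<in> K_grp then f ((*v) k ` e) else 0)"

definition C_inf_E :: "'a::finite vec_m set set \<Rightarrow> 'a vec_m set \<Rightarrow> ('a vec_m set \<Rightarrow> complex) set" where
  "C_inf_E E e = {f. (\<forall>x. x \<notin> E \<longrightarrow> f x = 0) \<and> K_lift e f \<in> C_inf K_grp}"

definition K_descend ::
    "'a::finite vec_m set set \<Rightarrow> 'a vec_m set \<Rightarrow> ('a mat_m \<Rightarrow> complex) \<Rightarrow> 'a vec_m set \<Rightarrow> complex" where
  "K_descend E e = inv_into (C_inf_E E e) (K_lift e)"

definition delta ::
    "'a::finite vec_m set set \<Rightarrow> 'a vec_m set \<Rightarrow> ('a mat_m \<Rightarrow> complex) \<Rightarrow> 'a vec_m set \<Rightarrow> complex" where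
  "delta E e u = K_descend E e (\<lambda>k. if k \<in> K_grp then u k else 0)"

text \<open>A choice of \<open>g = \<kappa>(g) \<mu>(g) a(g) \<eta>(g)\<close>.\<close>

definition decomp :: "'a::finite mat_m set \<Rightarrow> 'a mat_m \<Rightarrow> 'a mat_m \<times> 'a mat_m \<times> 'a mat_m \<times> 'a mat_m" where
  "decomp L g = (SOME (k, m, a, \<eta>). k \<in> K_grp \<and> m \<in> L \<and> a \<in> A_grp \<and> \<eta> \<in> Np_grp \<and>
     g = k ** m ** a ** \<eta>)"

definition \<kappa> :: "'a::finite mat_m set \<Rightarrow> 'a mat_m \<Rightarrow> 'a mat_m" where
  "\<kappa> L g = fst (decomp L g)"

definition a_part :: "'a::finite mat_m set \<Rightarrow> 'a mat_m \<Rightarrow> 'a mat_m" where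
  "a_part L g = fst (snd (snd (decomp L g)))"

definition pi_c :: "'a::finite mat_m set \<Rightarrow> 'a vec_m set set \<Rightarrow> 'a vec_m set \<Rightarrow> complex \<Rightarrow>
    'a mat_m \<Rightarrow> ('a vec_m set \<Rightarrow> complex) \<Rightarrow> 'a vec_m set \<Rightarrow> complex" where
  "pi_c L E e l g f = K_descend E e (\<lambda>k. if k \<in> K_grp
     then K_lift e f (\<kappa> L (matrix_inv g ** k)) * \<xi> l (a_part L (matrix_inv g ** k)) else 0)"

text \<open>\<open>C\<^sup>\<infinity>(E)\<^sub>\<lambda>\<close>, for lines and for rays, is the space \<open>C_inf_Ein\<close> resp. \<open>C_inf_Ein_hat\<close> with the
  action \<open>pi_Ein \<lambda>\<close> resp. \<open>pi_Ein_hat \<lambda>\<close>.\<close>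

definition C_inf_Ein :: "('a::finite vec_m set \<Rightarrow> complex) set" where
  "C_inf_Ein = C_inf_E Ein (span {base_vec})"

definition C_inf_Ein_hat :: "('a::finite vec_m set \<Rightarrow> complex) set" where
  "C_inf_Ein_hat = C_inf_E Ein_hat (ray base_vec)"

definition pi_Ein ::
    "complex \<Rightarrow> 'a::finite mat_m \<Rightarrow> ('a vec_m set \<Rightarrow> complex) \<Rightarrow> 'a vec_m set \<Rightarrow> complex" where
  "pi_Ein = pi_c M_grp Ein (span {base_vec})"

definition pi_Ein_hat ::
    "complex \<Rightarrow> 'a::finite mat_m \<Rightarrow> ('a vec_m set \<Rightarrow> complex) \<Rightarrow> 'a vec_m set \<Rightarrow> complex" where
  "pi_Ein_hat = pi_c M_hat Ein_hat (ray base_vec)"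

definition delta_Ein :: "('a::finite mat_m \<Rightarrow> complex) \<Rightarrow> 'a vec_m set \<Rightarrow> complex" where
  "delta_Ein = delta Ein (span {base_vec})"

definition delta_Ein_hat :: "('a::finite mat_m \<Rightarrow> complex) \<Rightarrow> 'a vec_m set \<Rightarrow> complex" where
  "delta_Ein_hat = delta Ein_hat (ray base_vec)"

definition Dc_op :: "nat \<Rightarrow> nat \<Rightarrow> complex \<Rightarrow>
    ('a::finite option vec_m set \<Rightarrow> complex) \<Rightarrow> 'a vec_m set \<Rightarrow> complex" where
  "Dc_op n N l = delta_Ein \<circ> D_op n N l \<circ> inv_into (Ind M_grp l) delta_Ein"

definition Dc_hat_op :: "nat \<Rightarrow> nat \<Rightarrow> complex \<Rightarrow>
    ('a::finite option vec_m set \<Rightarrow> complex) \<Rightarrow> 'a vec_m set \<Rightarrow> complex" where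
  "Dc_hat_op n N l = delta_Ein_hat \<circ> D_op n N l \<circ> inv_into (Ind M_hat l) delta_Ein_hat"

definition equivariant_operator :: "'g set \<Rightarrow>
    ('x \<Rightarrow> complex) set \<Rightarrow> ('g \<Rightarrow> ('x \<Rightarrow> complex) \<Rightarrow> 'x \<Rightarrow> complex) \<Rightarrow>
    ('y \<Rightarrow> complex) set \<Rightarrow> ('g \<Rightarrow> ('y \<Rightarrow> complex) \<Rightarrow> 'y \<Rightarrow> complex) \<Rightarrow>
    (('x \<Rightarrow> complex) \<Rightarrow> 'y \<Rightarrow> complex) \<Rightarrow> bool" where
  "equivariant_operator G V \<rho> W \<sigma> T \<longleftrightarrow>
     T \<in> V \<rightarrow> W \<and>
     (\<forall>f\<in>V. \<forall>h\<in>V. \<forall>c d. T (\<lambda>x. c * f x + d * h x) = (\<lambda>y. c * T f y + d * T h y)) \<and>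
     (\<forall>g\<in>G. \<forall>f\<in>V. T (\<rho> g f) = \<sigma> g (T f))"

end

theory Submission
  imports Defs
begin

text \<open>Write \<open>e\<close> for the isotropic base vector, \<open>f\<close> for the isotropic vector opposite to it (\<open>opp_vec\<close>),
  \<open>W\<close> for the orthogonal complement of both (\<open>mid_space\<close>), \<open>B\<close> for the bilinear form and
  \<open>a \<and> b\<close> for the skew operator \<open>z \<mapsto> B(b,z) a - B(a,z) b\<close>. In these terms \<open>\<nn>\<^sup>-\<close> consists of the
  operators \<open>f \<and> v\<close>, \<open>\<nn>\<^sup>+\<close> of the \<open>e \<and> v\<close> and \<open>\<mm>\<close> is spanned by the \<open>v \<and> w\<close>, for \<open>v, w\<close> in \<open>W\<close>, while
  \<open>H = -1/2 e \<and> f\<close>. Every bracket and every conjugation needed below is an instance of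
  \<open>g (a \<and> b) g\<^sup>-\<^sup>1 = ga \<and> gb\<close> or of its infinitesimal version.

  A function in an induced module satisfies \<open>R(X) u = 0\<close> for \<open>X\<close> in \<open>\<mm>\<close> and \<open>\<nn>\<^sup>+\<close> and \<open>R(H) u = \<lambda> u\<close>.
  To see that the restriction of \<open>R(\<D>\<^sub>N) u\<close> to the smaller group is again induced, the three factors
  of its parabolic subgroup are treated separately. An element of \<open>M A\<close> with \<open>p e = c e\<close> and
  \<open>p f = c\<^sup>-\<^sup>1 f\<close> conjugates \<open>f \<and> v\<close> into \<open>c\<^sup>-\<^sup>1 f \<and> pv\<close>; it fixes the last basis vector and is
  orthogonal on the rest of \<open>W\<close>, hence multiplies \<open>\<Delta>\<^sup>s T\<^sup>k\<close> by \<open>c\<close> to the power \<open>-(2s + k)\<close>. This gives the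
  weight \<open>\<lambda> - N\<close>, and since \<open>c\<close> is negative for \<open>-1\<close>, it also shows why \<open>N\<close> has to be even for lines
  (\<open>D_levi\<close>). The group \<open>N\<^sup>+\<close> is the exponential of \<open>\<nn>\<^sup>+\<close>, so for it one needs only that
  \<open>x\<^sub>w = R(e \<and> w)\<close> annihilates \<open>R(\<D>\<^sub>N) u\<close>. Moving \<open>x\<^sub>w\<close> to the right past \<open>\<Delta>\<close> and \<open>T\<close> yields, with
  \<open>y\<^sub>w = R(f \<and> w)\<close>,
  \<open>x\<^sub>w \<Delta>\<^sup>s T\<^sup>k u = 2s (2\<lambda> + n - 1 - 2k - 2s) y\<^sub>w \<Delta>\<^sup>s\<^sup>-\<^sup>1 T\<^sup>k u + k (k - 1) y\<^sub>w \<Delta>\<^sup>s T\<^sup>k\<^sup>-\<^sup>2 u\<close>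
  (\<open>x_Q\<close>), and the recursion for the coefficients is exactly the condition that neighbouring terms of
  the sum cancel (\<open>x_op_kills\<close>).

  For the compact picture the parabolic subgroup is identified with the stabilizer of the line or ray
  of \<open>e\<close> (\<open>parabolic_decompose\<close>). The substance of this is \<open>M_hat_eq\<close>: the stabilizer of \<open>e\<close> and \<open>f\<close>
  is a Lorentz group, and rotations and boosts reduce each of its elements to a product of \<open>w\<^sub>1\<close> and
  \<open>w\<^sub>2\<close>. Induced functions are then homogeneous functions on the light cone (\<open>Ind_iff\<close>). The compact
  group is transitive on the rays, with smooth local sections built from reflections
  (\<open>smooth_local_section\<close>), so restriction to it is a bijection onto the smooth functions on the
  Einstein universe, and the transported action is left translation (\<open>pi_c_delta\<close>). Left translation
  commutes with the operators \<open>R\<close>, which gives the equivariance.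

  The analytic input is elementary: a coinductive calculus of smooth functions, the symmetry of second
  derivatives, which makes \<open>R\<close> a representation of the Lie algebra and hence of its enveloping
  algebra, and the matrix exponential as the solution of a linear differential equation.\<close>

section \<open>Smooth functions\<close>

text \<open>A class of functions that is closed under directional derivatives consists of smooth functions: the
  iterated derivatives can be chosen inside the class. The operations on smooth functions below are treated by
  exhibiting such a class.\<close>

lemma smooth_on_coinduct:
  assumes "f \<in> C"
    and "\<And>g. g \<in> C \<Longrightarrow> \<exists>g'. (\<forall>x\<in>U. (g has_derivative g' x) (at x)) \<and> (\<forall>v. (\<lambda>x. g' x v) \<in> C)"
  shows "smooth_on U f"
proof -
  have "\<forall>g\<in>C. \<exists>g'. (\<forall>x\<in>U. (g has_derivative g' x) (at x)) \<and> (\<forall>v. (\<lambda>x. g' x v) \<in> C)"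
    using assms(2) by blast
  then obtain d where d: "\<forall>g\<in>C. (\<forall>x\<in>U. (g has_derivative d g x) (at x)) \<and> (\<forall>v. (\<lambda>x. d g x v) \<in> C)"
    by (rule bchoice[THEN exE])
  define D where "D vs = foldr (\<lambda>v g x. d g x v) vs f" for vs
  have DC: "D vs \<in> C" for vs
    by (induct vs) (use d assms(1) in \<open>auto simp: D_def\<close>)
  have "(D vs has_derivative (\<lambda>v. D (v # vs) x)) (at x)" if "x \<in> U" for vs x
  proof -
    have "(D vs has_derivative d (D vs) x) (at x)"
      using DC that d by blast
    then show ?thesis
      by (simp add: D_def)
  qed
  then show ?thesis
    unfolding smooth_on_def by (intro exI[of _ D]) (simp add: D_def[of "[]"])
qed

lemma smooth_on_derivative:
  assumes "smooth_on U f" "open U"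
  obtains f' where "\<And>x. x \<in> U \<Longrightarrow> (f has_derivative f' x) (at x)"
    and "\<And>v. smooth_on U (\<lambda>x. f' x v)"
proof -
  obtain D where D: "\<And>x. x \<in> U \<Longrightarrow> D [] x = f x"
    "\<And>vs x. x \<in> U \<Longrightarrow> (D vs has_derivative (\<lambda>v. D (v # vs) x)) (at x)"
    using assms(1) unfolding smooth_on_def by blast
  show thesis
  proof (rule that)
    show "(f has_derivative (\<lambda>v. D [v] x)) (at x)" if "x \<in> U" for x
      using has_derivative_transform_within_open[OF D(2)[OF that, of "[]"] assms(2) that D(1)] .
    show "smooth_on U (\<lambda>x. D [v] x)" for v
      unfolding smooth_on_def using D(2) by (intro exI[of _ "\<lambda>vs. D (vs @ [v])"]) simp
  qed
qed

lemma smooth_on_subset: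
  assumes "smooth_on U f" "V \<subseteq> U"
  shows "smooth_on V f"
proof -
  obtain D where "\<forall>x\<in>U. D [] x = f x" "\<forall>vs. \<forall>x\<in>U. (D vs has_derivative (\<lambda>v. D (v # vs) x)) (at x)"
    using assms(1) unfolding smooth_on_def by blast
  then show ?thesis
    unfolding smooth_on_def using assms(2) by (intro exI[of _ D]) blast
qed

lemma smooth_on_cong: "smooth_on U f \<Longrightarrow> (\<And>x. x \<in> U \<Longrightarrow> f x = g x) \<Longrightarrow> smooth_on U g"
  unfolding smooth_on_def by (elim exE, rule exI) auto

text \<open>The product and chain rules produce sums, so a class as in \<open>smooth_on_coinduct\<close> is closed only up
  to finite sums. As differentiation is linear, this is enough.\<close>

inductive_set sums_of :: "('a \<Rightarrow> 'b::real_normed_vector) set \<Rightarrow> ('a \<Rightarrow> 'b) set" for C where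
  zero: "(\<lambda>x. 0) \<in> sums_of C"
| base: "g \<in> C \<Longrightarrow> g \<in> sums_of C"
| add: "g \<in> sums_of C \<Longrightarrow> h \<in> sums_of C \<Longrightarrow> (\<lambda>x. g x + h x) \<in> sums_of C"

lemma sums_of_sum:
  "(\<And>i. i \<in> I \<Longrightarrow> g i \<in> sums_of C) \<Longrightarrow> (\<lambda>x. \<Sum>i\<in>I. g i x) \<in> sums_of C"
  by (induct I rule: infinite_finite_induct) (auto intro: sums_of.intros)

lemma smooth_on_coinduct_sums:
  assumes "f \<in> sums_of C"
    and C: "\<And>g. g \<in> C \<Longrightarrow> \<exists>g'. (\<forall>x\<in>U. (g has_derivative g' x) (at x)) \<and> (\<forall>v. (\<lambda>x. g' x v) \<in> sums_of C)"
  shows "smooth_on U f"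
proof (rule smooth_on_coinduct[OF assms(1)])
  show "\<exists>g'. (\<forall>x\<in>U. (g has_derivative g' x) (at x)) \<and> (\<forall>v. (\<lambda>x. g' x v) \<in> sums_of C)"
    if "g \<in> sums_of C" for g
    using that
  proof induct
    case zero
    then show ?case
      by (intro exI[of _ "\<lambda>x v. 0"]) (auto intro: sums_of.zero)
  next
    case (base g)
    then show ?case by (rule C)
  next
    case (add g h)
    then obtain g' h' where
      "\<And>x. x \<in> U \<Longrightarrow> (g has_derivative g' x) (at x)" "\<And>v. (\<lambda>x. g' x v) \<in> sums_of C"
      "\<And>x. x \<in> U \<Longrightarrow> (h has_derivative h' x) (at x)" "\<And>v. (\<lambda>x. h' x v) \<in> sums_of C"
      by blast
    then show ?case
      by (intro exI[of _ "\<lambda>x v. g' x v + h' x v"]) (auto intro: sums_of.add has_derivative_add)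
  qed
qed

lemma smooth_on_const [intro, simp]: "smooth_on U (\<lambda>x. c)"
proof (rule smooth_on_coinduct[of _ "range (\<lambda>c x. c)"])
  show "\<exists>g'. (\<forall>x\<in>U. (g has_derivative g' x) (at x)) \<and> (\<forall>v. (\<lambda>x. g' x v) \<in> range (\<lambda>c x. c))"
    if "g \<in> range (\<lambda>c x. c)" for g :: "'a \<Rightarrow> 'b"
    using that by (intro exI[of _ "\<lambda>x v. 0"]) auto
qed simp

lemma smooth_on_bounded_linear:
  assumes "bounded_linear L"
  shows "smooth_on U L"
proof (rule smooth_on_coinduct[of _ "{L} \<union> range (\<lambda>c x. c)"])
  show "\<exists>g'. (\<forall>x\<in>U. (g has_derivative g' x) (at x)) \<and> (\<forall>v. (\<lambda>x. g' x v) \<in> {L} \<union> range (\<lambda>c x. c))"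
    if "g \<in> {L} \<union> range (\<lambda>c x. c)" for g
    using that
  proof
    assume "g \<in> {L}"
    then show ?thesis
      using assms by (intro exI[of _ "\<lambda>x v. L v"]) (auto intro: bounded_linear_imp_has_derivative)
  qed (auto intro!: exI[of _ "\<lambda>x v. 0"])
qed simp

lemma smooth_on_add [intro]:
  assumes "smooth_on U f" "smooth_on U g" "open U"
  shows "smooth_on U (\<lambda>x. f x + g x)"
proof (rule smooth_on_coinduct_sums[of _ "Collect (smooth_on U)"])
  show "(\<lambda>x. f x + g x) \<in> sums_of (Collect (smooth_on U))"
    using assms by (intro sums_of.add sums_of.base) auto
  show "\<exists>h'. (\<forall>x\<in>U. (h has_derivative h' x) (at x)) \<and> (\<forall>v. (\<lambda>x. h' x v) \<in> sums_of (Collect (smooth_on U)))"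
    if h: "h \<in> Collect (smooth_on U)" for h :: "'a \<Rightarrow> 'b"
  proof -
    obtain h' where "\<And>x. x \<in> U \<Longrightarrow> (h has_derivative h' x) (at x)" "\<And>v. smooth_on U (\<lambda>x. h' x v)"
      using smooth_on_derivative[OF _ assms(3)] h by blast
    then show ?thesis
      by (intro exI[of _ h']) (auto intro: sums_of.base)
  qed
qed

lemma smooth_on_sum [intro]:
  assumes "\<And>i. i \<in> I \<Longrightarrow> smooth_on U (f i)" "open U"
  shows "smooth_on U (\<lambda>x. \<Sum>i\<in>I. f i x)"
  using assms(1) by (induct I rule: infinite_finite_induct) (auto intro: smooth_on_add assms(2))

lemma smooth_on_bilinear:
  assumes bl: "bounded_bilinear pr" and "smooth_on U f" "smooth_on U g" "open U"
  shows "smooth_on U (\<lambda>x. pr (f x) (g x))"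
proof -
  define C where "C = {\<lambda>x. pr (f x) (g x) | f g. smooth_on U f \<and> smooth_on U g}"
  have CI: "(\<lambda>x. pr (f x) (g x)) \<in> C" if "smooth_on U f" "smooth_on U g" for f g
    using that by (auto simp: C_def)
  show ?thesis
  proof (rule smooth_on_coinduct_sums[of _ C])
    show "\<exists>h'. (\<forall>x\<in>U. (h has_derivative h' x) (at x)) \<and> (\<forall>v. (\<lambda>x. h' x v) \<in> sums_of C)"
      if hC: "h \<in> C" for h
    proof -
      obtain f g where h: "h = (\<lambda>x. pr (f x) (g x))" "smooth_on U f" "smooth_on U g"
        using hC by (auto simp: C_def)
      obtain f' where f': "\<And>x. x \<in> U \<Longrightarrow> (f has_derivative f' x) (at x)" "\<And>v. smooth_on U (\<lambda>x. f' x v)"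
        using smooth_on_derivative[OF h(2) assms(4)] by blast
      obtain g' where g': "\<And>x. x \<in> U \<Longrightarrow> (g has_derivative g' x) (at x)" "\<And>v. smooth_on U (\<lambda>x. g' x v)"
        using smooth_on_derivative[OF h(3) assms(4)] by blast
      show ?thesis
        unfolding h(1)
        by (intro exI[of _ "\<lambda>x v. pr (f x) (g' x v) + pr (f' x v) (g x)"] conjI ballI allI
            bounded_bilinear.FDERIV[OF bl] sums_of.add sums_of.base CI f' g' h(2,3))
    qed
  qed (intro sums_of.base CI assms)
qed

lemmas smooth_on_scaleR [intro] = smooth_on_bilinear[OF bounded_bilinear_scaleR]
lemmas smooth_on_mult [intro] = smooth_on_bilinear[OF bounded_bilinear_mult]

lemma smooth_on_bounded_linear_comp:
  assumes "bounded_linear L" "smooth_on U f" "open U"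
  shows "smooth_on U (\<lambda>x. L (f x))"
  using smooth_on_bilinear[OF bounded_bilinear.comp[OF bounded_bilinear_scaleR bounded_linear_ident assms(1)]
      smooth_on_const assms(2,3), of 1] by simp

lemmas smooth_on_uminus [intro] = smooth_on_bounded_linear_comp[OF bounded_linear_minus[OF bounded_linear_ident]]

lemma smooth_on_diff [intro]:
  assumes "smooth_on U f" "smooth_on U g" "open U"
  shows "smooth_on U (\<lambda>x. f x - g x)"
  using smooth_on_add[OF assms(1) smooth_on_uminus[OF assms(2,3)] assms(3)] by simp

lemma smooth_on_vec_lambda:
  assumes "\<And>i. smooth_on U (\<lambda>x. f x i)" "open U"
  shows "smooth_on U (\<lambda>x. \<chi> i. (f x i :: 'b::euclidean_space))"
proof -
  have ax: "bounded_linear (axis i :: 'b \<Rightarrow> 'b ^ 'n)" for i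
    by (auto simp: linear_conv_bounded_linear[symmetric] linear_iff axis_def vec_eq_iff)
  have "smooth_on U (\<lambda>x. \<Sum>i\<in>UNIV. axis i (f x i))"
    by (intro smooth_on_sum smooth_on_bounded_linear_comp[OF ax] assms)
  moreover have "(\<Sum>i\<in>UNIV. axis i (f x i)) = (\<chi> i. f x i)" for x
    by (simp add: vec_eq_iff axis_def)
  ultimately show ?thesis
    by simp
qed

text \<open>In coordinates, a derivative of \<open>\<phi> \<cdot> (w \<circ> k)\<close> is a sum of terms of the same shape, the new factors
  \<open>\<phi>\<close> absorbing the derivatives of \<open>k\<close>. This avoids any formula for the higher derivatives of a
  composition.\<close>

lemma smooth_on_compose:
  fixes f :: "'b::euclidean_space \<Rightarrow> 'c::real_normed_vector" and k :: "'a::real_normed_vector \<Rightarrow> 'b"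
  assumes "smooth_on V f" "open V" "smooth_on U k" "open U" "k ` U \<subseteq> V"
  shows "smooth_on U (\<lambda>x. f (k x))"
proof -
  define C where "C = {\<lambda>x. \<phi> x *\<^sub>R w (k x) | \<phi> w. smooth_on U \<phi> \<and> smooth_on V (w :: 'b \<Rightarrow> 'c)}"
  have CI: "(\<lambda>x. \<phi> x *\<^sub>R w (k x)) \<in> C" if "smooth_on U \<phi>" "smooth_on V w" for \<phi> w
    using that by (auto simp: C_def)
  obtain k' where k': "\<And>x. x \<in> U \<Longrightarrow> (k has_derivative k' x) (at x)" "\<And>v. smooth_on U (\<lambda>x. k' x v)"
    using smooth_on_derivative[OF assms(3,4)] by blast
  show ?thesis
  proof (rule smooth_on_coinduct_sums[of _ C])
    show "\<exists>h'. (\<forall>x\<in>U. (h has_derivative h' x) (at x)) \<and> (\<forall>v. (\<lambda>x. h' x v) \<in> sums_of C)"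
      if hC: "h \<in> C" for h
    proof -
      obtain \<phi> w where h: "h = (\<lambda>x. \<phi> x *\<^sub>R w (k x))" "smooth_on U \<phi>" "smooth_on V w"
        using hC by (auto simp: C_def)
      obtain \<phi>' where \<phi>': "\<And>x. x \<in> U \<Longrightarrow> (\<phi> has_derivative \<phi>' x) (at x)" "\<And>v. smooth_on U (\<lambda>x. \<phi>' x v)"
        using smooth_on_derivative[OF h(2) assms(4)] by blast
      obtain w' where w': "\<And>x. x \<in> V \<Longrightarrow> (w has_derivative w' x) (at x)" "\<And>v. smooth_on V (\<lambda>x. w' x v)"
        using smooth_on_derivative[OF h(3) assms(2)] by blast
      define h' where "h' x v = (\<Sum>b\<in>Basis. (\<phi> x * (k' x v \<bullet> b)) *\<^sub>R w' (k x) b) + \<phi>' x v *\<^sub>R w (k x)" for x v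
      have "(h has_derivative h' x) (at x)" if x: "x \<in> U" for x
      proof -
        have kx: "k x \<in> V"
          using x assms(5) by blast
        have "((\<lambda>x. w (k x)) has_derivative (\<lambda>v. w' (k x) (k' x v))) (at x)"
          using has_derivative_compose[OF k'(1)[OF x] w'(1)[OF kx]] .
        from has_derivative_scaleR[OF \<phi>'(1)[OF x] this]
        have "(h has_derivative (\<lambda>v. \<phi> x *\<^sub>R w' (k x) (k' x v) + \<phi>' x v *\<^sub>R w (k x))) (at x)"
          by (simp add: h(1))
        moreover have "w' (k x) (k' x v) = (\<Sum>b\<in>Basis. (k' x v \<bullet> b) *\<^sub>R w' (k x) b)" for v
        proof -
          have l: "linear (w' (k x))"
            using w'(1)[OF kx] has_derivative_linear by blast
          have "w' (k x) (k' x v) = w' (k x) (\<Sum>b\<in>Basis. (k' x v \<bullet> b) *\<^sub>R b)"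
            by (simp add: euclidean_representation)
          then show ?thesis
            by (simp add: linear_sum[OF l] linear_scale[OF l])
        qed
        ultimately show ?thesis
          by (simp add: h'_def[abs_def] scaleR_sum_right)
      qed
      moreover have "(\<lambda>x. h' x v) \<in> sums_of C" for v
        unfolding h'_def
        by (intro sums_of.add sums_of_sum sums_of.base CI smooth_on_mult
             smooth_on_bounded_linear_comp[OF bounded_linear_inner_left] h \<phi>' w' k' assms)
      ultimately show ?thesis
        by blast
    qed
    show "(\<lambda>x. f (k x)) \<in> sums_of C"
      using CI[of "\<lambda>x. 1" f] assms(1) by (intro sums_of.base) simp
  qed
qed

lemma smooth_on_ln: "smooth_on {0<..} (ln :: real \<Rightarrow> real)"
proof (rule smooth_on_coinduct[of _ "{ln} \<union> {\<lambda>x. c * inverse x ^ n | c n. True}"])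
  show "\<exists>g'. (\<forall>x\<in>{0<..}. (g has_derivative g' x) (at x)) \<and>
      (\<forall>v. (\<lambda>x. g' x v) \<in> {ln} \<union> {\<lambda>x. c * inverse x ^ n | c n. True})"
    if "g \<in> {ln} \<union> {\<lambda>x. c * inverse x ^ n | c n. True}" for g :: "real \<Rightarrow> real"
    using that
  proof
    assume "g \<in> {ln}"
    then have "\<forall>x\<in>{0<..}. (g has_derivative (\<lambda>v. v * inverse x ^ 1)) (at x)"
      by (auto intro!: derivative_eq_intros simp: divide_inverse)
    then show ?thesis
      by (intro exI[of _ "\<lambda>x v. v * inverse x ^ 1"]) blast
  next
    assume "g \<in> {\<lambda>x. c * inverse x ^ n | c n. True}"
    then obtain c n where g: "g = (\<lambda>x. c * inverse x ^ n)" by blast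
    have "\<forall>x\<in>{0<..}. (g has_derivative (\<lambda>v. (- (c * of_nat n * v)) * inverse x ^ (Suc n))) (at x)"
    proof
      fix x :: real assume "x \<in> {0<..}"
      then have "((\<lambda>x. c * inverse x ^ n) has_field_derivative c * (of_nat n * inverse x ^ (n - Suc 0) * - (inverse x * inverse x))) (at x)"
        by (auto intro!: derivative_eq_intros)
      also have "c * (of_nat n * inverse x ^ (n - Suc 0) * - (inverse x * inverse x)) = - (c * of_nat n) * inverse x ^ Suc n"
        by (cases n) (simp_all only: power_Suc diff_Suc_Suc minus_nat.diff_0, simp_all add: mult_ac)
      finally show "(g has_derivative (\<lambda>v. (- (c * of_nat n * v)) * inverse x ^ (Suc n))) (at x)"
        unfolding g has_field_derivative_def
        by (rule has_derivative_eq_rhs) (simp add: fun_eq_iff mult_ac)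
    qed
    then show ?thesis
      by (intro exI[of _ "\<lambda>x v. (- (c * of_nat n * v)) * inverse x ^ (Suc n)"]) blast
  qed
qed simp

lemma smooth_on_exp_of_real: "smooth_on UNIV (\<lambda>t. exp (l * of_real t) :: complex)"
proof (rule smooth_on_coinduct[of _ "{\<lambda>t. c * exp (l * of_real t) | c. True}"])
  show "\<exists>g'. (\<forall>x\<in>UNIV. (g has_derivative g' x) (at x)) \<and>
      (\<forall>v. (\<lambda>x. g' x v) \<in> {\<lambda>t. c * exp (l * of_real t) | c. True})"
    if g: "g \<in> {\<lambda>t. c * exp (l * of_real t) | c. True}" for g :: "real \<Rightarrow> complex"
  proof -
    obtain c where c: "g = (\<lambda>t. c * exp (l * of_real t))" using g by blast
    have "(g has_derivative (\<lambda>v. (c * l * of_real v) * exp (l * of_real x))) (at x)" for x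
    proof -
      have "((\<lambda>z. c * exp (l * z)) has_field_derivative (c * l * exp (l * of_real x))) (at (of_real x))"
        by (auto intro!: derivative_eq_intros)
      then have "(g has_vector_derivative (c * l * exp (l * of_real x))) (at x)"
        unfolding c by (rule has_vector_derivative_real_field)
      then show ?thesis
        by (simp add: has_vector_derivative_def scaleR_conv_of_real mult_ac)
    qed
    then show ?thesis
      by (intro exI[of _ "\<lambda>x v. (c * l * of_real v) * exp (l * of_real x)"]) auto
  qed
qed (auto intro!: exI[of _ 1])

lemma smooth_on_exp: "smooth_on UNIV (exp :: real \<Rightarrow> real)"
  using smooth_on_bounded_linear_comp[OF bounded_linear_Re smooth_on_exp_of_real[of 1]]
  by (simp add: exp_of_real)

lemma smooth_on_powr_pos:
  assumes "smooth_on U f" "open U" "\<And>x. x \<in> U \<Longrightarrow> 0 < f x"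
  shows "smooth_on U (\<lambda>x. exp (l * of_real (ln (f x))) :: complex)"
  by (rule smooth_on_compose[OF smooth_on_exp_of_real _ smooth_on_compose[OF smooth_on_ln _ assms(1)]])
    (use assms in auto)

lemma smooth_on_inverse_pos:
  assumes "smooth_on U f" "open U" "\<And>x. x \<in> U \<Longrightarrow> 0 < f x"
  shows "smooth_on U (\<lambda>x. inverse (f x) :: real)"
proof (rule smooth_on_cong)
  show "smooth_on U (\<lambda>x. exp (- ln (f x)))"
    by (rule smooth_on_compose[OF smooth_on_exp _
          smooth_on_uminus[OF smooth_on_compose[OF smooth_on_ln _ assms(1)]]])
      (use assms in auto)
qed (use assms in \<open>simp add: exp_minus\<close>)

lemma smooth_on_sqrt_pos:
  assumes "smooth_on U f" "open U" "\<And>x. x \<in> U \<Longrightarrow> 0 < f x"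
  shows "smooth_on U (\<lambda>x. sqrt (f x))"
proof (rule smooth_on_cong)
  show "smooth_on U (\<lambda>x. exp ((1/2) * ln (f x)))"
    by (rule smooth_on_compose[OF smooth_on_exp _
          smooth_on_mult[OF smooth_on_const smooth_on_compose[OF smooth_on_ln _ assms(1)]]])
      (use assms in auto)
  show "exp ((1/2) * ln (f x)) = sqrt (f x)" if "x \<in> U" for x
    using assms(3)[OF that] by (simp add: powr_half_sqrt[symmetric] powr_def)
qed

subsection \<open>Symmetry of the second derivative\<close>

text \<open>The second difference over a small parallelogram is symmetric in \<open>v\<close> and \<open>w\<close>; two applications of
  the mean value theorem express it by the mixed derivative taken in one order. Comparing both orders
  and using continuity gives the symmetry of the second derivative.\<close>

lemma second_difference_mean_value:
  fixes f :: "'a::real_normed_vector \<Rightarrow> real"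
  assumes f': "\<And>y. y \<in> ball x d \<Longrightarrow> (f has_derivative f' y) (at y)"
    and f'': "\<And>y. y \<in> ball x d \<Longrightarrow> ((\<lambda>y. f' y v) has_derivative f'' y) (at y)"
    and h: "0 < h" "h * (norm v + norm w) < d"
  shows "\<exists>p\<in>ball x d. f (x + h *\<^sub>R v + h *\<^sub>R w) - f (x + h *\<^sub>R v) - f (x + h *\<^sub>R w) + f x = h * h * f'' p w"
proof -
  have inb: "x + s *\<^sub>R v + t *\<^sub>R w \<in> ball x d" if "0 \<le> s" "s \<le> h" "0 \<le> t" "t \<le> h" for s t
  proof -
    have "norm (s *\<^sub>R v + t *\<^sub>R w) \<le> s * norm v + t * norm w"
      using norm_triangle_ineq[of "s *\<^sub>R v" "t *\<^sub>R w"] that by simp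
    also have "\<dots> \<le> h * norm v + h * norm w"
      by (intro add_mono mult_right_mono) (use that in auto)
    also have "\<dots> < d"
      using h by (simp add: distrib_left)
    finally show ?thesis
      by (metis add.assoc add_diff_cancel_left' dist_commute dist_norm mem_ball)
  qed
  have lin: "((\<lambda>s. a + s *\<^sub>R b) has_derivative (\<lambda>r. r *\<^sub>R b)) (at s within S)" for a b :: 'a and s :: real and S
    by (auto intro!: derivative_eq_intros)
  define \<phi> where "\<phi> s = f (x + h *\<^sub>R w + s *\<^sub>R v) - f (x + s *\<^sub>R v)" for s
  have d\<phi>0: "(\<phi> has_derivative (\<lambda>r. f' (x + h *\<^sub>R w + s *\<^sub>R v) (r *\<^sub>R v) - f' (x + s *\<^sub>R v) (r *\<^sub>R v))) (at s)"
    if "0 \<le> s" "s \<le> h" for s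
    unfolding \<phi>_def using inb[of s h] inb[of s 0] that h(1)
    by (intro has_derivative_diff has_derivative_compose[OF lin f']) (simp_all add: add_ac)
  have d\<phi>: "(\<phi> has_derivative (\<lambda>r. r * (f' (x + h *\<^sub>R w + s *\<^sub>R v) v - f' (x + s *\<^sub>R v) v))) (at s)"
    if "0 \<le> s" "s \<le> h" for s
  proof -
    have "x + h *\<^sub>R w + s *\<^sub>R v \<in> ball x d" "x + s *\<^sub>R v \<in> ball x d"
      using inb[of s h] inb[of s 0] that h(1) by (simp_all add: add_ac)
    from this[THEN f', THEN has_derivative_linear]
    have "(\<lambda>r. f' (x + h *\<^sub>R w + s *\<^sub>R v) (r *\<^sub>R v) - f' (x + s *\<^sub>R v) (r *\<^sub>R v))
        = (\<lambda>r. r * (f' (x + h *\<^sub>R w + s *\<^sub>R v) v - f' (x + s *\<^sub>R v) v))"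
      by (simp add: linear_cmul right_diff_distrib)
    then show ?thesis
      using d\<phi>0[OF that] by simp
  qed
  obtain \<xi> where \<xi>: "0 < \<xi>" "\<xi> < h" "\<phi> h - \<phi> 0 = (h - 0) * (f' (x + h *\<^sub>R w + \<xi> *\<^sub>R v) v - f' (x + \<xi> *\<^sub>R v) v)"
    using mvt[OF h(1), of \<phi> "\<lambda>s r. r * (f' (x + h *\<^sub>R w + s *\<^sub>R v) v - f' (x + s *\<^sub>R v) v)"] d\<phi>
    by (metis (no_types, lifting) continuous_at_imp_continuous_on atLeastAtMost_iff has_derivative_continuous less_imp_le)
  define \<psi> where "\<psi> t = f' (x + \<xi> *\<^sub>R v + t *\<^sub>R w) v" for t
  have d\<psi>: "(\<psi> has_derivative (\<lambda>r. r * f'' (x + \<xi> *\<^sub>R v + t *\<^sub>R w) w)) (at t)"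
    if "0 \<le> t" "t \<le> h" for t
  proof -
    have i: "x + \<xi> *\<^sub>R v + t *\<^sub>R w \<in> ball x d"
      using inb[of \<xi> t] that \<xi> by simp
    have "(\<psi> has_derivative (\<lambda>r. f'' (x + \<xi> *\<^sub>R v + t *\<^sub>R w) (r *\<^sub>R w))) (at t)"
      unfolding \<psi>_def using has_derivative_compose[OF lin f''[OF i]] .
    then show ?thesis
      using has_derivative_linear[OF f''[OF i]] by (simp add: linear_cmul)
  qed
  obtain \<eta> where \<eta>: "0 < \<eta>" "\<eta> < h" "\<psi> h - \<psi> 0 = (h - 0) * f'' (x + \<xi> *\<^sub>R v + \<eta> *\<^sub>R w) w"
    using mvt[OF h(1), of \<psi> "\<lambda>t r. r * f'' (x + \<xi> *\<^sub>R v + t *\<^sub>R w) w"] d\<psi>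
    by (metis (no_types, lifting) continuous_at_imp_continuous_on atLeastAtMost_iff has_derivative_continuous less_imp_le)
  have "f (x + h *\<^sub>R v + h *\<^sub>R w) - f (x + h *\<^sub>R v) - f (x + h *\<^sub>R w) + f x = \<phi> h - \<phi> 0"
    by (simp add: \<phi>_def add_ac)
  also have "\<dots> = h * (\<psi> h - \<psi> 0)"
    using \<xi>(3) by (simp add: \<psi>_def add_ac)
  also have "\<dots> = h * h * f'' (x + \<xi> *\<^sub>R v + \<eta> *\<^sub>R w) w"
    using \<eta>(3) by simp
  finally show ?thesis
    using inb[of \<xi> \<eta>] \<xi> \<eta> by (intro bexI[of _ "x + \<xi> *\<^sub>R v + \<eta> *\<^sub>R w"]) auto
qed

lemma second_derivative_symmetric:
  fixes f :: "'a::real_normed_vector \<Rightarrow> real"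
  assumes U: "open U" "x \<in> U"
    and f': "\<And>y. y \<in> U \<Longrightarrow> (f has_derivative f' y) (at y)"
    and f'': "\<And>y v. y \<in> U \<Longrightarrow> ((\<lambda>y. f' y v) has_derivative f'' v y) (at y)"
    and cont: "\<And>v w. isCont (\<lambda>y. f'' v y w) x"
  shows "f'' v x w = f'' w x v"
proof -
  have "\<bar>f'' v x w - f'' w x v\<bar> < e + e" if "0 < e" for e :: real
  proof -
    obtain d1 where d1: "0 < d1" "\<And>y. dist y x < d1 \<Longrightarrow> dist (f'' v y w) (f'' v x w) < e"
      using cont[of v w] \<open>0 < e\<close> unfolding continuous_at_eps_delta by blast
    obtain d2 where d2: "0 < d2" "\<And>y. dist y x < d2 \<Longrightarrow> dist (f'' w y v) (f'' w x v) < e"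
      using cont[of w v] \<open>0 < e\<close> unfolding continuous_at_eps_delta by blast
    obtain d3 where d3: "0 < d3" "ball x d3 \<subseteq> U"
      using U openE by blast
    define d where "d = min d1 (min d2 d3)"
    have d: "0 < d" "ball x d \<subseteq> U"
      using d1 d2 d3 by (auto simp: d_def)
    define h where "h = d / (2 * (norm v + norm w + 1))"
    have pos: "0 < norm v + norm w + 1"
      by (simp add: add_nonneg_pos)
    have h: "0 < h"
      using d pos by (simp add: h_def)
    have "h * (norm v + norm w) < h * (2 * (norm v + norm w + 1))"
      using pos by (intro mult_strict_left_mono h) argo
    also have "\<dots> = d"
      using pos by (simp add: h_def del: distrib_left_numeral)
    finally have hd: "h * (norm v + norm w) < d" "h * (norm w + norm v) < d"
      by (simp_all add: add.commute)
    obtain p where p: "p \<in> ball x d"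
      "f (x + h *\<^sub>R v + h *\<^sub>R w) - f (x + h *\<^sub>R v) - f (x + h *\<^sub>R w) + f x = h * h * f'' v p w"
      using second_difference_mean_value[of x d f f' v "f'' v" h w] f' f'' d(2) h hd by blast
    obtain q where q: "q \<in> ball x d"
      "f (x + h *\<^sub>R w + h *\<^sub>R v) - f (x + h *\<^sub>R w) - f (x + h *\<^sub>R v) + f x = h * h * f'' w q v"
      using second_difference_mean_value[of x d f f' w "f'' w" h v] f' f'' d(2) h hd by blast
    have "h * h * f'' v p w = h * h * f'' w q v"
      using p(2) q(2) by (simp only: add.assoc add.commute[of "h *\<^sub>R w"])
    then have pq: "f'' v p w = f'' w q v"
      using h by simp
    have "dist (f'' v p w) (f'' v x w) < e" "dist (f'' w q v) (f'' w x v) < e"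
      using d1(2)[of p] d2(2)[of q] p(1) q(1) by (auto simp: d_def dist_commute)
    then show ?thesis
      using pq by (simp add: dist_real_def)
  qed
  then have "\<bar>f'' v x w - f'' w x v\<bar> \<le> 0"
    by (metis field_sum_of_halves half_gt_zero_iff less_irrefl not_le)
  then show ?thesis by simp
qed

lemma iterated_derivative_symmetric:
  fixes D :: "'a::real_normed_vector list \<Rightarrow> 'a \<Rightarrow> complex"
  assumes "open U" "x \<in> U"
    and D: "\<And>vs x. x \<in> U \<Longrightarrow> (D vs has_derivative (\<lambda>v. D (v # vs) x)) (at x)"
  shows "D [v, w] x = D [w, v] x"
proof -
  have c: "isCont (D vs) x" for vs
    using D[OF assms(2), THEN has_derivative_continuous] .
  have "Re (D [v, w] x) = Re (D [w, v] x)"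
    by (rule second_derivative_symmetric[where f' = "\<lambda>y v. Re (D [v] y)" and f = "\<lambda>y. Re (D [] y)" and f'' = "\<lambda>v y w. Re (D [w, v] y)", OF assms(1,2)])
      (auto intro!: bounded_linear.has_derivative[OF bounded_linear_Re] D isCont_Re c)
  moreover have "Im (D [v, w] x) = Im (D [w, v] x)"
    by (rule second_derivative_symmetric[where f' = "\<lambda>y v. Im (D [v] y)" and f = "\<lambda>y. Im (D [] y)" and f'' = "\<lambda>v y w. Im (D [w, v] y)", OF assms(1,2)])
      (auto intro!: bounded_linear.has_derivative[OF bounded_linear_Im] D isCont_Im c)
  ultimately show ?thesis
    by (simp add: complex_eq_iff)
qed

section \<open>The matrix exponential\<close>

lemma bounded_bilinear_matrix_mult:
  "bounded_bilinear ((**) :: real ^ 'n ^ 'm \<Rightarrow> real ^ 'p ^ 'n \<Rightarrow> real ^ 'p ^ 'm)"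
  unfolding bilinear_conv_bounded_bilinear[symmetric] bilinear_def linear_iff
  by (auto simp: vec_eq_iff matrix_matrix_mult_def sum.distrib sum_distrib_left algebra_simps)

lemma bounded_bilinear_matrix_vector_mult:
  "bounded_bilinear ((*v) :: real ^ 'n ^ 'm \<Rightarrow> real ^ 'n \<Rightarrow> real ^ 'm)"
  unfolding bilinear_conv_bounded_bilinear[symmetric] bilinear_def linear_iff
  by (auto simp: vec_eq_iff matrix_vector_mult_def sum.distrib sum_distrib_left algebra_simps)

lemmas matrix_mult_simps =
  bounded_bilinear.add_left[OF bounded_bilinear_matrix_mult]
  bounded_bilinear.add_right[OF bounded_bilinear_matrix_mult]
  bounded_bilinear.diff_left[OF bounded_bilinear_matrix_mult]
  bounded_bilinear.diff_right[OF bounded_bilinear_matrix_mult]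
  bounded_bilinear.minus_left[OF bounded_bilinear_matrix_mult]
  bounded_bilinear.minus_right[OF bounded_bilinear_matrix_mult]
  bounded_bilinear.scaleR_left[OF bounded_bilinear_matrix_mult]
  bounded_bilinear.scaleR_right[OF bounded_bilinear_matrix_mult]
  bounded_bilinear.zero_left[OF bounded_bilinear_matrix_mult]
  bounded_bilinear.zero_right[OF bounded_bilinear_matrix_mult]

lemmas matrix_vector_simps =
  bounded_bilinear.add_left[OF bounded_bilinear_matrix_vector_mult]
  bounded_bilinear.add_right[OF bounded_bilinear_matrix_vector_mult]
  bounded_bilinear.diff_left[OF bounded_bilinear_matrix_vector_mult]
  bounded_bilinear.diff_right[OF bounded_bilinear_matrix_vector_mult]
  bounded_bilinear.minus_left[OF bounded_bilinear_matrix_vector_mult]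
  bounded_bilinear.minus_right[OF bounded_bilinear_matrix_vector_mult]
  bounded_bilinear.scaleR_left[OF bounded_bilinear_matrix_vector_mult]
  bounded_bilinear.scaleR_right[OF bounded_bilinear_matrix_vector_mult]
  bounded_bilinear.zero_left[OF bounded_bilinear_matrix_vector_mult]
  bounded_bilinear.zero_right[OF bounded_bilinear_matrix_vector_mult]

lemma has_vector_derivative_vec:
  fixes f :: "real \<Rightarrow> 'b::euclidean_space ^ 'n"
  assumes "\<And>i. ((\<lambda>t. f t $ i) has_vector_derivative f' $ i) (at t)"
  shows "(f has_vector_derivative f') (at t)"
proof -
  have ax: "bounded_linear (axis i :: 'b \<Rightarrow> 'b ^ 'n)" for i
    by (auto simp: linear_conv_bounded_linear[symmetric] linear_iff axis_def vec_eq_iff)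
  have "((\<lambda>t. \<Sum>i\<in>UNIV. axis i (f t $ i)) has_vector_derivative (\<Sum>i\<in>UNIV. axis i (f' $ i))) (at t)"
    by (intro has_vector_derivative_sum bounded_linear.has_vector_derivative[OF ax] assms)
  moreover have "(\<Sum>i\<in>UNIV. axis i (x $ i)) = x" for x :: "'b ^ 'n"
    by (simp add: vec_eq_iff axis_def)
  ultimately show ?thesis
    by simp
qed

definition mat_pow :: "real ^ 'n ^ 'n \<Rightarrow> nat \<Rightarrow> real ^ 'n ^ 'n" where
  "mat_pow X k = ((**) X ^^ k) (mat 1)"

lemma mat_pow_simps [simp]: "mat_pow X 0 = mat 1" "mat_pow X (Suc k) = X ** mat_pow X k"
  by (simp_all add: mat_pow_def)

lemma mat_pow_commute: "X ** mat_pow X k = mat_pow X k ** X"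
proof (induct k)
  case (Suc k)
  have "mat_pow X (Suc k) ** X = X ** (mat_pow X k ** X)"
    by (simp add: matrix_mul_assoc)
  then show ?case
    by (simp flip: Suc)
qed simp

lemma mat_pow_scaleR: "mat_pow (t *\<^sub>R X) k = t ^ k *\<^sub>R mat_pow X k"
  by (induct k) (simp_all add: matrix_mult_simps mult_ac)

lemma mat_exp_eq: "mat_exp X = suminf (\<lambda>k. (1 / fact k) *\<^sub>R mat_pow X k)"
  by (simp add: mat_exp_def mat_pow_def)

lemma summable_mat_exp:
  fixes X :: "real ^ 'n::finite ^ 'n"
  shows "summable (\<lambda>k. (1 / fact k) *\<^sub>R mat_pow X k)"
proof -
  obtain K where K: "\<And>(Y :: real ^ 'n ^ 'n) (Z :: real ^ 'n ^ 'n). norm (Y ** Z) \<le> norm Y * norm Z * K" "0 < K"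
    using bounded_bilinear.pos_bounded[OF bounded_bilinear_matrix_mult] by blast
  have "norm (mat_pow X k) \<le> (norm X * K) ^ k * norm (mat 1 :: real ^ 'n ^ 'n)" for k
  proof (induct k)
    case (Suc k)
    have "norm (mat_pow X (Suc k)) \<le> (norm X * K) * norm (mat_pow X k)"
      using K(1)[of X "mat_pow X k"] by (simp add: mult_ac)
    also have "\<dots> \<le> (norm X * K) * ((norm X * K) ^ k * norm (mat 1 :: real ^ 'n ^ 'n))"
      using Suc K(2) by (intro mult_left_mono) auto
    finally show ?case by simp
  qed simp
  then have "norm ((1 / fact k) *\<^sub>R mat_pow X k) \<le> inverse (fact k) * (norm X * K) ^ k * norm (mat 1 :: real ^ 'n ^ 'n)" for k
    by (simp add: divide_inverse mult.assoc mult_left_mono)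
  then show ?thesis
    by (intro summable_comparison_test[OF _ summable_mult2[OF summable_exp]]) blast
qed

lemma mat_exp_0 [simp]: "mat_exp (0 :: real ^ 'n::finite ^ 'n) = mat 1"
proof -
  have "mat_pow (0 :: real ^ 'n ^ 'n) k = (if k = 0 then mat 1 else 0)" for k :: nat
    by (cases k) (auto simp: matrix_mult_simps)
  then show ?thesis
    unfolding mat_exp_eq by (subst suminf_finite[of "{0}"]) auto
qed

lemma mat_exp_commute: "X ** mat_exp (t *\<^sub>R X) = mat_exp (t *\<^sub>R X) ** X"
proof -
  have "X ** mat_exp (t *\<^sub>R X) = suminf (\<lambda>k. X ** ((1 / fact k) *\<^sub>R mat_pow (t *\<^sub>R X) k))"
    unfolding mat_exp_eq
    by (rule bounded_linear.suminf[OF bounded_bilinear.bounded_linear_right[OF bounded_bilinear_matrix_mult] summable_mat_exp])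
  also have "\<dots> = suminf (\<lambda>k. ((1 / fact k) *\<^sub>R mat_pow (t *\<^sub>R X) k) ** X)"
    by (simp add: matrix_mult_simps mat_pow_scaleR mat_pow_commute)
  also have "\<dots> = mat_exp (t *\<^sub>R X) ** X"
    unfolding mat_exp_eq
    by (rule bounded_linear.suminf[OF bounded_bilinear.bounded_linear_left[OF bounded_bilinear_matrix_mult] summable_mat_exp, symmetric])
  finally show ?thesis .
qed

lemma bounded_linear_matrix_entry: "bounded_linear (\<lambda>A :: real ^ 'n ^ 'm. A $ i $ j)"
  by (rule bounded_linear_compose[OF bounded_linear_vec_nth bounded_linear_vec_nth])

lemma mat_exp_has_vector_derivative:
  "((\<lambda>t. mat_exp (t *\<^sub>R X)) has_vector_derivative X ** mat_exp (t *\<^sub>R X)) (at t)"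
proof (intro has_vector_derivative_vec)
  fix i j
  define c where "c k = (1 / fact k) * mat_pow X k $ i $ j" for k
  have "(\<lambda>k. ((1 / fact k) *\<^sub>R mat_pow (s *\<^sub>R X) k) $ i $ j) sums (mat_exp (s *\<^sub>R X) $ i $ j)" for s
    unfolding mat_exp_eq
    by (intro bounded_linear.sums[OF bounded_linear_matrix_entry] summable_sums summable_mat_exp)
  then have sums: "(\<lambda>k. c k * s ^ k) sums (mat_exp (s *\<^sub>R X) $ i $ j)" for s
    by (simp add: c_def mat_pow_scaleR mult_ac)
  have d: "diffs c k * s ^ k = (X ** ((1 / fact k) *\<^sub>R mat_pow (s *\<^sub>R X) k)) $ i $ j" for k s
    by (simp add: diffs_def c_def mat_pow_scaleR matrix_mult_simps field_simps del: of_nat_Suc)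
  have dsum: "(\<lambda>k. diffs c k * s ^ k) sums ((X ** mat_exp (s *\<^sub>R X)) $ i $ j)" for s
    unfolding d mat_exp_eq
    by (intro bounded_linear.sums[OF bounded_linear_matrix_entry] summable_sums summable_mat_exp
        bounded_linear.sums[OF bounded_bilinear.bounded_linear_right[OF bounded_bilinear_matrix_mult]])
  have "((\<lambda>s. suminf (\<lambda>k. c k * s ^ k)) has_field_derivative suminf (\<lambda>k. diffs c k * t ^ k)) (at t)"
    by (rule termdiffs_strong_converges_everywhere) (use sums sums_summable in blast)
  then show "((\<lambda>s. mat_exp (s *\<^sub>R X) $ i $ j) has_vector_derivative (X ** mat_exp (t *\<^sub>R X)) $ i $ j) (at t)"
    by (simp add: sums_unique[OF sums, symmetric] sums_unique[OF dsum, symmetric] has_real_derivative_iff_has_vector_derivative)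
qed

lemma has_vector_derivative_zero_imp_eq:
  fixes \<phi> :: "real \<Rightarrow> 'a::real_normed_vector"
  assumes "\<And>t. (\<phi> has_vector_derivative 0) (at t)"
  shows "\<phi> s = \<phi> t"
proof -
  have "\<exists>c. \<forall>x\<in>UNIV. \<phi> x = c"
    using assms by (intro has_derivative_zero_constant) (auto simp: has_vector_derivative_def)
  then show ?thesis by force
qed

text \<open>The derivative of \<open>exp(-tX) \<phi>(t)\<close> vanishes. Hence solutions of \<open>\<phi>' = X \<phi>\<close> are unique, and a value of
  the exponential on a vector is found by guessing the solution (\<open>mat_exp_flow\<close>); no closed form of the
  matrix \<open>exp(tX)\<close> is ever computed.\<close>

lemma mat_exp_minus_flow:
  assumes \<phi>: "\<And>t. (\<phi> has_vector_derivative X *v \<phi> t) (at t)"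
  shows "mat_exp (- (t *\<^sub>R X)) *v \<phi> t = \<phi> 0"
proof -
  have "((\<lambda>t. mat_exp (t *\<^sub>R (- X)) *v \<phi> t) has_vector_derivative
      mat_exp (t *\<^sub>R (- X)) *v (X *v \<phi> t) + (- X ** mat_exp (t *\<^sub>R (- X))) *v \<phi> t) (at t)" for t
    by (rule bounded_bilinear.has_vector_derivative[OF bounded_bilinear_matrix_vector_mult
          mat_exp_has_vector_derivative \<phi>])
  moreover have "mat_exp (t *\<^sub>R (- X)) *v (X *v \<phi> t) + (- X ** mat_exp (t *\<^sub>R (- X))) *v \<phi> t = 0" for t
    unfolding mat_exp_commute by (simp add: matrix_mult_simps matrix_vector_simps matrix_vector_mul_assoc)
  ultimately have "mat_exp (t *\<^sub>R (- X)) *v \<phi> t = mat_exp (0 *\<^sub>R (- X)) *v \<phi> 0"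
    by (intro has_vector_derivative_zero_imp_eq[of "\<lambda>t. mat_exp (t *\<^sub>R (- X)) *v \<phi> t"]) simp
  then show ?thesis by simp
qed

lemma mat_exp_orbit:
  "((\<lambda>t. mat_exp (t *\<^sub>R X) *v z) has_vector_derivative X *v (mat_exp (t *\<^sub>R X) *v z)) (at t)"
  using bounded_linear.has_vector_derivative[OF
      bounded_bilinear.bounded_linear_left[OF bounded_bilinear_matrix_vector_mult] mat_exp_has_vector_derivative]
  by (simp add: matrix_vector_mul_assoc)

lemma mat_exp_inverse: "mat_exp (- X) ** mat_exp X = mat 1" "mat_exp X ** mat_exp (- X) = mat 1"
proof -
  have "mat_exp (- X) ** mat_exp X = mat 1" for X :: "real ^ 'n ^ 'n"
    using mat_exp_minus_flow[of "\<lambda>t. mat_exp (t *\<^sub>R X) *v z" X 1 for z, OF mat_exp_orbit]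
    by (simp add: matrix_eq matrix_vector_mul_assoc)
  from this[of X] this[of "- X"]
  show "mat_exp (- X) ** mat_exp X = mat 1" "mat_exp X ** mat_exp (- X) = mat 1"
    by simp_all
qed

lemma mat_exp_flow:
  assumes "\<And>t. (\<phi> has_vector_derivative X *v \<phi> t) (at t)"
  shows "mat_exp (t *\<^sub>R X) *v \<phi> 0 = \<phi> t"
  using arg_cong[OF mat_exp_minus_flow[OF assms, of t], of "\<lambda>z. mat_exp (t *\<^sub>R X) *v z"]
  by (simp add: matrix_vector_mul_assoc mat_exp_inverse)

lemma mat_exp_add: "mat_exp ((s + t) *\<^sub>R X) = mat_exp (s *\<^sub>R X) ** mat_exp (t *\<^sub>R X)"
proof -
  have "mat_exp (s *\<^sub>R X) *v (mat_exp (t *\<^sub>R X) *v z) = mat_exp ((s + t) *\<^sub>R X) *v z" for z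
  proof -
    have "((\<lambda>s. mat_exp ((s + t) *\<^sub>R X) *v z) has_vector_derivative X *v (mat_exp ((s + t) *\<^sub>R X) *v z)) (at s)" for s
    proof -
      have "((\<lambda>s. s + t) has_vector_derivative 1) (at s)"
        by (auto intro!: derivative_eq_intros)
      from vector_diff_chain_at[OF this mat_exp_orbit[of X z]] show ?thesis
        by (simp add: o_def)
    qed
    from mat_exp_flow[of "\<lambda>s. mat_exp ((s + t) *\<^sub>R X) *v z", OF this, of s]
    show ?thesis by simp
  qed
  then show ?thesis
    by (simp add: matrix_eq matrix_vector_mul_assoc)
qed

lemma mat_exp_intertwine:
  fixes P :: "real ^ 'n::finite ^ 'm::finite"
  assumes "P ** X = Y ** P"
  shows "P ** mat_exp (t *\<^sub>R X) = mat_exp (t *\<^sub>R Y) ** P"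
proof -
  have "mat_exp (t *\<^sub>R Y) *v (P *v z) = P *v (mat_exp (t *\<^sub>R X) *v z)" for z
  proof -
    have "((\<lambda>t. P *v (mat_exp (t *\<^sub>R X) *v z)) has_vector_derivative Y *v (P *v (mat_exp (t *\<^sub>R X) *v z))) (at t)" for t
    proof -
      have "P *v (X *v y) = Y *v (P *v y)" for y
        by (simp add: matrix_vector_mul_assoc assms)
      then show ?thesis
        using bounded_linear.has_vector_derivative[OF bounded_bilinear.bounded_linear_right[OF
            bounded_bilinear_matrix_vector_mult] mat_exp_orbit, of P X z t]
        by simp
    qed
    from mat_exp_flow[of "\<lambda>t. P *v (mat_exp (t *\<^sub>R X) *v z)", OF this, of t]
    show ?thesis by simp
  qed
  then show ?thesis
    by (simp add: matrix_eq matrix_vector_mul_assoc)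
qed

lemma mat_exp_fixes:
  assumes "X *v z = 0"
  shows "mat_exp (t *\<^sub>R X) *v z = z"
  using mat_exp_flow[of "\<lambda>t. z" X t] assms by simp

section \<open>The form of signature (2, m - 1) and its group\<close>

lemma sum_coord:
  fixes h :: "'a::finite coord \<Rightarrow> 'b::comm_monoid_add"
  shows "(\<Sum>c\<in>UNIV. h c) = h Time1 + (h Time2 + (h Space1 + (h Space2 + (\<Sum>j\<in>UNIV. h (Space j)))))"
proof -
  have U: "(UNIV :: 'a coord set) = insert Time1 (insert Time2 (insert Space1 (insert Space2 (range Space))))"
    using coord.exhaust by blast
  have "sum h (range Space) = (\<Sum>j\<in>UNIV. h (Space j))"
    by (subst sum.reindex) (auto simp: inj_on_def)
  then show ?thesis
    unfolding U by (simp add: image_iff)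
qed

definition csign :: "'a coord \<Rightarrow> real" where
  "csign c = (if time_like c then -1 else 1)"

lemma csign_simps [simp]:
  "csign Time1 = -1" "csign Time2 = -1" "csign Space1 = 1" "csign Space2 = 1" "csign (Space j) = 1"
  by (auto simp: csign_def time_like_def)

lemma csign_sq [simp]: "csign c * csign c = 1" "csign c * (csign c * x) = x"
  by (auto simp: csign_def)

lemma csign_neq_0 [simp]: "csign c \<noteq> 0"
  by (simp add: csign_def)

definition bform :: "'a::finite vec_m \<Rightarrow> 'a vec_m \<Rightarrow> real" where
  "bform x y = (\<Sum>c\<in>UNIV. csign c * x $ c * y $ c)"

lemma qform_bform: "qform x = bform x x"
  by (simp add: qform_def bform_def sum_coord power2_eq_square)

lemma bounded_bilinear_bform: "bounded_bilinear (bform :: 'a::finite vec_m \<Rightarrow> _)"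
  unfolding bilinear_conv_bounded_bilinear[symmetric] bilinear_def linear_iff
  by (auto simp: bform_def sum.distrib sum_distrib_left algebra_simps)

lemma bform_simps:
  "bform (x + x') y = bform x y + bform x' y" "bform y (x + x') = bform y x + bform y x'"
  "bform (x - x') y = bform x y - bform x' y" "bform y (x - x') = bform y x - bform y x'"
  "bform (- x) y = - bform x y" "bform y (- x) = - bform y x"
  "bform (r *\<^sub>R x) y = r * bform x y" "bform y (r *\<^sub>R x) = r * bform y x"
  "bform 0 y = 0" "bform y 0 = 0"
  using bounded_bilinear.add_left[OF bounded_bilinear_bform] bounded_bilinear.add_right[OF bounded_bilinear_bform]
    bounded_bilinear.diff_left[OF bounded_bilinear_bform] bounded_bilinear.diff_right[OF bounded_bilinear_bform]
    bounded_bilinear.minus_left[OF bounded_bilinear_bform] bounded_bilinear.minus_right[OF bounded_bilinear_bform]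
    bounded_bilinear.scaleR_left[OF bounded_bilinear_bform] bounded_bilinear.scaleR_right[OF bounded_bilinear_bform]
    bounded_bilinear.zero_left[OF bounded_bilinear_bform] bounded_bilinear.zero_right[OF bounded_bilinear_bform]
  by auto

lemma bform_commute: "bform x y = bform y x"
  by (simp add: bform_def mult_ac)

lemma bform_axis [simp]: "bform x (axis c 1) = csign c * x $ c" "bform (axis c 1) x = csign c * x $ c"
proof -
  show "bform x (axis c 1) = csign c * x $ c" for x
    by (simp add: bform_def axis_def if_distrib[of "(*) _"] cong: if_cong)
  then show "bform (axis c 1) x = csign c * x $ c"
    by (simp add: bform_commute)
qed

lemma bform_eq_0_imp:
  assumes "\<And>y. bform x y = 0"
  shows "x = 0"
  using assms[of "axis c 1" for c] by (simp add: vec_eq_iff)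

lemma bform_polar: "2 * bform x y = qform (x + y) - qform x - qform y"
  by (simp add: qform_bform bform_simps bform_commute[of y x])

lemma G_grp_iff: "g \<in> G_grp \<longleftrightarrow> (\<forall>x y. bform (g *v x) (g *v y) = bform x y)"
proof
  assume "g \<in> G_grp"
  then have q: "qform (g *v x) = qform x" for x
    by (simp add: G_grp_def)
  have "2 * bform (g *v x) (g *v y) = 2 * bform x y" for x y
    unfolding bform_polar by (simp add: q flip: matrix_vector_right_distrib)
  then show "\<forall>x y. bform (g *v x) (g *v y) = bform x y"
    by simp
qed (simp add: G_grp_def qform_bform)

lemma G_grp_bform: "g \<in> G_grp \<Longrightarrow> bform (g *v x) (g *v y) = bform x y"
  by (simp add: G_grp_iff)

lemma G_grp_mult [intro]: "g \<in> G_grp \<Longrightarrow> h \<in> G_grp \<Longrightarrow> g ** h \<in> G_grp"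
  by (simp add: G_grp_iff flip: matrix_vector_mul_assoc)

lemma G_grp_one [simp, intro]: "mat 1 \<in> G_grp"
  by (simp add: G_grp_iff)

lemma G_grp_minus: "g \<in> G_grp \<Longrightarrow> - g \<in> G_grp"
  by (simp add: G_grp_iff matrix_vector_simps bform_simps)

lemma G_grp_invertible:
  assumes "g \<in> G_grp"
  shows "invertible g"
proof -
  have "inj ((*v) g)"
  proof (rule injI)
    fix x y assume "g *v x = g *v y"
    then have "bform (x - y) z = 0" for z
      using G_grp_bform[OF assms, of "x - y" z] by (simp add: matrix_vector_simps bform_simps)
    then show "x = y"
      using bform_eq_0_imp by fastforce
  qed
  then show ?thesis
    using invertible_left_inverse matrix_left_invertible_injective by blast
qed

lemma G_grp_inverse [simp]:
  assumes "g \<in> G_grp"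
  shows "matrix_inv g ** g = mat 1" "g ** matrix_inv g = mat 1"
  using someI_ex[OF G_grp_invertible[OF assms, unfolded invertible_def]] by (simp_all add: matrix_inv_def)

lemma G_grp_inverse_vec [simp]:
  assumes "g \<in> G_grp"
  shows "matrix_inv g *v (g *v x) = x" "g *v (matrix_inv g *v x) = x"
  by (simp_all add: matrix_vector_mul_assoc assms)

lemma G_grp_inv [intro, simp]:
  assumes "g \<in> G_grp"
  shows "matrix_inv g \<in> G_grp"
  unfolding G_grp_iff
proof (intro allI)
  fix x y
  show "bform (matrix_inv g *v x) (matrix_inv g *v y) = bform x y"
    using G_grp_bform[OF assms, of "matrix_inv g *v x" "matrix_inv g *v y"] by (simp add: assms)
qed

lemma right_inverse_unique:
  assumes "g \<in> G_grp" "g ** h = mat 1"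
  shows "h = matrix_inv g"
  using assms by (metis G_grp_inverse(1) matrix_mul_assoc matrix_mul_lid matrix_mul_rid)

lemma bform_mat_exp_derivative:
  "((\<lambda>t. bform (mat_exp (t *\<^sub>R X) *v x) (mat_exp (t *\<^sub>R X) *v y)) has_vector_derivative
     bform (mat_exp (t *\<^sub>R X) *v x) (X *v (mat_exp (t *\<^sub>R X) *v y)) +
     bform (X *v (mat_exp (t *\<^sub>R X) *v x)) (mat_exp (t *\<^sub>R X) *v y)) (at t)"
  by (rule bounded_bilinear.has_vector_derivative[OF bounded_bilinear_bform mat_exp_orbit mat_exp_orbit])

lemma gg_iff: "X \<in> \<gg> \<longleftrightarrow> (\<forall>x y. bform x (X *v y) + bform (X *v x) y = 0)"
proof
  assume "X \<in> \<gg>"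
  then have G: "mat_exp (t *\<^sub>R X) \<in> G_grp" for t
    by (simp add: \<gg>_def lie_algebra_of_def)
  show "\<forall>x y. bform x (X *v y) + bform (X *v x) y = 0"
  proof (intro allI)
    fix x y
    have "((\<lambda>t :: real. bform x y) has_vector_derivative
       bform x (X *v y) + bform (X *v x) y) (at 0)"
      using bform_mat_exp_derivative[of X x y 0] by (simp add: G_grp_bform[OF G])
    then show "bform x (X *v y) + bform (X *v x) y = 0"
      using vector_derivative_unique_at has_vector_derivative_const by blast
  qed
next
  assume X: "\<forall>x y. bform x (X *v y) + bform (X *v x) y = 0"
  have "bform (mat_exp (t *\<^sub>R X) *v x) (mat_exp (t *\<^sub>R X) *v y) = bform x y" for t x y
    using has_vector_derivative_zero_imp_eq[of "\<lambda>t. bform (mat_exp (t *\<^sub>R X) *v x) (mat_exp (t *\<^sub>R X) *v y)" t 0]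
      bform_mat_exp_derivative[of X x y] X by simp
  then show "X \<in> \<gg>"
    by (simp add: \<gg>_def lie_algebra_of_def G_grp_iff)
qed

lemma gg_exp: "X \<in> \<gg> \<Longrightarrow> mat_exp (t *\<^sub>R X) \<in> G_grp"
  by (simp add: \<gg>_def lie_algebra_of_def)

lemma gg_skew: "X \<in> \<gg> \<Longrightarrow> bform (X *v x) y = - bform x (X *v y)"
  unfolding gg_iff by (simp add: eq_neg_iff_add_eq_0 add.commute)

lemma gg_add [intro]: "X \<in> \<gg> \<Longrightarrow> Y \<in> \<gg> \<Longrightarrow> X + Y \<in> \<gg>"
  and gg_scaleR [intro]: "X \<in> \<gg> \<Longrightarrow> r *\<^sub>R X \<in> \<gg>"
  and gg_zero [intro, simp]: "0 \<in> \<gg>"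
  and gg_minus [intro]: "X \<in> \<gg> \<Longrightarrow> - X \<in> \<gg>"
  by (simp_all add: gg_skew gg_iff matrix_vector_simps bform_simps)

lemma gg_bracket [intro]: "X \<in> \<gg> \<Longrightarrow> Y \<in> \<gg> \<Longrightarrow> X ** Y - Y ** X \<in> \<gg>"
  by (simp add: gg_skew gg_iff[of "X ** Y - Y ** X"] matrix_vector_simps bform_simps flip: matrix_vector_mul_assoc)

section \<open>Skew operators of rank two\<close>

text \<open>The entries are those of \<open>a b\<^sup>T J - b a\<^sup>T J\<close> with \<open>J\<close> the diagonal matrix of the form; the shape
  that is used is \<open>wedge_mult_vec\<close>.\<close>

definition wedge :: "'a::finite vec_m \<Rightarrow> 'a vec_m \<Rightarrow> 'a mat_m" where
  "wedge a b = (\<chi> i j. a $ i * (csign j * b $ j) - b $ i * (csign j * a $ j))"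

lemma wedge_mult_vec: "wedge a b *v z = bform b z *\<^sub>R a - bform a z *\<^sub>R b"
  by (simp add: vec_eq_iff wedge_def matrix_vector_mult_def bform_def sum_distrib_right sum_distrib_left
      left_diff_distrib right_diff_distrib sum_subtractf mult_ac)

lemma wedge_simps:
  "wedge (a + a') b = wedge a b + wedge a' b" "wedge b (a + a') = wedge b a + wedge b a'"
  "wedge (a - a') b = wedge a b - wedge a' b" "wedge b (a - a') = wedge b a - wedge b a'"
  "wedge (- a) b = - wedge a b" "wedge b (- a) = - wedge b a"
  "wedge (r *\<^sub>R a) b = r *\<^sub>R wedge a b" "wedge b (r *\<^sub>R a) = r *\<^sub>R wedge b a"
  "wedge 0 b = 0" "wedge b 0 = 0" "wedge a a = 0"
  by (simp_all add: vec_eq_iff wedge_def algebra_simps)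

lemma wedge_commute: "wedge a b = - wedge b a"
  by (simp add: vec_eq_iff wedge_def algebra_simps)

lemma wedge_in_gg [intro, simp]: "wedge a b \<in> \<gg>"
  by (simp add: gg_iff wedge_mult_vec bform_simps bform_commute)

lemma wedge_bracket:
  assumes "X \<in> \<gg>"
  shows "X ** wedge a b - wedge a b ** X = wedge (X *v a) b + wedge a (X *v b)"
  by (simp add: matrix_eq matrix_vector_simps wedge_mult_vec gg_skew[OF assms] flip: matrix_vector_mul_assoc)

lemma wedge_conj:
  assumes "g \<in> G_grp"
  shows "g ** wedge a b = wedge (g *v a) (g *v b) ** g"
  by (simp add: matrix_eq matrix_vector_simps wedge_mult_vec G_grp_bform[OF assms] flip: matrix_vector_mul_assoc)

lemma wedge_axis: "wedge (axis c 1) (axis d 1) = csign d *\<^sub>R elem_mat c d - csign c *\<^sub>R elem_mat d c"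
  by (auto simp: vec_eq_iff wedge_def elem_mat_def axis_def)

lemma transpose_elem_mat [simp]: "transpose (elem_mat a b) = elem_mat b a"
  by (auto simp: vec_eq_iff transpose_def elem_mat_def)

lemma transpose_add: "transpose (A + B) = transpose A + transpose (B :: real ^ 'n ^ 'm)"
  and transpose_diff: "transpose (A - B) = transpose A - transpose (B :: real ^ 'n ^ 'm)"
  and transpose_minus: "transpose (- A) = - transpose (A :: real ^ 'n ^ 'm)"
  by (simp_all add: vec_eq_iff transpose_def)

definition opp_vec :: "'a::finite vec_m" where
  "opp_vec = axis Time1 1 - axis Space2 1"

lemmas base_opp_defs = base_vec_def opp_vec_def

lemma bform_base_opp [simp]:
  "bform base_vec base_vec = 0" "bform opp_vec opp_vec = 0"
  "bform base_vec opp_vec = -2" "bform opp_vec base_vec = -2"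
  by (simp_all add: base_opp_defs bform_simps, simp_all add: axis_def)

lemma base_vec_neq_0 [simp]: "base_vec \<noteq> 0"
  by (auto simp: vec_eq_iff base_vec_def axis_def)

definition mid_space :: "'a::finite vec_m set" where
  "mid_space = {v. v $ Time1 = 0 \<and> v $ Space2 = 0}"

lemma mid_space_iff: "v \<in> mid_space \<longleftrightarrow> bform base_vec v = 0 \<and> bform opp_vec v = 0"
  by (auto simp: mid_space_def base_opp_defs bform_simps)

lemma mid_space_bform [simp]:
  assumes "v \<in> mid_space"
  shows "bform base_vec v = 0" "bform opp_vec v = 0" "bform v base_vec = 0" "bform v opp_vec = 0"
  using assms bform_commute by (metis mid_space_iff)+

lemma mid_space_axis [simp]:
  "axis Time2 1 \<in> mid_space" "axis Space1 1 \<in> mid_space" "axis (Space j) 1 \<in> mid_space"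
  by (auto simp: mid_space_def axis_def)

lemma mid_space_closed [intro]:
  "0 \<in> mid_space"
  "v \<in> mid_space \<Longrightarrow> w \<in> mid_space \<Longrightarrow> v + w \<in> mid_space"
  "v \<in> mid_space \<Longrightarrow> w \<in> mid_space \<Longrightarrow> v - w \<in> mid_space"
  "v \<in> mid_space \<Longrightarrow> r *\<^sub>R v \<in> mid_space" "v \<in> mid_space \<Longrightarrow> - v \<in> mid_space"
  by (auto simp: mid_space_def)

lemma mid_space_expand:
  assumes "v \<in> mid_space"
  shows "v = v $ Time2 *\<^sub>R axis Time2 1 + (v $ Space1 *\<^sub>R axis Space1 1 + (\<Sum>j\<in>UNIV. v $ Space j *\<^sub>R axis (Space j) 1))"
  unfolding vec_eq_iff
proof
  fix c
  show "v $ c = (v $ Time2 *\<^sub>R axis Time2 1 + (v $ Space1 *\<^sub>R axis Space1 1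
      + (\<Sum>j\<in>UNIV. v $ Space j *\<^sub>R axis (Space j) 1))) $ c"
  proof (cases c)
    case (Space a)
    have "(\<Sum>j\<in>UNIV. v $ Space j * axis (Space j) 1 $ Space a) = v $ Space a"
      by (subst sum.remove[of _ a]) (auto simp: axis_def intro!: sum.neutral)
    then show ?thesis
      by (simp add: Space) (simp add: axis_def)
  qed (use assms in \<open>simp_all add: mid_space_def axis_def\<close>)
qed

lemma vec_decompose:
  obtains \<alpha> \<beta> w where "x = \<alpha> *\<^sub>R base_vec + \<beta> *\<^sub>R opp_vec + w" "w \<in> mid_space"
proof
  define \<alpha> where "\<alpha> = (x $ Time1 + x $ Space2) / 2"
  define \<beta> where "\<beta> = (x $ Time1 - x $ Space2) / 2"
  show "x - \<alpha> *\<^sub>R base_vec - \<beta> *\<^sub>R opp_vec \<in> mid_space"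
    by (simp add: mid_space_def base_vec_def opp_vec_def axis_def \<alpha>_def \<beta>_def field_simps)
  show "x = \<alpha> *\<^sub>R base_vec + \<beta> *\<^sub>R opp_vec + (x - \<alpha> *\<^sub>R base_vec - \<beta> *\<^sub>R opp_vec)"
    by simp
qed

lemma H_mat_wedge: "H_mat = (- 1/2) *\<^sub>R wedge base_vec opp_vec"
  by (auto simp: vec_eq_iff H_mat_def wedge_def elem_mat_def base_vec_def opp_vec_def axis_def)

lemma H_mat_mult:
  "H_mat *v base_vec = base_vec" "H_mat *v opp_vec = - opp_vec"
  "v \<in> mid_space \<Longrightarrow> H_mat *v v = 0"
  by (simp_all add: H_mat_wedge matrix_vector_simps wedge_mult_vec)

lemma H_mat_gg [simp, intro]: "H_mat \<in> \<gg>"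
  unfolding H_mat_wedge by (intro gg_scaleR wedge_in_gg)

lemma Qm_wedge:
  "Q1m = wedge opp_vec (axis Time2 1)" "Q2m = wedge opp_vec (axis Space1 1)"
  "Ym j = wedge opp_vec (axis (Space j) 1)"
  by (simp_all add: Q1m_def Q2m_def Ym_def opp_vec_def wedge_simps wedge_axis)

lemma Qp_wedge:
  "transpose Q1m = - wedge base_vec (axis Time2 1)" "transpose Q2m = wedge base_vec (axis Space1 1)"
  "transpose (Ym j) = wedge base_vec (axis (Space j) 1)"
  by (simp_all add: Q1m_def Q2m_def Ym_def base_vec_def wedge_simps wedge_axis transpose_add transpose_diff transpose_minus)

lemma m_wedge:
  "H2 = wedge (axis Time2 1) (axis Space1 1)"
  "Zp j = wedge (axis Time2 1) (axis (Space j) 1) + wedge (axis Space1 1) (axis (Space j) 1)"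
  "transpose (Zp j) = wedge (axis Time2 1) (axis (Space j) 1) - wedge (axis Space1 1) (axis (Space j) 1)"
  "Mij i j = wedge (axis (Space i) 1) (axis (Space j) 1)"
  by (simp_all add: H2_def Zp_def Mij_def wedge_axis transpose_add transpose_diff)

text \<open>Transposition exchanges \<open>f \<and> v\<close> and, up to the sign for the time coordinate, \<open>e \<and> v\<close>.\<close>

lemma nnp_wedge: "\<nn>p = {wedge base_vec v | v. v \<in> mid_space}"
proof
  have "linear (wedge base_vec)"
    by (auto simp: linear_iff wedge_simps)
  moreover have "subspace mid_space"
    by (auto simp: subspace_def)
  ultimately have "subspace (wedge base_vec ` mid_space)"
    by (rule linear_subspace_image)
  then have "subspace {wedge base_vec v | v. v \<in> mid_space}"
    by (simp add: Setcompr_eq_image)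
  moreover have "{transpose Q1m, transpose Q2m} \<union> range (\<lambda>j. transpose (Ym j)) \<subseteq> {wedge base_vec v | v. v \<in> mid_space}"
    unfolding Qp_wedge wedge_simps(6)[symmetric] using mid_space_closed(5) by (auto intro!: exI)
  ultimately show "\<nn>p \<subseteq> {wedge base_vec v | v. v \<in> mid_space}"
    unfolding \<nn>p_def by (rule span_minimal[rotated])
  have "wedge base_vec v \<in> \<nn>p" if v: "v \<in> mid_space" for v
  proof -
    have lin: "linear (wedge base_vec)"
      by (auto simp: linear_iff wedge_simps)
    have "- transpose Q1m \<in> \<nn>p" "transpose Q2m \<in> \<nn>p" "transpose (Ym j) \<in> \<nn>p" for j
      unfolding \<nn>p_def by (auto intro: span_base span_neg)
    then have n: "wedge base_vec (axis Time2 1) \<in> \<nn>p" "wedge base_vec (axis Space1 1) \<in> \<nn>p"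
      "wedge base_vec (axis (Space j) 1) \<in> \<nn>p" for j
      by (simp_all add: Qp_wedge)
    have "v $ Time2 *\<^sub>R wedge base_vec (axis Time2 1) + (v $ Space1 *\<^sub>R wedge base_vec (axis Space1 1)
        + (\<Sum>j\<in>UNIV. v $ Space j *\<^sub>R wedge base_vec (axis (Space j) 1))) \<in> \<nn>p"
      using n unfolding \<nn>p_def by (intro span_add span_scale span_sum)
    then show ?thesis
      by (subst mid_space_expand[OF v]) (simp add: wedge_simps linear_sum[OF lin])
  qed
  then show "{wedge base_vec v | v. v \<in> mid_space} \<subseteq> \<nn>p"
    by blast
qed

lemma wedge_mm:
  assumes p: "p \<in> mid_space" and q: "q \<in> mid_space"
  shows "wedge p q \<in> \<mm>"
proof -
  have lin: "linear (wedge x)" "linear (\<lambda>y. wedge y x)" for x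
    by (auto simp: linear_iff wedge_simps)
  have m0: "H2 \<in> \<mm>" "Zp j \<in> \<mm>" "transpose (Zp j) \<in> \<mm>" "Mij i j \<in> \<mm>" for i j
    unfolding \<mm>_def by (auto intro: span_base)
  have mmc: "X \<in> \<mm> \<Longrightarrow> Y \<in> \<mm> \<Longrightarrow> X + Y \<in> \<mm>" "X \<in> \<mm> \<Longrightarrow> Y \<in> \<mm> \<Longrightarrow> X - Y \<in> \<mm>"
    "X \<in> \<mm> \<Longrightarrow> r *\<^sub>R X \<in> \<mm>" "X \<in> \<mm> \<Longrightarrow> - X \<in> \<mm>" for X Y r
    unfolding \<mm>_def by (auto intro: span_add span_diff span_scale span_neg)
  have sum: "(\<Sum>j\<in>UNIV. F j) \<in> \<mm>" if "\<And>j. F j \<in> \<mm>" for F :: "_ \<Rightarrow> _"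
    using that unfolding \<mm>_def by (rule span_sum)
  have zero: "0 \<in> \<mm>"
    unfolding \<mm>_def by (rule span_zero)
  have 1: "wedge (axis Time2 1) (axis (Space j) 1) = (1/2) *\<^sub>R (Zp j + transpose (Zp j))"
    "wedge (axis Space1 1) (axis (Space j) 1) = (1/2) *\<^sub>R (Zp j - transpose (Zp j))" for j
    using scaleR_half_double[of "wedge (axis Time2 1) (axis (Space j) 1)"]
      scaleR_half_double[of "wedge (axis Space1 1) (axis (Space j) 1)"]
    unfolding m_wedge(3) unfolding m_wedge(2) by simp_all
  have a: "wedge (axis Time2 1) (axis (Space j) 1) \<in> \<mm>" "wedge (axis Space1 1) (axis (Space j) 1) \<in> \<mm>" for j
    unfolding 1 by (intro mmc m0)+
  have b: "wedge (axis Time2 1) (axis Space1 1) \<in> \<mm>" "wedge (axis (Space i) 1) (axis (Space j) 1) \<in> \<mm>" for i j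
    using m0 by (simp_all add: m_wedge)
  have c: "wedge (axis (Space j) 1) (axis Time2 1) \<in> \<mm>" "wedge (axis (Space j) 1) (axis Space1 1) \<in> \<mm>"
     "wedge (axis Space1 1) (axis Time2 1) \<in> \<mm>" for j
    using a b mmc(4) wedge_commute by metis+
  have d: "wedge (axis d 1) q \<in> \<mm>" if "d \<in> {Time2, Space1} \<union> range Space" for d
    by (subst mid_space_expand[OF q], insert that)
      (auto simp: wedge_simps linear_sum[OF lin(1)] intro!: mmc sum a b c zero)
  show ?thesis
    by (subst mid_space_expand[OF p])
      (auto simp: wedge_simps linear_sum[OF lin(2)] intro!: mmc sum d)
qed

lemma mm_wedge: "(\<mm> :: 'a::finite mat_m set) = span {wedge p q | p q. p \<in> mid_space \<and> q \<in> mid_space}"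
  (is "_ = ?S")
proof
  show "\<mm> \<subseteq> ?S"
    unfolding \<mm>_def
  proof (rule span_minimal)
    have "wedge p q \<in> ?S"
      if "p \<in> mid_space" "q \<in> mid_space" for p q :: "'a vec_m"
      using that by (intro span_base) blast
    then have "H2 \<in> ?S" "Zp j \<in> ?S" "transpose (Zp j) \<in> ?S" "Mij i j \<in> ?S" for i j :: 'a
      unfolding m_wedge(3) unfolding m_wedge(1,2,4) by (auto intro!: span_add span_diff)
    then show "{H2} \<union> range Zp \<union> range (\<lambda>j. transpose (Zp j)) \<union> {Mij i j |i j. True}
        \<subseteq> ?S"
      by blast
  qed simp
  show "?S \<subseteq> \<mm>"
    using wedge_mm by (intro span_minimal) (auto simp: \<mm>_def)
qed

section \<open>The stabilizer of the base point\<close>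

lemma axis_at: "axis c (1 :: real) $ d = (if d = c then 1 else 0)"
  by (simp add: axis_def)

text \<open>The group that \<open>M_hat\<close> turns out to be. It acts on \<open>mid_space\<close> as the full Lorentz group.\<close>

definition M_stab :: "'a::finite mat_m set" where
  "M_stab = {g \<in> G_grp. g *v base_vec = base_vec \<and> g *v opp_vec = opp_vec}"

lemma M_stab_G: "g \<in> M_stab \<Longrightarrow> g \<in> G_grp"
  by (simp add: M_stab_def)

lemma M_stab_one [simp]: "mat 1 \<in> M_stab"
  by (simp add: M_stab_def)

lemma M_stab_mult [intro]: "g \<in> M_stab \<Longrightarrow> h \<in> M_stab \<Longrightarrow> g ** h \<in> M_stab"
  by (auto simp: M_stab_def simp flip: matrix_vector_mul_assoc)

lemma M_stab_inv [intro]: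
  assumes "g \<in> M_stab"
  shows "matrix_inv g \<in> M_stab"
proof -
  have g: "g \<in> G_grp" "g *v base_vec = base_vec" "g *v opp_vec = opp_vec"
    using assms by (simp_all add: M_stab_def)
  have "matrix_inv g *v base_vec = base_vec" "matrix_inv g *v opp_vec = opp_vec"
    using G_grp_inverse_vec(1)[OF g(1), of base_vec] G_grp_inverse_vec(1)[OF g(1), of opp_vec]
    unfolding g(2,3) by blast+
  then show ?thesis
    using g(1) by (simp add: M_stab_def)
qed

lemma M_stab_mid_space:
  assumes "g \<in> M_stab" "v \<in> mid_space"
  shows "g *v v \<in> mid_space"
proof -
  have g: "g \<in> G_grp" "g *v base_vec = base_vec" "g *v opp_vec = opp_vec"
    using assms by (simp_all add: M_stab_def)
  show ?thesis
    unfolding mid_space_iff using G_grp_bform[OF g(1), of base_vec v] G_grp_bform[OF g(1), of opp_vec v] assms(2)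
    by (simp add: g(2,3))
qed

lemma mm_kills: "\<mm> \<subseteq> {X \<in> \<gg>. X *v base_vec = 0 \<and> X *v opp_vec = 0}"
  unfolding mm_wedge
proof (rule span_minimal)
  show "subspace {X \<in> \<gg>. X *v base_vec = 0 \<and> X *v opp_vec = 0}"
    by (auto simp: subspace_def matrix_vector_simps)
qed (auto simp: wedge_mult_vec)

lemma mm_exp_stab: "X \<in> \<mm> \<Longrightarrow> mat_exp X \<in> M_stab"
  using mm_kills gg_exp[of X 1] mat_exp_fixes[of X _ 1] by (auto simp: M_stab_def)

lemma group_GL: "group (GL :: (real ^ 'n ^ 'n) monoid)"
proof (rule groupI)
  have "invertible (mat 1 :: real ^ 'n ^ 'n)"
    unfolding invertible_def by (rule exI[of _ "mat 1"]) simp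
  then show "\<one>\<^bsub>GL\<^esub> \<in> carrier (GL :: (real ^ 'n ^ 'n) monoid)"
    by (simp add: GL_def)
  fix x :: "real ^ 'n ^ 'n" assume "x \<in> carrier GL"
  then show "\<exists>y\<in>carrier GL. y \<otimes>\<^bsub>GL\<^esub> x = \<one>\<^bsub>GL\<^esub>"
    by (auto simp: GL_def invertible_def)
qed (auto simp: GL_def invertible_mult matrix_mul_assoc)

lemma GL_simps [simp]: "x \<otimes>\<^bsub>GL\<^esub> y = x ** y" "\<one>\<^bsub>GL\<^esub> = mat 1" "x \<in> carrier GL \<longleftrightarrow> invertible x"
  by (simp_all add: GL_def)

lemma inv_GL:
  assumes "x ** y = mat 1" "y ** x = mat 1"
  shows "inv\<^bsub>GL\<^esub> x = y"
  using assms by (intro group.inv_equality[OF group_GL]) (auto simp: invertible_def)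

lemma generate_GL_subset_M_stab:
  assumes "S \<subseteq> M_stab"
  shows "generate GL S \<subseteq> M_stab"
proof
  fix x assume "x \<in> generate GL S"
  then show "x \<in> M_stab"
  proof induct
    case (inv h)
    then have h: "h \<in> M_stab" using assms by blast
    then have "inv\<^bsub>GL\<^esub> h = matrix_inv h"
      by (intro inv_GL) (auto dest: M_stab_G)
    then show ?case using h by auto
  qed (use assms in auto)
qed

abbreviation "M0 \<equiv> analytic_subgroup \<mm>"

lemma M0_stab: "M0 \<subseteq> M_stab"
  unfolding analytic_subgroup_def by (intro generate_GL_subset_M_stab) (auto intro: mm_exp_stab)

lemma M0_exp: "X \<in> \<mm> \<Longrightarrow> mat_exp X \<in> M0"
  unfolding analytic_subgroup_def by (intro generate.incl) auto

lemma M0_one: "mat 1 \<in> M0"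
  unfolding analytic_subgroup_def using generate.one[of GL] by simp

lemma M0_mult: "g \<in> M0 \<Longrightarrow> h \<in> M0 \<Longrightarrow> g ** h \<in> M0"
  unfolding analytic_subgroup_def using generate.eng[of g GL _ h] by simp

lemma mm_scaleR: "X \<in> \<mm> \<Longrightarrow> r *\<^sub>R X \<in> \<mm>" and mm_minus: "X \<in> \<mm> \<Longrightarrow> - X \<in> \<mm>"
  unfolding \<mm>_def by (auto intro: span_scale span_neg)

lemma M0_induct [consumes 1, case_names one exp mult]:
  assumes "g \<in> M0" "P (mat 1)" "\<And>X. X \<in> \<mm> \<Longrightarrow> P (mat_exp X)"
    "\<And>g h. g \<in> M0 \<Longrightarrow> h \<in> M0 \<Longrightarrow> P g \<Longrightarrow> P h \<Longrightarrow> P (g ** h)"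
  shows "P g"
  using assms(1) unfolding analytic_subgroup_def
proof induct
  case (incl h)
  then show ?case using assms(3) by auto
next
  case (inv h)
  then obtain X where X: "X \<in> \<mm>" "h = mat_exp X" by auto
  have "inv\<^bsub>GL\<^esub> h = mat_exp (- X)"
    unfolding X(2) by (intro inv_GL mat_exp_inverse)
  then show ?case using assms(3) mm_minus[OF X(1)] by simp
qed (use assms in \<open>auto simp: analytic_subgroup_def\<close>)

lemma M0_inverse:
  assumes "g \<in> M0"
  shows "\<exists>h\<in>M0. h ** g = mat 1 \<and> g ** h = mat 1"
  using assms
proof (induct rule: M0_induct)
  case one
  then show ?case by (intro bexI[of _ "mat 1"]) (auto simp: M0_one)
next
  case (exp X)
  then show ?case
    by (intro bexI[of _ "mat_exp (- X)"]) (auto simp: mat_exp_inverse M0_exp mm_minus)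
next
  case (mult g h)
  then obtain g' h' where gh: "g' \<in> M0" "g' ** g = mat 1" "g ** g' = mat 1"
     "h' \<in> M0" "h' ** h = mat 1" "h ** h' = mat 1" by blast
  have "h' ** g' ** (g ** h) = h' ** (g' ** g) ** h" "g ** h ** (h' ** g') = g ** (h ** h') ** g'"
    by (simp_all only: matrix_mul_assoc)
  then show ?case
    using gh by (intro bexI[of _ "h' ** g'"]) (auto intro: M0_mult)
qed

lemma M0_inv_fixes: "h ** g = mat 1 \<Longrightarrow> g *v x = y \<Longrightarrow> h *v y = x" for h g :: "real ^ 'n ^ 'n"
  by (auto simp: matrix_vector_mul_assoc)

text \<open>The exponential of \<open>t (q \<and> p)\<close> rotates the plane of \<open>p, q\<close> and fixes its orthogonal complement.\<close>

lemma M0_rotation: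
  assumes pq: "p \<in> mid_space" "q \<in> mid_space" "bform p p = 1" "bform q q = 1" "bform p q = 0"
    and cs: "c\<^sup>2 + s\<^sup>2 = (1 :: real)"
  shows "\<exists>h\<in>M0. h *v (c *\<^sub>R p + s *\<^sub>R q) = p \<and> (\<forall>z. bform p z = 0 \<longrightarrow> bform q z = 0 \<longrightarrow> h *v z = z)"
proof -
  obtain t where t: "c = cos t" "s = sin t"
    using sincos_total_2pi[OF cs] by metis
  define X where "X = wedge q p"
  have X: "X \<in> \<mm>"
    unfolding X_def using pq by (intro wedge_mm)
  have Xpq: "X *v p = q" "X *v q = - p"
    using pq by (simp_all add: X_def wedge_mult_vec bform_commute)
  have "mat_exp (t *\<^sub>R X) *v (cos 0 *\<^sub>R p + sin 0 *\<^sub>R q) = cos t *\<^sub>R p + sin t *\<^sub>R q"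
    by (rule mat_exp_flow[of "\<lambda>t. cos t *\<^sub>R p + sin t *\<^sub>R q"])
      (auto intro!: derivative_eq_intros simp: matrix_vector_simps Xpq)
  then have "mat_exp (t *\<^sub>R X) *v p = cos t *\<^sub>R p + sin t *\<^sub>R q"
    by simp
  then have "mat_exp (- (t *\<^sub>R X)) *v (cos t *\<^sub>R p + sin t *\<^sub>R q) = p"
    by (rule M0_inv_fixes[OF mat_exp_inverse(1)])
  moreover have "mat_exp ((- t) *\<^sub>R X) *v z = z" if "bform p z = 0" "bform q z = 0" for z
    using that by (intro mat_exp_fixes) (simp add: X_def wedge_mult_vec)
  ultimately show ?thesis
    unfolding t using M0_exp[OF mm_scaleR[OF X, of "- t"]] by (intro bexI[of _ "mat_exp ((- t) *\<^sub>R X)"]) auto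
qed

text \<open>For a timelike \<open>p\<close> the same exponential is a hyperbolic rotation.\<close>

lemma M0_boost:
  assumes pq: "p \<in> mid_space" "q \<in> mid_space" "bform p p = - 1" "bform q q = 1" "bform p q = 0"
    and cs: "c\<^sup>2 = 1 + s\<^sup>2" "(0 :: real) < c"
  shows "\<exists>h\<in>M0. h *v (c *\<^sub>R p + s *\<^sub>R q) = p"
proof -
  define t where "t = arsinh s"
  have t: "s = sinh t" "c = cosh t"
    using cs by (simp_all add: t_def cosh_arsinh_real real_sqrt_unique add.commute)
  define X where "X = wedge p q"
  have X: "X \<in> \<mm>"
    unfolding X_def using pq by (intro wedge_mm)
  have Xpq: "X *v p = q" "X *v q = p"
    using pq by (simp_all add: X_def wedge_mult_vec bform_commute)
  have "mat_exp (t *\<^sub>R X) *v (cosh 0 *\<^sub>R p + sinh 0 *\<^sub>R q) = cosh t *\<^sub>R p + sinh t *\<^sub>R q"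
    by (rule mat_exp_flow[of "\<lambda>t. cosh t *\<^sub>R p + sinh t *\<^sub>R q"])
      (auto intro!: derivative_eq_intros simp: matrix_vector_simps Xpq)
  then have "mat_exp (t *\<^sub>R X) *v p = cosh t *\<^sub>R p + sinh t *\<^sub>R q"
    by simp
  then have "mat_exp (- (t *\<^sub>R X)) *v (cosh t *\<^sub>R p + sinh t *\<^sub>R q) = p"
    by (rule M0_inv_fixes[OF mat_exp_inverse(1)])
  then show ?thesis
    unfolding t using M0_exp[OF mm_scaleR[OF X, of "- t"]] by (intro bexI[of _ "mat_exp ((- t) *\<^sub>R X)"]) auto
qed

lemma mid_space_bform_expand:
  "y \<in> mid_space \<Longrightarrow> bform y y = - (y $ Time2)\<^sup>2 + (y $ Space1)\<^sup>2 + (\<Sum>j\<in>UNIV. (y $ Space j)\<^sup>2)"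
  by (simp add: bform_def sum_coord mid_space_def power2_eq_square)

lemma mid_space_spatial_pos:
  assumes "y \<in> mid_space" "y $ Time2 = 0"
  shows "0 \<le> bform y y" "bform y y = 0 \<Longrightarrow> y = 0"
proof -
  have nn: "0 \<le> (\<Sum>j\<in>UNIV. (y $ Space j)\<^sup>2)"
    by (simp add: sum_nonneg)
  then show "0 \<le> bform y y"
    using assms by (simp add: mid_space_bform_expand)
  assume "bform y y = 0"
  then have "(y $ Space1)\<^sup>2 = 0" "(\<Sum>j\<in>UNIV. (y $ Space j)\<^sup>2) = 0"
    using assms nn by (auto simp: mid_space_bform_expand add_nonneg_eq_0_iff)
  then have "y $ Space1 = 0" "\<And>j. y $ Space j = 0"
    by (auto simp: sum_nonneg_eq_0_iff)
  then have "y $ c = 0" for c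
    using assms by (cases c) (auto simp: mid_space_def)
  then show "y = 0"
    by (simp add: vec_eq_iff)
qed

lemma mid_space_spatial_normalize:
  assumes "y \<in> mid_space" "y $ Time2 = 0" "y \<noteq> 0"
  obtains s q where "q \<in> mid_space" "y = s *\<^sub>R q" "bform q q = 1" "s\<^sup>2 = bform y y" "q = (1/s) *\<^sub>R y" "s \<noteq> 0"
proof -
  define s where "s = sqrt (bform y y)"
  have s: "s\<^sup>2 = bform y y" "s \<noteq> 0"
    using mid_space_spatial_pos[OF assms(1,2)] assms(3) by (auto simp: s_def)
  have q: "(1/s) *\<^sub>R y \<in> mid_space"
    using assms(1) by (rule mid_space_closed(4))
  have "bform ((1/s) *\<^sub>R y) ((1/s) *\<^sub>R y) = 1"
    using s(2) by (simp add: bform_simps s(1)[symmetric] power2_eq_square)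
  moreover have "y = s *\<^sub>R (1/s) *\<^sub>R y"
    using s(2) by simp
  ultimately show thesis
    using that[OF q _ _ s(1) refl s(2)] by blast
qed

text \<open>Spatial basis vectors are brought back to their places one after the other. The rotation that takes
  the image of the next one back acts in a plane orthogonal to those already treated, so it does not
  disturb them.\<close>

lemma M0_fixes_space_coordinates:
  fixes F :: "'a::finite set"
  assumes g: "g \<in> M_stab" "g *v axis Time2 1 = axis Time2 1"
  shows "\<exists>h\<in>M0. (h ** g) *v axis Time2 1 = axis Time2 1 \<and> (\<forall>j\<in>F. (h ** g) *v axis (Space j) 1 = axis (Space j) 1)"
proof (induct F rule: finite_induct[OF finite])
  case 1
  then show ?case
    using g by (intro bexI[of _ "mat 1"]) (auto simp: M0_one)
next
  case (2 j F)
  then obtain h where h: "h \<in> M0" "(h ** g) *v axis Time2 1 = axis Time2 1"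
    "\<And>i. i \<in> F \<Longrightarrow> (h ** g) *v axis (Space i) 1 = axis (Space i) 1" by blast
  define k where "k = h ** g"
  have k: "k \<in> M_stab"
    using h(1) g(1) M0_stab by (auto simp: k_def)
  note hk = h(2,3)[folded k_def]
  define p where "p = (axis (Space j) 1 :: 'a vec_m)"
  define x where "x = k *v p"
  have p: "p \<in> mid_space" "bform p p = 1"
    by (simp_all add: p_def)
  have x: "x \<in> mid_space" "bform x x = 1"
    using M_stab_mid_space[OF k p(1)] p(2) G_grp_bform[OF M_stab_G[OF k]] by (simp_all add: x_def)
  have xT: "bform x (axis Time2 1) = 0"
    using G_grp_bform[OF M_stab_G[OF k], of p "axis Time2 1"] hk(1) by (simp add: x_def p_def del: bform_axis) (simp add: axis_at)
  have xF: "bform x (axis (Space i) 1) = 0" if "i \<in> F" for i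
    using G_grp_bform[OF M_stab_G[OF k], of p "axis (Space i) 1"] hk(2)[OF that] that 2(2)
    by (simp add: x_def p_def del: bform_axis) (auto simp: axis_at)
  define c where "c = bform p x"
  define y where "y = x - c *\<^sub>R p"
  have y: "y \<in> mid_space" "y $ Time2 = 0" "bform p y = 0" "bform y y = 1 - c\<^sup>2"
    using x p xT by (auto simp: y_def bform_simps c_def power2_eq_square p_def axis_at intro!: mid_space_closed(3,4))
  \<comment> \<open>If the image is already \<open>p\<close> or \<open>-p\<close>, any orthogonal direction will do; \<open>Space1\<close> is never among the treated coordinates.\<close>
  obtain q s where q: "q \<in> mid_space" "bform q q = 1" "bform p q = 0" "y = s *\<^sub>R q" "s\<^sup>2 = 1 - c\<^sup>2"
    "bform q (axis Time2 1) = 0" "\<And>i. i \<in> F \<Longrightarrow> bform q (axis (Space i) 1) = 0"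
  proof (cases "y = 0")
    case True
    show ?thesis
    proof (rule that[of "axis Space1 1" 0])
      show "0\<^sup>2 = 1 - c\<^sup>2"
        using True y(4) by (simp add: bform_simps)
    qed (use True in \<open>simp_all add: p_def\<close>, simp_all add: axis_at)
  next
    case False
    obtain s q where sq: "q \<in> mid_space" "y = s *\<^sub>R q" "bform q q = 1" "s\<^sup>2 = bform y y" "q = (1/s) *\<^sub>R y" "s \<noteq> 0"
      using mid_space_spatial_normalize[OF y(1,2) False] by blast
    show ?thesis
    proof (rule that[of q s])
      show "bform q (axis (Space i) 1) = 0" if "i \<in> F" for i
      proof -
        have "bform y (axis (Space i) 1) = 0"
          using xF[OF that] that 2(2) by (simp add: y_def bform_simps p_def) (auto simp: axis_at)
        then show ?thesis by (simp add: sq(5) bform_simps)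
      qed
      show "bform q (axis Time2 1) = 0" "bform p q = 0"
        using y(2,3) by (simp_all add: sq(5) bform_simps)
    qed (fact sq(1) sq(2) sq(3) sq(4)[unfolded y(4)])+
  qed
  have "x = c *\<^sub>R p + s *\<^sub>R q"
    using q(4) by (simp add: y_def algebra_simps)
  then obtain r where r: "r \<in> M0" "r *v x = p" "\<And>z. bform p z = 0 \<Longrightarrow> bform q z = 0 \<Longrightarrow> r *v z = z"
    using M0_rotation[OF p(1) q(1) p(2) q(2,3), of c s] q(5) by auto
  have "r *v axis Time2 1 = axis Time2 1"
    by (intro r(3) q(6)) (simp add: p_def axis_at)
  moreover have "r *v axis (Space i) 1 = axis (Space i) 1" if "i \<in> F" for i
    by (intro r(3) q(7) that) (use that 2(2) in \<open>auto simp: p_def axis_at\<close>)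
  ultimately have "\<forall>i\<in>insert j F. (r ** k) *v axis (Space i) 1 = axis (Space i) 1"
     "(r ** k) *v axis Time2 1 = axis Time2 1"
    using hk r(2) by (auto simp: x_def p_def simp flip: matrix_vector_mul_assoc)
  then show ?case
    using r(1) h(1) by (intro bexI[of _ "r ** h"]) (auto simp: k_def matrix_mul_assoc intro: M0_mult)
qed

lemma matrix_eq_axis:
  fixes A B :: "real ^ 'n ^ 'm"
  assumes "\<And>c. A *v axis c 1 = B *v axis c 1"
  shows "A = B"
  using assms by (simp add: matrix_vector_mult_basis column_def vec_eq_iff)

lemma w_mult_vec: "w1 *v x = (\<chi> c. if c = Time2 then - x $ c else x $ c)"
  "w2 *v x = (\<chi> c. if c = Space1 then - x $ c else x $ c)"
proof -
  have 1: "(\<Sum>j\<in>UNIV. (if i = j then if i = k then - 1 else 1 else 0) * x $ j) = (if i = k then - x $ i else x $ i)" for i k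
    by (subst sum.remove[of _ i]) (auto intro!: sum.neutral)
  show "w1 *v x = (\<chi> c. if c = Time2 then - x $ c else x $ c)"
    "w2 *v x = (\<chi> c. if c = Space1 then - x $ c else x $ c)"
    by (simp_all only: vec_eq_iff w1_def w2_def matrix_vector_mult_def vec_lambda_beta 1 simp_thms)
qed

lemma w_stab [simp]: "w1 \<in> M_stab" "w2 \<in> M_stab"
  by (auto simp: M_stab_def G_grp_iff bform_def w_mult_vec base_opp_defs axis_at vec_eq_iff intro!: sum.cong)

lemma w_sq: "w1 ** w1 = mat 1" "w2 ** w2 = mat 1"
  by (simp_all add: matrix_eq w_mult_vec vec_eq_iff flip: matrix_vector_mul_assoc)

text \<open>Only the image of the coordinate \<open>Space1\<close> is left, and orthogonality confines it to its axis.\<close>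

lemma M_stab_determined:
  fixes g :: "'a::finite mat_m"
  assumes g: "g \<in> M_stab" "g *v axis Time2 1 = axis Time2 1"
    "\<And>j. g *v axis (Space j) 1 = axis (Space j) 1"
  shows "g = mat 1 \<or> g = w2"
proof -
  define x where "x = g *v axis Space1 1"
  have G: "g \<in> G_grp" using g(1) by (rule M_stab_G)
  have "(axis Time1 1 :: 'a vec_m) = (1/2) *\<^sub>R (base_vec + opp_vec)" "(axis Space2 1 :: 'a vec_m) = (1/2) *\<^sub>R (base_vec - opp_vec)"
    by (simp_all add: base_opp_defs vec_eq_iff axis_at)
  then have T: "g *v axis Time1 1 = axis Time1 1" "g *v axis Space2 1 = axis Space2 1"
    using g(1) by (simp_all add: M_stab_def matrix_vector_simps)
  have x: "x \<in> mid_space"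
    unfolding x_def by (intro M_stab_mid_space g) simp
  have "bform x (axis Time2 1) = 0" "\<And>j. bform x (axis (Space j) 1) = 0"
    using G_grp_bform[OF G, of "axis Space1 1" "axis Time2 1"] G_grp_bform[OF G, of "axis Space1 1" "axis (Space j) 1" for j] g
    by (simp_all add: x_def del: bform_axis) (simp_all add: axis_at)
  then have xc: "x $ Time2 = 0" "\<And>j. x $ Space j = 0"
    by simp_all
  have "bform x x = 1"
    unfolding x_def G_grp_bform[OF G] by (simp add: axis_at)
  then have "(x $ Space1)\<^sup>2 = 1"
    using x xc by (simp add: mid_space_bform_expand)
  then have "x $ Space1 = 1 \<or> x $ Space1 = - 1"
    by (simp add: power2_eq_1_iff)
  moreover have "x = x $ Space1 *\<^sub>R axis Space1 1"
    using mid_space_expand[OF x] xc by simp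
  ultimately have "x = axis Space1 1 \<or> x = - axis Space1 1"
    by (metis scaleR_minus1_left scaleR_one)
  then show ?thesis
  proof
    assume "x = axis Space1 1"
    then have "g *v axis c 1 = mat 1 *v axis c 1" for c
      using g T by (cases c) (auto simp: x_def)
    then show ?thesis using matrix_eq_axis by blast
  next
    assume "x = - axis Space1 1"
    then have "g *v axis c 1 = w2 *v axis c 1" for c
      using g T by (cases c) (auto simp: x_def w_mult_vec vec_eq_iff axis_at)
    then show ?thesis using matrix_eq_axis by blast
  qed
qed

text \<open>A boost takes the image of the time axis back, provided that it points to the future; then the
  spatial coordinates follow.\<close>

lemma M_stab_time_oriented:
  fixes g :: "'a::finite mat_m"
  assumes g: "g \<in> M_stab" and pos: "0 \<le> (g *v axis Time2 1) $ Time2"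
  shows "\<exists>h\<in>M0. g = h \<or> g = h ** w2"
proof -
  define p where "p = (axis Time2 1 :: 'a vec_m)"
  define x where "x = g *v p"
  have p: "p \<in> mid_space" "bform p p = - 1"
    by (simp_all add: p_def)
  have x: "x \<in> mid_space" "bform x x = - 1"
    using M_stab_mid_space[OF g p(1)] p(2) G_grp_bform[OF M_stab_G[OF g]] by (simp_all add: x_def)
  define c where "c = x $ Time2"
  define y where "y = x - c *\<^sub>R p"
  have y: "y \<in> mid_space" "y $ Time2 = 0" "bform p y = 0" "bform y y = c\<^sup>2 - 1"
    using x p by (auto simp: y_def c_def bform_simps power2_eq_square p_def axis_at intro!: mid_space_closed(3,4))
  obtain r where r: "r \<in> M0" "r *v x = p"
  proof (cases "y = 0")
    case True
    then have "c\<^sup>2 = 1" "x = c *\<^sub>R p"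
      using y(4) by (simp_all add: bform_simps y_def)
    moreover have "0 \<le> c"
      using pos by (simp add: c_def x_def p_def)
    ultimately have "x = p"
      by (simp add: power2_eq_1_iff)
    then show ?thesis using that[of "mat 1"] M0_one by simp
  next
    case False
    obtain s q where q: "q \<in> mid_space" "y = s *\<^sub>R q" "bform q q = 1" "s\<^sup>2 = bform y y" "q = (1/s) *\<^sub>R y" "s \<noteq> 0"
      using mid_space_spatial_normalize[OF y(1,2) False] by blast
    have cs: "c\<^sup>2 = 1 + s\<^sup>2"
      using q(4) y(4) by simp
    have pq: "bform p q = 0"
      unfolding q(5) using y(3) by (simp add: bform_simps)
    have "0 \<le> c"
      using pos by (simp add: c_def x_def p_def)
    moreover have "c \<noteq> 0"
      using cs zero_le_power2[of s] by (intro notI) (simp add: add_nonneg_eq_0_iff)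
    ultimately obtain r where "r \<in> M0" "r *v (c *\<^sub>R p + s *\<^sub>R q) = p"
      using M0_boost[OF p(1) q(1) p(2) q(3) pq cs] by auto
    moreover have "c *\<^sub>R p + s *\<^sub>R q = x"
      unfolding q(2)[symmetric] y_def by simp
    ultimately show ?thesis
      using that by simp
  qed
  have rg: "r ** g \<in> M_stab" "(r ** g) *v axis Time2 1 = axis Time2 1"
    using r g M0_stab by (auto simp: x_def p_def simp flip: matrix_vector_mul_assoc)
  obtain h where h: "h \<in> M0" "(h ** (r ** g)) *v axis Time2 1 = axis Time2 1"
    "\<And>j. (h ** (r ** g)) *v axis (Space j) 1 = axis (Space j) 1"
    using M0_fixes_space_coordinates[OF rg, of UNIV] by blast
  have "h ** (r ** g) \<in> M_stab"
    using h(1) rg(1) M0_stab by blast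
  from M_stab_determined[OF this h(2,3)]
  have 1: "(h ** r) ** g = mat 1 \<or> (h ** r) ** g = w2"
    by (simp add: matrix_mul_assoc)
  obtain k where k: "k \<in> M0" "k ** (h ** r) = mat 1"
    using M0_inverse[OF M0_mult[OF h(1) r(1)]] by blast
  have "g = k ** ((h ** r) ** g)"
    using matrix_mul_assoc[of k "h ** r" g] k(2) by simp
  then show ?thesis
    using 1 k(1) by auto
qed

lemma M0_normal:
  assumes "w = w1 \<or> w = w2" "h \<in> M0"
  shows "w ** h ** w \<in> M0"
proof -
  have w: "w ** w = mat 1" "w \<in> M_stab"
    using assms(1) w_sq by auto
  have mm: "\<mm> \<subseteq> {X. w ** X ** w \<in> \<mm>}"
  proof (subst mm_wedge, rule span_minimal)
    show "subspace {X. w ** X ** w \<in> \<mm>}"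
      by (auto simp: subspace_def matrix_mult_simps \<mm>_def intro: span_add span_scale span_zero)
    have "w ** wedge p q ** w = wedge (w *v p) (w *v q)" for p q
      using wedge_conj[OF M_stab_G[OF w(2)], of p q] by (simp add: w(1) flip: matrix_mul_assoc)
    then show "{wedge p q | p q. p \<in> mid_space \<and> q \<in> mid_space} \<subseteq> {X. w ** X ** w \<in> \<mm>}"
      using M_stab_mid_space[OF w(2)] by (auto intro!: wedge_mm)
  qed
  show ?thesis
    using assms(2)
  proof (induct rule: M0_induct)
    case one
    then show ?case by (simp add: w M0_one)
  next
    case (exp X)
    have "w ** X = (w ** X ** w) ** w"
      by (simp add: w flip: matrix_mul_assoc)
    from mat_exp_intertwine[OF this, of 1]
    have "w ** mat_exp X ** w = mat_exp (w ** X ** w)"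
      by (simp add: w flip: matrix_mul_assoc)
    then show ?case using mm exp M0_exp by auto
  next
    case (mult g h)
    have "w ** (g ** h) ** w = (w ** g ** (w ** w) ** h ** w)"
      by (simp add: w matrix_mul_assoc)
    also have "\<dots> = (w ** g ** w) ** (w ** h ** w)"
      by (simp add: matrix_mul_assoc)
    finally show ?case using mult M0_mult by simp
  qed
qed

text \<open>If the time orientation is reversed, \<open>w1\<close> restores it. The reduction leaves a possible factor \<open>w2\<close>
  on the right, which is moved to the left because \<open>w2\<close> normalizes the connected group.\<close>

lemma M_hat_eq: "M_hat = M_stab"
proof
  have "generate GL {w1, w2} \<subseteq> M_stab"
    by (rule generate_GL_subset_M_stab) auto
  then show "M_hat \<subseteq> M_stab"
    using M0_stab by (auto simp: M_hat_def set_mult_def)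
next
  have gen: "mat 1 \<in> generate GL {w1, w2 :: 'a mat_m}" "w1 \<in> generate GL {w1, w2 :: 'a mat_m}"
    "w2 \<in> generate GL {w1, w2 :: 'a mat_m}" "w1 ** w2 \<in> generate GL {w1, w2 :: 'a mat_m}"
    using generate.one[of GL "{w1, w2}"] generate.incl[of _ "{w1, w2}" GL]
      generate.eng[of w1 GL "{w1, w2}" w2] by auto
  have hw: "h ** w2 = w2 ** (w2 ** h ** w2)" for h :: "'a mat_m"
    by (simp add: matrix_mul_assoc w_sq)
  show "M_stab \<subseteq> (M_hat :: 'a mat_m set)"
  proof
    fix g :: "'a mat_m" assume g: "g \<in> M_stab"
    show "g \<in> M_hat"
    proof (cases "0 \<le> (g *v axis Time2 1) $ Time2")
      case True
      then obtain h where "h \<in> M0" "g = mat 1 ** h \<or> g = w2 ** (w2 ** h ** w2)"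
        using M_stab_time_oriented[OF g] hw by (metis matrix_mul_lid)
      then show ?thesis
        unfolding M_hat_def set_mult_def using gen M0_normal[of w2] by blast
    next
      case False
      have "0 \<le> ((w1 ** g) *v axis Time2 1) $ Time2"
        using False by (simp add: w_mult_vec flip: matrix_vector_mul_assoc)
      moreover have "w1 ** g \<in> M_stab"
        using g by auto
      ultimately obtain h where h: "h \<in> M0" "w1 ** g = h \<or> w1 ** g = h ** w2"
        using M_stab_time_oriented by blast
      have "g = w1 ** (w1 ** g)"
        by (simp add: matrix_mul_assoc w_sq)
      then have "g = w1 ** h \<or> g = (w1 ** w2) ** (w2 ** h ** w2)"
        using h(2) hw[of h] by (metis matrix_mul_assoc)
      then show ?thesis
        unfolding M_hat_def set_mult_def using gen h(1) M0_normal[of w2 h] by blast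
    qed
  qed
qed

section \<open>The parabolic subgroups and induction\<close>

text \<open>Lines and rays are treated at the same time: the flag \<open>s\<close> is true for lines. Then \<open>c\<close> in \<open>scalars s\<close>
  says that \<open>c x\<close> and \<open>x\<close> span the same line, respectively ray.\<close>

definition L_grp :: "bool \<Rightarrow> 'a::finite mat_m set" where
  "L_grp s = (if s then M_grp else M_hat)"

definition scalars :: "bool \<Rightarrow> real set" where
  "scalars s = (if s then - {0} else {0<..})"

lemma scalars_nonzero: "c \<in> scalars s \<Longrightarrow> c \<noteq> 0"
  by (auto simp: scalars_def split: if_splits)

lemma scalars_mult: "c \<in> scalars s \<Longrightarrow> d \<in> scalars s \<Longrightarrow> c * d \<in> scalars s"
  by (auto simp: scalars_def split: if_splits)

lemma scalars_inverse: "c \<in> scalars s \<Longrightarrow> inverse c \<in> scalars s"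
  by (auto simp: scalars_def split: if_splits)

lemma scalars_pos: "0 < c \<Longrightarrow> c \<in> scalars s"
  by (auto simp: scalars_def)

lemma L_grp_iff:
  "m \<in> L_grp s \<longleftrightarrow> m \<in> G_grp \<and>
     (\<exists>\<sigma>\<in>{1, -1} \<inter> scalars s. m *v base_vec = \<sigma> *\<^sub>R base_vec \<and> m *v opp_vec = \<sigma> *\<^sub>R opp_vec)"
proof (cases s)
  case True
  have "m \<in> M_grp \<longleftrightarrow> m \<in> M_stab \<or> - m \<in> M_stab"
  proof
    assume "m \<in> M_grp"
    then show "m \<in> M_stab \<or> - m \<in> M_stab"
      by (auto simp: M_grp_def M_hat_eq set_mult_def matrix_mult_simps)
  next
    have "m = mat 1 ** m" "m = - mat 1 ** - m"
      by (simp_all add: matrix_mult_simps)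
    moreover assume "m \<in> M_stab \<or> - m \<in> M_stab"
    ultimately show "m \<in> M_grp"
      unfolding M_grp_def M_hat_eq set_mult_def by blast
  qed
  also have "\<dots> \<longleftrightarrow> m \<in> G_grp \<and> (m *v base_vec = base_vec \<and> m *v opp_vec = opp_vec \<or>
      m *v base_vec = - base_vec \<and> m *v opp_vec = - opp_vec)"
  proof -
    have "- m \<in> G_grp \<longleftrightarrow> m \<in> G_grp"
      using G_grp_minus[of m] G_grp_minus[of "- m"] by auto
    moreover have "- m *v x = x \<longleftrightarrow> m *v x = - x" for x
      by (simp only: matrix_vector_simps) (metis minus_minus)
    ultimately show ?thesis
      unfolding M_stab_def by blast
  qed
  finally show ?thesis
    using True by (auto simp: L_grp_def scalars_def)
next
  case False
  then show ?thesis
    by (auto simp: L_grp_def scalars_def M_hat_eq M_stab_def)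
qed

lemma L_grp_G: "m \<in> L_grp s \<Longrightarrow> m \<in> G_grp"
  by (simp add: L_grp_iff)

lemma exp_H_base: "mat_exp (t *\<^sub>R H_mat) *v base_vec = exp t *\<^sub>R base_vec"
proof -
  have "((\<lambda>t. exp t *\<^sub>R base_vec) has_vector_derivative H_mat *v (exp t *\<^sub>R base_vec)) (at t)" for t :: real
    by (auto intro!: derivative_eq_intros simp: matrix_vector_simps H_mat_mult)
  from mat_exp_flow[of "\<lambda>t. exp t *\<^sub>R base_vec", OF this] show ?thesis by simp
qed

lemma exp_H_opp: "mat_exp (t *\<^sub>R H_mat) *v opp_vec = exp (- t) *\<^sub>R opp_vec"
proof -
  have "((\<lambda>t. exp (- t) *\<^sub>R opp_vec) has_vector_derivative H_mat *v (exp (- t) *\<^sub>R opp_vec)) (at t)" for t :: real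
    by (auto intro!: derivative_eq_intros simp: matrix_vector_simps H_mat_mult)
  from mat_exp_flow[of "\<lambda>t. exp (- t) *\<^sub>R opp_vec", OF this] show ?thesis by simp
qed

lemma exp_n_base: "mat_exp (wedge base_vec v) *v base_vec = base_vec" if "v \<in> mid_space"
  using mat_exp_fixes[of "wedge base_vec v" base_vec 1] that by (simp add: wedge_mult_vec)

lemma exp_n_opp:
  assumes "v \<in> mid_space"
  shows "mat_exp (wedge base_vec v) *v opp_vec = opp_vec + 2 *\<^sub>R v + bform v v *\<^sub>R base_vec"
proof -
  let ?\<phi> = "\<lambda>t. opp_vec + (2 * t) *\<^sub>R v + (t * t * bform v v) *\<^sub>R base_vec"
  have "(?\<phi> has_vector_derivative wedge base_vec v *v ?\<phi> t) (at t)" for t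
    using assms
    by (auto intro!: derivative_eq_intros simp: matrix_vector_simps wedge_mult_vec bform_simps algebra_simps)
  from mat_exp_flow[of ?\<phi>, OF this, of 1] show ?thesis by simp
qed

lemma A_grp_eq: "A_grp = range (\<lambda>t. mat_exp (t *\<^sub>R H_mat))"
  by (auto simp: A_grp_def)

lemma A_grp_G: "a \<in> A_grp \<Longrightarrow> a \<in> G_grp"
  by (auto simp: A_grp_eq gg_exp)

lemma Np_grp_eq: "Np_grp = {mat_exp (wedge base_vec v) | v. v \<in> mid_space}"
  by (auto simp: Np_grp_def nnp_wedge)

lemma Np_grp_G: "\<eta> \<in> Np_grp \<Longrightarrow> \<eta> \<in> G_grp"
  using gg_exp[OF wedge_in_gg, of 1] by (auto simp: Np_grp_eq)

lemma \<xi>_exp: "\<xi> l (mat_exp (t *\<^sub>R H_mat :: 'a::finite mat_m)) = exp (l * of_real t)"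
proof -
  have "t = s" if "mat_exp (t *\<^sub>R H_mat :: 'a mat_m) = mat_exp (s *\<^sub>R H_mat)" for s
    using arg_cong[OF that, of "\<lambda>g. g *v base_vec"] by (simp add: exp_H_base)
  then have "(THE s. mat_exp (t *\<^sub>R H_mat :: 'a mat_m) = mat_exp (s *\<^sub>R H_mat)) = t"
    by (intro the_equality) auto
  then show ?thesis
    by (simp add: \<xi>_def)
qed

text \<open>The vector \<open>p\<^sup>-\<^sup>1 f\<close> is isotropic and pairs with \<open>p\<^sup>-\<^sup>1 e\<close> as \<open>f\<close> does with \<open>e\<close>; these two equations say
  that it is \<open>c exp(e \<and> v) f\<close> for some \<open>v\<close>. So \<open>p exp(e \<and> v) exp(-ln c H)\<close> fixes both \<open>e\<close> and \<open>f\<close>.\<close>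

lemma parabolic_decompose_pos:
  assumes p: "p \<in> G_grp" and c: "p *v base_vec = c *\<^sub>R base_vec" "0 < c"
  shows "\<exists>m\<in>M_stab. \<exists>\<eta>\<in>Np_grp. p = m ** mat_exp (ln c *\<^sub>R H_mat) ** \<eta>"
proof -
  define q where "q = matrix_inv p"
  have qe: "q *v base_vec = (1/c) *\<^sub>R base_vec"
    using arg_cong[OF c(1), of "\<lambda>x. (1/c) *\<^sub>R (q *v x)"] p c(2) by (simp add: q_def matrix_vector_simps)
  have qG: "q \<in> G_grp" using p by (simp add: q_def)
  obtain \<alpha> \<beta> w where x: "q *v opp_vec = \<alpha> *\<^sub>R base_vec + \<beta> *\<^sub>R opp_vec + w" and w: "w \<in> mid_space"
    using vec_decompose .
  have "bform (q *v base_vec) (q *v opp_vec) = -2"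
    by (simp add: G_grp_bform[OF qG])
  then have \<beta>: "\<beta> = c"
    using w c(2) by (simp add: qe x bform_simps field_simps)
  have "bform (q *v opp_vec) (q *v opp_vec) = 0"
    by (simp add: G_grp_bform[OF qG])
  then have \<alpha>: "4 * \<alpha> * c = bform w w"
    using w by (simp add: x \<beta> bform_simps)
  define v where "v = (1 / (2 * c)) *\<^sub>R w"
  have v: "v \<in> mid_space" using w by (auto simp: v_def)
  have qf: "q *v opp_vec = c *\<^sub>R (opp_vec + 2 *\<^sub>R v + bform v v *\<^sub>R base_vec)"
    using c(2) by (simp add: x \<beta> v_def bform_simps \<alpha>[symmetric] algebra_simps)
  define n where "n = mat_exp (wedge base_vec v)"
  define a where "a = mat_exp (ln c *\<^sub>R H_mat :: 'a mat_m)"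
  define a' where "a' = mat_exp (- (ln c *\<^sub>R H_mat) :: 'a mat_m)"
  have aa: "a' ** a = mat 1"
    by (simp add: a_def a'_def mat_exp_inverse)
  have nn: "n ** mat_exp (wedge base_vec (- v)) = mat 1" "mat_exp (wedge base_vec (- v)) \<in> Np_grp"
    using v by (auto simp: n_def mat_exp_inverse wedge_simps Np_grp_eq intro!: exI[of _ "- v"])
  define m where "m = p ** n ** a'"
  have a'e: "a' *v base_vec = (1/c) *\<^sub>R base_vec" "a' *v opp_vec = c *\<^sub>R opp_vec"
    using exp_H_base[of "- ln c"] exp_H_opp[of "- ln c"] c(2) by (simp_all add: a'_def exp_minus inverse_eq_divide)
  have "m *v base_vec = base_vec"
    using c by (simp add: m_def n_def a'e matrix_vector_simps exp_n_base[OF v] flip: matrix_vector_mul_assoc)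
  moreover have "m *v opp_vec = opp_vec"
    using arg_cong[OF qf, of "\<lambda>x. p *v x"] p
    by (simp add: q_def m_def n_def a'e matrix_vector_simps exp_n_opp[OF v] flip: matrix_vector_mul_assoc)
  moreover have "m \<in> G_grp"
    unfolding m_def n_def a'_def using p v gg_exp[OF H_mat_gg, of "- ln c"] gg_exp[OF wedge_in_gg, of 1 base_vec v]
    by (auto intro!: G_grp_mult)
  ultimately have "m \<in> M_stab"
    by (simp add: M_stab_def)
  moreover have "m ** a ** mat_exp (wedge base_vec (- v)) = p ** n ** (a' ** a) ** mat_exp (wedge base_vec (- v))"
    by (simp add: m_def matrix_mul_assoc)
  then have "p = m ** a ** mat_exp (wedge base_vec (- v))"
    by (simp add: aa nn(1) flip: matrix_mul_assoc)
  ultimately show ?thesis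
    using nn(2) unfolding a_def by blast
qed

lemma parabolic_decompose:
  assumes p: "p \<in> G_grp" and c: "p *v base_vec = c *\<^sub>R base_vec" "c \<in> scalars s"
  shows "\<exists>m\<in>L_grp s. \<exists>\<eta>\<in>Np_grp. p = m ** mat_exp (ln \<bar>c\<bar> *\<^sub>R H_mat) ** \<eta>"
proof (cases "0 < c")
  case True
  then obtain m \<eta> where "m \<in> M_stab" "\<eta> \<in> Np_grp" "p = m ** mat_exp (ln \<bar>c\<bar> *\<^sub>R H_mat) ** \<eta>"
    using parabolic_decompose_pos[OF p c(1)] by auto
  moreover from this have "m \<in> L_grp s"
    by (auto simp: L_grp_iff M_stab_def scalars_pos intro!: bexI[of _ 1])
  ultimately show ?thesis by blast
next
  case False
  then have neg: "0 < - c" "s"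
    using c(2) scalars_nonzero[OF c(2)] by (auto simp: scalars_def split: if_splits)
  have "- p *v base_vec = (- c) *\<^sub>R base_vec"
    by (simp add: matrix_vector_simps c(1))
  then obtain m \<eta> where m: "m \<in> M_stab" "\<eta> \<in> Np_grp" "- p = m ** mat_exp (ln (- c) *\<^sub>R H_mat) ** \<eta>"
    using parabolic_decompose_pos[OF G_grp_minus[OF p] _ neg(1)] by auto
  have "p = - m ** mat_exp (ln \<bar>c\<bar> *\<^sub>R H_mat) ** \<eta>"
    using m(3) neg(1) by (simp add: matrix_mult_simps minus_equation_iff[of p] abs_of_neg)
  moreover have "- m \<in> L_grp s"
    using m(1) neg(2) by (auto simp: L_grp_iff M_stab_def G_grp_minus matrix_vector_simps scalars_def intro!: bexI[of _ "-1"])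
  ultimately show ?thesis using m(2) by blast
qed

lemma man_base:
  assumes "m \<in> L_grp s" "a = mat_exp (t *\<^sub>R H_mat)" "\<eta> \<in> Np_grp"
  obtains c where "c \<in> scalars s" "\<bar>c\<bar> = exp t" "m ** a ** \<eta> \<in> G_grp" "(m ** a ** \<eta>) *v base_vec = c *\<^sub>R base_vec"
proof -
  obtain \<sigma> where \<sigma>: "\<sigma> = 1 \<or> \<sigma> = -1" "\<sigma> \<in> scalars s" "m *v base_vec = \<sigma> *\<^sub>R base_vec"
    using assms(1) by (auto simp: L_grp_iff)
  have "m ** a ** \<eta> \<in> G_grp"
    using assms L_grp_G A_grp_G Np_grp_G unfolding A_grp_eq by blast
  moreover have "(m ** a ** \<eta>) *v base_vec = (\<sigma> * exp t) *\<^sub>R base_vec"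
    using assms(2,3) \<sigma>(3) by (auto simp: Np_grp_eq exp_n_base exp_H_base matrix_vector_simps simp flip: matrix_vector_mul_assoc)
  moreover have "\<sigma> * exp t \<in> scalars s"
    using scalars_mult[OF \<sigma>(2) scalars_pos[of "exp t"]] by simp
  ultimately show thesis
    using \<sigma>(1) by (intro that[of "\<sigma> * exp t"]) (auto simp: abs_mult)
qed

text \<open>Since the parabolic subgroup is the stabilizer of the line or ray of \<open>e\<close>, the values \<open>u g\<close> depend on
  \<open>g e\<close> only, homogeneously of degree \<open>l\<close>.\<close>

lemma Ind_iff:
  "u \<in> Ind (L_grp s) l \<longleftrightarrow> u \<in> C_inf G_grp \<and>
     (\<forall>g\<in>G_grp. \<forall>p\<in>G_grp. \<forall>c\<in>scalars s. p *v base_vec = c *\<^sub>R base_vec \<longrightarrow>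
        u (g ** p) = exp (l * of_real (ln \<bar>c\<bar>)) * u g)"
proof (intro iffI conjI ballI impI)
  assume u: "u \<in> Ind (L_grp s) l"
  then show "u \<in> C_inf G_grp" by (simp add: Ind_def)
  fix g p :: "'a mat_m" and c
  assume g: "g \<in> G_grp" and p: "p \<in> G_grp" "c \<in> scalars s" "p *v base_vec = c *\<^sub>R base_vec"
  obtain m \<eta> where m: "m \<in> L_grp s" "\<eta> \<in> Np_grp" "p = m ** mat_exp (ln \<bar>c\<bar> *\<^sub>R H_mat) ** \<eta>"
    using parabolic_decompose[OF p(1,3,2)] by blast
  have "u (g ** m ** mat_exp (ln \<bar>c\<bar> *\<^sub>R H_mat) ** \<eta>) = \<xi> l (mat_exp (ln \<bar>c\<bar> *\<^sub>R H_mat :: 'a mat_m)) * u g"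
    using u g m(1,2) by (auto simp: Ind_def A_grp_eq)
  then show "u (g ** p) = exp (l * of_real (ln \<bar>c\<bar>)) * u g"
    by (simp add: m(3) matrix_mul_assoc \<xi>_exp)
next
  assume u: "u \<in> C_inf G_grp \<and> (\<forall>g\<in>G_grp. \<forall>p\<in>G_grp. \<forall>c\<in>scalars s. p *v base_vec = c *\<^sub>R base_vec \<longrightarrow>
        u (g ** p) = exp (l * of_real (ln \<bar>c\<bar>)) * u g)"
  have "u (g ** m ** a ** \<eta>) = \<xi> l a * u g"
    if h: "g \<in> G_grp" "m \<in> L_grp s" "a \<in> A_grp" "\<eta> \<in> Np_grp" for g m a \<eta>
  proof -
    obtain t where t: "a = mat_exp (t *\<^sub>R H_mat)"
      using h(3) by (auto simp: A_grp_eq)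
    obtain c where c: "c \<in> scalars s" "\<bar>c\<bar> = exp t" "m ** a ** \<eta> \<in> G_grp" "(m ** a ** \<eta>) *v base_vec = c *\<^sub>R base_vec"
      using man_base[OF h(2) t h(4)] .
    have "u (g ** (m ** a ** \<eta>)) = exp (l * of_real (ln \<bar>c\<bar>)) * u g"
      using u h(1) c(1,3,4) by blast
    then show ?thesis
      by (simp add: c(2) t \<xi>_exp matrix_mul_assoc)
  qed
  then show "u \<in> Ind (L_grp s) l"
    using u by (simp add: Ind_def)
qed

section \<open>Left invariant differential operators\<close>

lemma C_inf_vanish: "u \<in> C_inf S \<Longrightarrow> x \<notin> S \<Longrightarrow> u x = 0"
  by (simp add: C_inf_def)

lemma C_inf_local:
  assumes "u \<in> C_inf S" "x \<in> S"
  obtains U v where "open U" "x \<in> U" "smooth_on U v" "\<And>y. y \<in> U \<Longrightarrow> y \<in> S \<Longrightarrow> v y = u y"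
  using assms unfolding C_inf_def by blast

lemma C_infI:
  assumes "\<And>x. x \<notin> S \<Longrightarrow> u x = 0"
    "\<And>x. x \<in> S \<Longrightarrow> \<exists>U v. open U \<and> x \<in> U \<and> smooth_on U v \<and> (\<forall>y\<in>U \<inter> S. v y = u y)"
  shows "u \<in> C_inf S"
  using assms unfolding C_inf_def by blast

lemma C_inf_local2:
  assumes "u \<in> C_inf S" "w \<in> C_inf S" "x \<in> S"
  obtains U v z where "open U" "x \<in> U" "smooth_on U v" "\<And>y. y \<in> U \<Longrightarrow> y \<in> S \<Longrightarrow> v y = u y"
    "smooth_on U z" "\<And>y. y \<in> U \<Longrightarrow> y \<in> S \<Longrightarrow> z y = w y"
proof -
  obtain U v where U: "open U" "x \<in> U" "smooth_on U v" "\<And>y. y \<in> U \<Longrightarrow> y \<in> S \<Longrightarrow> v y = u y"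
    using C_inf_local[OF assms(1,3)] by blast
  obtain V z where V: "open V" "x \<in> V" "smooth_on V z" "\<And>y. y \<in> V \<Longrightarrow> y \<in> S \<Longrightarrow> z y = w y"
    using C_inf_local[OF assms(2,3)] by blast
  show thesis
    by (rule that[of "U \<inter> V" v z]) (use U V in \<open>auto intro: smooth_on_subset\<close>)
qed

lemma C_inf_zero [simp, intro]: "(\<lambda>x. 0) \<in> C_inf S"
  by (rule C_infI) (auto intro!: exI[of _ UNIV])

lemma C_inf_add [intro]:
  assumes "u \<in> C_inf S" "w \<in> C_inf S"
  shows "(\<lambda>x. u x + w x) \<in> C_inf S"
proof (rule C_infI)
  fix x assume "x \<in> S"
  then obtain U v z where "open U" "x \<in> U" "smooth_on U v" "\<And>y. y \<in> U \<Longrightarrow> y \<in> S \<Longrightarrow> v y = u y"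
    "smooth_on U z" "\<And>y. y \<in> U \<Longrightarrow> y \<in> S \<Longrightarrow> z y = w y"
    using C_inf_local2[OF assms] by blast
  then show "\<exists>U v. open U \<and> x \<in> U \<and> smooth_on U v \<and> (\<forall>y\<in>U \<inter> S. v y = u y + w y)"
    by (intro exI[of _ U] exI[of _ "\<lambda>x. v x + z x"]) auto
qed (simp add: C_inf_vanish[OF assms(1)] C_inf_vanish[OF assms(2)])

lemma C_inf_cmult [intro]:
  assumes "u \<in> C_inf S"
  shows "(\<lambda>x. c * u x) \<in> C_inf S"
proof (rule C_infI)
  fix x assume "x \<in> S"
  then obtain U v where "open U" "x \<in> U" "smooth_on U v" "\<And>y. y \<in> U \<Longrightarrow> y \<in> S \<Longrightarrow> v y = u y"
    using C_inf_local[OF assms] by blast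
  then show "\<exists>U v. open U \<and> x \<in> U \<and> smooth_on U v \<and> (\<forall>y\<in>U \<inter> S. v y = c * u y)"
    by (intro exI[of _ U] exI[of _ "\<lambda>x. c * v x"]) auto
qed (simp add: C_inf_vanish[OF assms])

lemma C_inf_sum [intro]:
  "(\<And>i. i \<in> I \<Longrightarrow> u i \<in> C_inf S) \<Longrightarrow> (\<lambda>x. \<Sum>i\<in>I. u i x) \<in> C_inf S"
  by (induct I rule: infinite_finite_induct) auto

lemma C_inf_compose:
  fixes \<phi> :: "'b::real_normed_vector \<Rightarrow> 'c::euclidean_space"
  assumes u: "u \<in> C_inf S" and \<phi>: "smooth_on UNIV \<phi>" and S: "\<And>x. \<phi> x \<in> S \<longleftrightarrow> x \<in> T"
  shows "(\<lambda>x. u (\<phi> x)) \<in> C_inf T"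
proof (rule C_infI)
  fix x assume x: "x \<in> T"
  then obtain U v where U: "open U" "\<phi> x \<in> U" "smooth_on U v" "\<And>y. y \<in> U \<Longrightarrow> y \<in> S \<Longrightarrow> v y = u y"
    using C_inf_local[OF u] S by blast
  have "continuous_on UNIV \<phi>"
    using smooth_on_derivative[OF \<phi> open_UNIV] has_derivative_continuous continuous_at_imp_continuous_on
    by (metis UNIV_I)
  then have op: "open (\<phi> -` U)"
    using U(1) by (metis continuous_on_open_vimage open_UNIV inf_top_right)
  show "\<exists>U v. open U \<and> x \<in> U \<and> smooth_on U v \<and> (\<forall>y\<in>U \<inter> T. v y = u (\<phi> y))"
    using op U S smooth_on_compose[OF U(3,1) smooth_on_subset[OF \<phi>] op]
    by (intro exI[of _ "\<phi> -` U"] exI[of _ "\<lambda>y. v (\<phi> y)"]) auto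
next
  show "u (\<phi> x) = 0" if "x \<notin> T" for x
    using that S C_inf_vanish[OF u] by blast
qed

lemma smooth_on_matrix_mult:
  assumes "smooth_on U f" "smooth_on U g" "open U"
  shows "smooth_on U (\<lambda>x. f x ** g x :: real ^ 'n ^ 'm)"
  using smooth_on_bilinear[OF bounded_bilinear_matrix_mult assms] .

lemma smooth_on_ident: "smooth_on U (\<lambda>x. x)"
  using smooth_on_bounded_linear[OF bounded_linear_ident] .

lemma C_inf_left_translate:
  assumes "u \<in> C_inf G_grp" "g \<in> G_grp"
  shows "(\<lambda>x. u (g ** x)) \<in> C_inf G_grp"
proof (rule C_inf_compose[OF assms(1)])
  show "smooth_on UNIV (\<lambda>x. g ** x)"
    by (intro smooth_on_matrix_mult smooth_on_const smooth_on_ident open_UNIV)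
  show "g ** x \<in> G_grp \<longleftrightarrow> x \<in> G_grp" for x
    using assms(2) G_grp_mult[of "matrix_inv g" "g ** x"] by (auto simp: matrix_mul_assoc)
qed

lemma C_inf_right_translate:
  assumes "u \<in> C_inf G_grp" "g \<in> G_grp"
  shows "(\<lambda>x. u (x ** g)) \<in> C_inf G_grp"
proof (rule C_inf_compose[OF assms(1)])
  show "smooth_on UNIV (\<lambda>x. x ** g)"
    by (intro smooth_on_matrix_mult smooth_on_const smooth_on_ident open_UNIV)
  show "x ** g \<in> G_grp \<longleftrightarrow> x \<in> G_grp" for x
    using assms(2) G_grp_mult[of "x ** g" "matrix_inv g"] by (auto simp flip: matrix_mul_assoc)
qed

lemma G_grp_exp_iff:
  assumes "X \<in> \<gg>"
  shows "x ** mat_exp (t *\<^sub>R X) \<in> G_grp \<longleftrightarrow> x \<in> G_grp"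
proof
  assume "x ** mat_exp (t *\<^sub>R X) \<in> G_grp"
  then have "(x ** mat_exp (t *\<^sub>R X)) ** mat_exp (- (t *\<^sub>R X)) \<in> G_grp"
    using gg_exp[OF assms, of "- t"] by auto
  then show "x \<in> G_grp"
    by (simp add: mat_exp_inverse flip: matrix_mul_assoc)
qed (use gg_exp[OF assms] in auto)

lemma exp_curve_derivative:
  "((\<lambda>t. x ** mat_exp (t *\<^sub>R X)) has_vector_derivative x ** X) (at 0)"
  using bounded_linear.has_vector_derivative[OF
      bounded_bilinear.bounded_linear_right[OF bounded_bilinear_matrix_mult] mat_exp_has_vector_derivative, of x X 0]
  by simp

text \<open>On the group, \<open>R(X) u\<close> at \<open>x\<close> is the derivative of any local extension of \<open>u\<close> in the direction \<open>x X\<close>,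
  because the curve \<open>x exp(tX)\<close> stays in the group. Through this description the operators inherit
  linearity and smoothness from the ambient matrix space.\<close>

lemma R_mat_local:
  assumes X: "X \<in> \<gg>" and x: "x \<in> G_grp" and U: "open U" "x \<in> U"
    and v: "(v has_derivative v') (at x)" and eq: "\<And>y. y \<in> U \<Longrightarrow> y \<in> G_grp \<Longrightarrow> v y = u y"
  shows "((\<lambda>t. u (x ** mat_exp (t *\<^sub>R X))) has_vector_derivative v' (x ** X)) (at 0)"
    and "R_mat X u x = v' (x ** X)"
proof -
  have d: "((\<lambda>t. v (x ** mat_exp (t *\<^sub>R X))) has_vector_derivative v' (x ** X)) (at 0)"
  proof -
    have "((\<lambda>t. x ** mat_exp (t *\<^sub>R X)) has_derivative (\<lambda>r. r *\<^sub>R (x ** X))) (at 0)"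
      using exp_curve_derivative by (simp add: has_vector_derivative_def)
    from has_derivative_compose[OF this, of v v'] v
    show ?thesis
      using has_derivative_linear[OF v] by (simp add: has_vector_derivative_def linear_cmul)
  qed
  have "((\<lambda>t. x ** mat_exp (t *\<^sub>R X)) \<longlongrightarrow> x) (at 0)"
    using has_vector_derivative_continuous[OF exp_curve_derivative, of x X] by (simp add: continuous_at)
  then have ev: "eventually (\<lambda>t. x ** mat_exp (t *\<^sub>R X) \<in> U) (at 0)"
    using U by (simp add: topological_tendstoD)
  then have "eventually (\<lambda>t. v (x ** mat_exp (t *\<^sub>R X)) = u (x ** mat_exp (t *\<^sub>R X))) (at 0)"
    by eventually_elim (use eq x G_grp_exp_iff[OF X] in auto)
  moreover have "v x = u x" using eq U x by blast
  ultimately show "((\<lambda>t. u (x ** mat_exp (t *\<^sub>R X))) has_vector_derivative v' (x ** X)) (at 0)"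
    using has_derivative_transform_eventually[OF d[unfolded has_vector_derivative_def], of "\<lambda>t. u (x ** mat_exp (t *\<^sub>R X))"]
    by (simp add: has_vector_derivative_def)
  then show "R_mat X u x = v' (x ** X)"
    by (simp add: R_mat_def vector_derivative_at)
qed

lemma R_mat_outside:
  assumes "X \<in> \<gg>" "u \<in> C_inf G_grp" "x \<notin> G_grp"
  shows "R_mat X u x = 0"
proof -
  have "u (x ** mat_exp (t *\<^sub>R X)) = 0" for t
    using assms(1,3) by (intro C_inf_vanish[OF assms(2)]) (simp add: G_grp_exp_iff)
  then show ?thesis
    by (simp add: R_mat_def)
qed

lemma linear_matrix_expand:
  fixes A :: "real ^ 'n::finite ^ 'm::finite"
  assumes "linear L"
  shows "L A = (\<Sum>b\<in>Basis. (A \<bullet> b) *\<^sub>R L b)"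
proof -
  have "L A = L (\<Sum>b\<in>Basis. (A \<bullet> b) *\<^sub>R b)"
    by (simp add: euclidean_representation)
  then show ?thesis
    by (simp add: linear_sum[OF assms] linear_scale[OF assms])
qed

lemma R_mat_smooth_extension:
  fixes v :: "'a::finite mat_m \<Rightarrow> complex"
  assumes "smooth_on U v" "open U"
    "\<And>x. x \<in> U \<Longrightarrow> (v has_derivative v' x) (at x)" "\<And>z. smooth_on U (\<lambda>x. v' x z)"
  shows "smooth_on U (\<lambda>x. v' x (x ** X))"
proof (rule smooth_on_cong)
  show "smooth_on U (\<lambda>x. \<Sum>b\<in>Basis. ((x ** X) \<bullet> b) *\<^sub>R v' x b)"
    by (intro smooth_on_sum smooth_on_scaleR smooth_on_bounded_linear_comp[OF bounded_linear_inner_left]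
        smooth_on_matrix_mult smooth_on_ident smooth_on_const assms)
  show "(\<Sum>b\<in>Basis. ((x ** X) \<bullet> b) *\<^sub>R v' x b) = v' x (x ** X)" if "x \<in> U" for x
    using linear_matrix_expand[OF has_derivative_linear[OF assms(3)[OF that]]] by metis
qed

lemma R_mat_C_inf [intro, simp]:
  fixes u :: "'a::finite mat_m \<Rightarrow> complex"
  assumes "X \<in> \<gg>" "u \<in> C_inf G_grp"
  shows "R_mat X u \<in> C_inf G_grp"
proof (rule C_infI)
  fix x :: "'a mat_m" assume x: "x \<in> G_grp"
  obtain U v where U: "open U" "x \<in> U" "smooth_on U v" "\<And>y. y \<in> U \<Longrightarrow> y \<in> G_grp \<Longrightarrow> v y = u y"
    using C_inf_local[OF assms(2) x] by blast
  obtain v' where v': "\<And>x. x \<in> U \<Longrightarrow> (v has_derivative v' x) (at x)" "\<And>z. smooth_on U (\<lambda>x. v' x z)"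
    using smooth_on_derivative[OF U(3,1)] by blast
  have "v' y (y ** X) = R_mat X u y" if "y \<in> U" "y \<in> G_grp" for y
    using R_mat_local(2)[OF assms(1) that(2) U(1) that(1) v'(1)[OF that(1)], of u] U(4) by simp
  then show "\<exists>U v. open U \<and> x \<in> U \<and> smooth_on U v \<and> (\<forall>y\<in>U \<inter> G_grp. v y = R_mat X u y)"
    using U R_mat_smooth_extension[OF U(3,1) v']
    by (intro exI[of _ U] exI[of _ "\<lambda>x. v' x (x ** X)"]) auto
qed (use R_mat_outside assms in blast)

lemma R_mat_cong_local:
  fixes u :: "'a::finite mat_m \<Rightarrow> complex"
  assumes "X \<in> \<gg>" "u \<in> C_inf G_grp" "x \<in> G_grp"
  obtains U v v' where "open U" "x \<in> U" "smooth_on U v" "\<And>y. y \<in> U \<Longrightarrow> y \<in> G_grp \<Longrightarrow> v y = u y"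
    "\<And>x. x \<in> U \<Longrightarrow> (v has_derivative v' x) (at x)" "\<And>z. smooth_on U (\<lambda>x. v' x z)"
proof -
  obtain U v where U: "open U" "x \<in> U" "smooth_on U v" "\<And>y. y \<in> U \<Longrightarrow> y \<in> G_grp \<Longrightarrow> v y = u y"
    using C_inf_local[OF assms(2,3)] by blast
  obtain v' where "\<And>x. x \<in> U \<Longrightarrow> (v has_derivative v' x) (at x)" "\<And>z. smooth_on U (\<lambda>x. v' x z)"
    using smooth_on_derivative[OF U(3,1)] by blast
  with U that show thesis by blast
qed

lemma R_mat_has_vector_derivative:
  assumes "X \<in> \<gg>" "u \<in> C_inf G_grp" "x \<in> G_grp"
  shows "((\<lambda>t. u (x ** mat_exp (t *\<^sub>R X))) has_vector_derivative R_mat X u (x ** mat_exp (s *\<^sub>R X))) (at s)"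
proof -
  have x: "x ** mat_exp (s *\<^sub>R X) \<in> G_grp"
    using assms gg_exp by blast
  obtain U v v' where v: "open U" "x ** mat_exp (s *\<^sub>R X) \<in> U" "\<And>y. y \<in> U \<Longrightarrow> y \<in> G_grp \<Longrightarrow> v y = u y"
    "\<And>x. x \<in> U \<Longrightarrow> (v has_derivative v' x) (at x)"
    using R_mat_cong_local[OF assms(1,2) x] by metis
  from R_mat_local[OF assms(1) x v(1,2) v(4)[OF v(2)] v(3)]
  have "((\<lambda>t. u (x ** mat_exp (s *\<^sub>R X) ** mat_exp (t *\<^sub>R X))) has_vector_derivative R_mat X u (x ** mat_exp (s *\<^sub>R X))) (at 0)"
    by simp
  moreover have "x ** mat_exp (s *\<^sub>R X) ** mat_exp (t *\<^sub>R X) = x ** mat_exp ((s + t) *\<^sub>R X)" for t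
    by (simp add: mat_exp_add matrix_mul_assoc)
  ultimately have d: "((\<lambda>t. u (x ** mat_exp ((s + t) *\<^sub>R X))) has_vector_derivative R_mat X u (x ** mat_exp (s *\<^sub>R X))) (at 0)"
    by simp
  have "((\<lambda>r. r - s) has_vector_derivative 1) (at s)"
    by (auto intro!: derivative_eq_intros)
  from vector_diff_chain_at[OF this, of "\<lambda>t. u (x ** mat_exp ((s + t) *\<^sub>R X))"] d
  show ?thesis
    by (simp add: o_def)
qed

lemma R_mat_add:
  assumes "X \<in> \<gg>" "u \<in> C_inf G_grp" "w \<in> C_inf G_grp"
  shows "R_mat X (\<lambda>x. u x + w x) = (\<lambda>x. R_mat X u x + R_mat X w x)"
proof
  fix x
  show "R_mat X (\<lambda>x. u x + w x) x = R_mat X u x + R_mat X w x"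
  proof (cases "x \<in> G_grp")
    case True
    have "((\<lambda>t. u (x ** mat_exp (t *\<^sub>R X)) + w (x ** mat_exp (t *\<^sub>R X))) has_vector_derivative
        R_mat X u x + R_mat X w x) (at 0)"
      using R_mat_has_vector_derivative[OF assms(1,2) True, of 0] R_mat_has_vector_derivative[OF assms(1,3) True, of 0]
      by (intro has_vector_derivative_add) simp_all
    then show ?thesis
      unfolding R_mat_def[of X "\<lambda>x. u x + w x"] by (rule vector_derivative_at)
  next
    case False
    then show ?thesis using assms by (simp add: R_mat_outside C_inf_add)
  qed
qed

lemma R_mat_cmult:
  assumes "X \<in> \<gg>" "u \<in> C_inf G_grp"
  shows "R_mat X (\<lambda>x. c * u x) = (\<lambda>x. c * R_mat X u x)"
proof
  fix x
  show "R_mat X (\<lambda>x. c * u x) x = c * R_mat X u x"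
  proof (cases "x \<in> G_grp")
    case True
    have "((\<lambda>t. c * u (x ** mat_exp (t *\<^sub>R X))) has_vector_derivative c * R_mat X u x) (at 0)"
      using R_mat_has_vector_derivative[OF assms True, of 0]
      by (intro has_vector_derivative_mult_right) simp_all
    then show ?thesis
      unfolding R_mat_def[of X "\<lambda>x. c * u x"] by (rule vector_derivative_at)
  next
    case False
    then show ?thesis using assms by (simp add: R_mat_outside C_inf_cmult)
  qed
qed

lemma R_mat_zero: "R_mat X (\<lambda>x. 0) = (\<lambda>x. 0)"
  by (simp add: R_mat_def fun_eq_iff)

lemma R_mat_sum:
  assumes "X \<in> \<gg>" "\<And>i. i \<in> I \<Longrightarrow> u i \<in> C_inf G_grp"
  shows "R_mat X (\<lambda>x. \<Sum>i\<in>I. u i x) = (\<lambda>x. \<Sum>i\<in>I. R_mat X (u i) x)"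
  using assms(2)
  by (induct I rule: infinite_finite_induct) (simp_all add: R_mat_zero R_mat_add[OF assms(1)] C_inf_sum)

lemma R_mat_add_matrix:
  assumes "X \<in> \<gg>" "Y \<in> \<gg>" "u \<in> C_inf G_grp"
  shows "R_mat (X + Y) u x = R_mat X u x + R_mat Y u x"
proof (cases "x \<in> G_grp")
  case True
  obtain U v v' where v: "open U" "x \<in> U" "\<And>y. y \<in> U \<Longrightarrow> y \<in> G_grp \<Longrightarrow> v y = u y"
    "\<And>x. x \<in> U \<Longrightarrow> (v has_derivative v' x) (at x)"
    using R_mat_cong_local[OF assms(1,3) True] by metis
  have R: "R_mat Z u x = v' x (x ** Z)" if "Z \<in> \<gg>" for Z
    using R_mat_local(2)[OF that True v(1,2) v(4)[OF v(2)] v(3)] .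
  show ?thesis
    using has_derivative_linear[OF v(4)[OF v(2)]] assms
    by (simp add: R gg_add matrix_mult_simps linear_add)
qed (use assms in \<open>simp add: R_mat_outside gg_add\<close>)

lemma R_mat_scaleR_matrix:
  assumes "X \<in> \<gg>" "u \<in> C_inf G_grp"
  shows "R_mat (r *\<^sub>R X) u x = of_real r * R_mat X u x"
proof (cases "x \<in> G_grp")
  case True
  obtain U v v' where v: "open U" "x \<in> U" "\<And>y. y \<in> U \<Longrightarrow> y \<in> G_grp \<Longrightarrow> v y = u y"
    "\<And>x. x \<in> U \<Longrightarrow> (v has_derivative v' x) (at x)"
    using R_mat_cong_local[OF assms True] by metis
  have R: "R_mat Z u x = v' x (x ** Z)" if "Z \<in> \<gg>" for Z
    using R_mat_local(2)[OF that True v(1,2) v(4)[OF v(2)] v(3)] .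
  show ?thesis
    using has_derivative_linear[OF v(4)[OF v(2)]] assms
    unfolding R[OF gg_scaleR[OF assms(1)]] R[OF assms(1)]
    by (simp add: matrix_mult_simps linear_cmul) (simp add: scaleR_conv_of_real)
qed (use assms in \<open>simp add: R_mat_outside gg_scaleR\<close>)

text \<open>Differentiating \<open>Dv(x)(x Y)\<close> in the direction \<open>x X\<close> gives \<open>D\<^sup>2v(x)(x X, x Y) + Dv(x)(x X Y)\<close>. The first
  term is symmetric, so the commutator is the derivative in the direction \<open>x (X Y - Y X)\<close>.\<close>

lemma R_mat_bracket:
  assumes X: "X \<in> \<gg>" and Y: "Y \<in> \<gg>" and u: "u \<in> C_inf G_grp"
  shows "R_mat X (R_mat Y u) x = R_mat Y (R_mat X u) x + R_mat (X ** Y - Y ** X) u x"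
proof (cases "x \<in> G_grp")
  case True
  obtain U v where U: "open U" "x \<in> U" "smooth_on U v" "\<And>y. y \<in> U \<Longrightarrow> y \<in> G_grp \<Longrightarrow> v y = u y"
    using C_inf_local[OF u True] by blast
  obtain D where D: "\<And>x. x \<in> U \<Longrightarrow> D [] x = v x"
    "\<And>vs x. x \<in> U \<Longrightarrow> (D vs has_derivative (\<lambda>z. D (z # vs) x)) (at x)"
    using U(3) unfolding smooth_on_def by blast
  have R1: "R_mat Z u y = D [y ** Z] y" if "Z \<in> \<gg>" "y \<in> U" "y \<in> G_grp" for Z y
    using R_mat_local(2)[OF that(1,3) U(1) that(2) D(2)[OF that(2), of "[]"], of u] D(1) U(4) by simp
  have lin: "linear (\<lambda>z. D (z # vs) y)" if "y \<in> U" for vs y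
    using has_derivative_linear[OF D(2)[OF that]] .
  have R2: "R_mat Z (R_mat W u) x = D [x ** Z, x ** W] x + D [x ** Z ** W] x" if "Z \<in> \<gg>" "W \<in> \<gg>" for Z W
  proof -
    \<comment> \<open>The direction \<open>y W\<close> varies with the point; expanding it in a basis reduces the derivative to the product rule.\<close>
    define V where "V y = (\<Sum>b\<in>Basis. ((y ** W) \<bullet> b) *\<^sub>R D [b] y)" for y
    have V: "V y = D [y ** W] y" if "y \<in> U" for y
      unfolding V_def using linear_matrix_expand[OF lin[OF that, of "[]"]] by metis
    have lW: "bounded_linear (\<lambda>y. (y ** W) \<bullet> b)" for b :: "'a mat_m"
      by (rule bounded_linear_compose[OF bounded_linear_inner_left
           bounded_bilinear.bounded_linear_left[OF bounded_bilinear_matrix_mult]])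
    have "(V has_derivative (\<lambda>z. \<Sum>b\<in>Basis. ((x ** W) \<bullet> b) *\<^sub>R D [z, b] x + ((z ** W) \<bullet> b) *\<^sub>R D [b] x)) (at x)"
      unfolding V_def
      by (intro has_derivative_sum has_derivative_scaleR D(2) U(2) bounded_linear_imp_has_derivative lW)
    from R_mat_local(2)[OF that(1) True U(1,2) this, of "R_mat W u"]
    have "R_mat Z (R_mat W u) x = (\<Sum>b\<in>Basis. ((x ** W) \<bullet> b) *\<^sub>R D [x ** Z, b] x + ((x ** Z ** W) \<bullet> b) *\<^sub>R D [b] x)"
      using V R1[OF that(2)] by simp
    also have "\<dots> = (\<Sum>b\<in>Basis. ((x ** W) \<bullet> b) *\<^sub>R D [b, x ** Z] x) + (\<Sum>b\<in>Basis. ((x ** Z ** W) \<bullet> b) *\<^sub>R D [b] x)"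
      by (simp add: sum.distrib iterated_derivative_symmetric[OF U(1,2) D(2), of "x ** Z"])
    also have "\<dots> = D [x ** W, x ** Z] x + D [x ** Z ** W] x"
      using linear_matrix_expand[OF lin[OF U(2), of "[x ** Z]"], of "x ** W"]
        linear_matrix_expand[OF lin[OF U(2), of "[]"], of "x ** Z ** W"] by simp
    also have "D [x ** W, x ** Z] x = D [x ** Z, x ** W] x"
      by (rule iterated_derivative_symmetric[OF U(1,2) D(2)])
    finally show ?thesis .
  qed
  have "D [x ** X, x ** Y] x = D [x ** Y, x ** X] x"
    by (rule iterated_derivative_symmetric[OF U(1,2) D(2)])
  then show ?thesis
    using linear_diff[OF lin[OF U(2), of "[]"]]
    by (simp add: R2 X Y R1[OF gg_bracket[OF X Y] U(2) True] matrix_mult_simps matrix_mul_assoc)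
qed (use assms in \<open>simp add: R_mat_outside gg_bracket\<close>)

lemma R_mat_left_translate: "R_mat X (\<lambda>x. u (g ** x)) = (\<lambda>x. R_mat X u (g ** x))"
  by (simp add: R_mat_def fun_eq_iff matrix_mul_assoc)

text \<open>The form in which \<open>Ad\<close> enters: \<open>x exp(tY) p = x p exp(tX)\<close> if \<open>p X = Y p\<close>.\<close>

lemma R_mat_right_translate:
  assumes "p ** X = Y ** p"
  shows "R_mat Y (\<lambda>x. u (x ** p)) = (\<lambda>x. R_mat X u (x ** p))"
  using mat_exp_intertwine[OF assms] by (simp add: R_mat_def fun_eq_iff flip: matrix_mul_assoc)

lemma R_mat_mat_zero: "R_mat 0 u = (\<lambda>x. 0)"
  by (simp add: R_mat_def fun_eq_iff)

section \<open>The action of the enveloping algebra\<close>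

abbreviation FA :: "'a::finite coord free_alg set" where
  "FA \<equiv> carrier (free_algebra \<gg>)"

lemma FA_iff: "p \<in> FA \<longleftrightarrow> (\<forall>w\<in>Poly_Mapping.keys p. set (letters w) \<subseteq> \<gg>)"
  by (simp add: free_algebra_def)

lemma free_algebra_simps [simp]:
  "p \<otimes>\<^bsub>free_algebra \<hh>\<^esub> q = p * q" "p \<oplus>\<^bsub>free_algebra \<hh>\<^esub> q = p + q"
  "\<zero>\<^bsub>free_algebra \<hh>\<^esub> = 0" "\<one>\<^bsub>free_algebra \<hh>\<^esub> = 1"
  by (simp_all add: free_algebra_def)

lemma FA_add [intro]: "p \<in> FA \<Longrightarrow> q \<in> FA \<Longrightarrow> p + q \<in> FA"
  using ring.ring_simprules(1)[OF ring_free_algebra, of p \<gg> q] by simp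

lemma FA_mult [intro]: "p \<in> FA \<Longrightarrow> q \<in> FA \<Longrightarrow> p * q \<in> FA"
  using ring.ring_simprules(5)[OF ring_free_algebra, of p \<gg> q] by simp

lemma FA_zero [intro, simp]: "0 \<in> FA"
  by (simp add: FA_iff)

lemma FA_one [intro, simp]: "1 \<in> FA"
  by (simp add: FA_iff zero_fword_def)

lemma FA_uminus [intro]: "p \<in> FA \<Longrightarrow> - p \<in> FA"
  by (auto simp: FA_iff in_keys_iff)

lemma FA_diff [intro]: "p \<in> FA \<Longrightarrow> q \<in> FA \<Longrightarrow> p - q \<in> FA"
  using FA_add[OF _ FA_uminus, of p q] by simp

lemma FA_sum [intro]: "(\<And>i. i \<in> I \<Longrightarrow> p i \<in> FA) \<Longrightarrow> sum p I \<in> FA"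
  by (induct I rule: infinite_finite_induct) auto

lemma FA_power [intro]: "p \<in> FA \<Longrightarrow> p ^ k \<in> FA"
  by (induct k) auto

lemma FA_gen [intro, simp]: "X \<in> \<gg> \<Longrightarrow> gen X \<in> FA"
  by (auto simp: FA_iff gen_def)

lemma FA_scal [intro, simp]: "scal c \<in> FA"
  by (auto simp: FA_iff scal_def zero_fword_def)

abbreviation R_word :: "(real ^ 'n ^ 'n) list \<Rightarrow> (real ^ 'n ^ 'n \<Rightarrow> complex) \<Rightarrow> real ^ 'n ^ 'n \<Rightarrow> complex" where
  "R_word \<equiv> foldr R_mat"

lemma R_word_C_inf [intro]:
  "set Xs \<subseteq> \<gg> \<Longrightarrow> u \<in> C_inf G_grp \<Longrightarrow> R_word Xs u \<in> C_inf G_grp"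
  by (induct Xs) auto

lemma R_word_cmult:
  "set Xs \<subseteq> \<gg> \<Longrightarrow> u \<in> C_inf G_grp \<Longrightarrow> R_word Xs (\<lambda>x. c * u x) = (\<lambda>x. c * R_word Xs u x)"
  by (induct Xs) (auto simp: R_mat_cmult R_word_C_inf)

lemma R_word_sum:
  "set Xs \<subseteq> \<gg> \<Longrightarrow> (\<And>i. i \<in> I \<Longrightarrow> u i \<in> C_inf G_grp) \<Longrightarrow>
     R_word Xs (\<lambda>x. \<Sum>i\<in>I. u i x) = (\<lambda>x. \<Sum>i\<in>I. R_word Xs (u i) x)"
  by (induct Xs) (auto simp: R_mat_sum R_word_C_inf)

lemma R_free_superset:
  assumes "finite A" "Poly_Mapping.keys p \<subseteq> A"
  shows "R_free p u x = (\<Sum>w\<in>A. Poly_Mapping.lookup p w * R_word (letters w) u x)"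
  unfolding R_free_def using assms by (intro sum.mono_neutral_left) (auto simp: in_keys_iff)

lemma R_free_C_inf [intro, simp]:
  assumes "p \<in> FA" "u \<in> C_inf G_grp"
  shows "R_free p u \<in> C_inf G_grp"
proof -
  have "(\<lambda>x. \<Sum>w\<in>Poly_Mapping.keys p. Poly_Mapping.lookup p w * R_word (letters w) u x) \<in> C_inf G_grp"
    using assms by (intro C_inf_sum C_inf_cmult R_word_C_inf) (auto simp: FA_iff)
  then show ?thesis
    by (simp add: R_free_def[abs_def])
qed

lemma R_free_add: "R_free (p + q) u x = R_free p u x + R_free q u x"
proof -
  let ?A = "Poly_Mapping.keys p \<union> Poly_Mapping.keys q"
  have "R_free (p + q) u x = (\<Sum>w\<in>?A. Poly_Mapping.lookup (p + q) w * R_word (letters w) u x)"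
    using keys_add[of p q] by (intro R_free_superset) auto
  then show ?thesis
    by (simp add: lookup_add distrib_right sum.distrib R_free_superset[of ?A p] R_free_superset[of ?A q])
qed

lemma R_free_zero [simp]: "R_free 0 u x = 0"
  by (simp add: R_free_def)

lemma R_free_uminus: "R_free (- p) u x = - R_free p u x"
  using R_free_add[of p "- p" u x] by (simp add: eq_neg_iff_add_eq_0 add.commute)

lemma R_free_diff: "R_free (p - q) u x = R_free p u x - R_free q u x"
  using R_free_add[of p "- q" u x] by (simp add: R_free_uminus)

lemma R_free_sum: "R_free (sum p I) u x = (\<Sum>i\<in>I. R_free (p i) u x)"
  by (induct I rule: infinite_finite_induct) (simp_all add: R_free_add)

lemma R_free_single: "R_free (Poly_Mapping.single w c) u x = c * R_word (letters w) u x"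
  by (subst R_free_superset[of "{w}"]) auto

lemma R_free_gen [simp]: "R_free (gen X) u = R_mat X u"
  by (simp add: fun_eq_iff gen_def R_free_single)

lemma R_free_scal: "R_free (scal c) u = (\<lambda>x. c * u x)"
  by (simp add: fun_eq_iff scal_def R_free_single zero_fword_def)

lemma R_free_one [simp]: "R_free 1 u = u"
  using R_free_scal[of 1 u] by (simp add: scal_def)

lemma free_alg_expand:
  "p = (\<Sum>w\<in>Poly_Mapping.keys p. Poly_Mapping.single w (Poly_Mapping.lookup p w))"
proof (rule poly_mapping_eqI)
  fix w
  show "Poly_Mapping.lookup p w =
      Poly_Mapping.lookup (\<Sum>w\<in>Poly_Mapping.keys p. Poly_Mapping.single w (Poly_Mapping.lookup p w)) w"
    by (cases "w \<in> Poly_Mapping.keys p")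
      (auto simp: lookup_sum lookup_single when_def in_keys_iff)
qed

text \<open>For words this is the composition of iterated operators; the general case needs the linearity of
  these operators, which holds on smooth functions only.\<close>

lemma R_free_mult:
  assumes p: "p \<in> FA" and q: "q \<in> FA" and u: "u \<in> C_inf G_grp"
  shows "R_free (p * q) u = R_free p (R_free q u)"
proof
  fix x
  let ?P = "Poly_Mapping.keys p" and ?Q = "Poly_Mapping.keys q"
  let ?a = "Poly_Mapping.lookup p" and ?b = "Poly_Mapping.lookup q"
  have "p * q = (\<Sum>v\<in>?P. \<Sum>w\<in>?Q. Poly_Mapping.single (v + w) (?a v * ?b w))"
    by (subst free_alg_expand[of p], subst free_alg_expand[of q]) (simp add: sum_product mult_single)
  then have "R_free (p * q) u x = (\<Sum>v\<in>?P. \<Sum>w\<in>?Q. ?a v * ?b w * R_word (letters (v + w)) u x)"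
    by (simp add: R_free_sum R_free_single)
  also have "\<dots> = (\<Sum>v\<in>?P. ?a v * (\<Sum>w\<in>?Q. ?b w * R_word (letters v) (R_word (letters w) u) x))"
    by (simp add: plus_fword_def sum_distrib_left mult.assoc)
  also have "\<dots> = (\<Sum>v\<in>?P. ?a v * R_word (letters v) (R_free q u) x)"
  proof (intro sum.cong refl arg_cong[where f = "\<lambda>z. _ * z"])
    fix v assume v: "v \<in> ?P"
    have "R_word (letters v) (\<lambda>x. \<Sum>w\<in>?Q. ?b w * R_word (letters w) u x)
        = (\<lambda>x. \<Sum>w\<in>?Q. R_word (letters v) (\<lambda>x. ?b w * R_word (letters w) u x) x)"
      using p q u v by (intro R_word_sum C_inf_cmult R_word_C_inf) (auto simp: FA_iff)
    also have "\<dots> = (\<lambda>x. \<Sum>w\<in>?Q. ?b w * R_word (letters v) (R_word (letters w) u) x)"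
      using p q u v by (intro ext sum.cong refl) (auto simp: FA_iff R_word_cmult R_word_C_inf)
    finally show "(\<Sum>w\<in>?Q. ?b w * R_word (letters v) (R_word (letters w) u) x) = R_word (letters v) (R_free q u) x"
      by (simp add: R_free_def[abs_def])
  qed
  finally show "R_free (p * q) u x = R_free p (R_free q u) x"
    by (simp add: R_free_def)
qed

lemma R_free_cmult:
  assumes "p \<in> FA" "u \<in> C_inf G_grp"
  shows "R_free p (\<lambda>x. c * u x) = (\<lambda>x. c * R_free p u x)"
  using assms unfolding R_free_def
  by (intro ext) (auto simp: R_word_cmult FA_iff sum_distrib_left mult_ac intro!: sum.cong)

lemma R_word_add:
  "set Xs \<subseteq> \<gg> \<Longrightarrow> u \<in> C_inf G_grp \<Longrightarrow> v \<in> C_inf G_grp \<Longrightarrow>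
     R_word Xs (\<lambda>x. u x + v x) = (\<lambda>x. R_word Xs u x + R_word Xs v x)"
  by (induct Xs) (auto simp: R_mat_add R_word_C_inf)

lemma R_free_add_fun:
  assumes "p \<in> FA" "u \<in> C_inf G_grp" "v \<in> C_inf G_grp"
  shows "R_free p (\<lambda>x. u x + v x) = (\<lambda>x. R_free p u x + R_free p v x)"
  using assms unfolding R_free_def
  by (intro ext) (auto simp: R_word_add FA_iff distrib_left simp flip: sum.distrib intro!: sum.cong)

lemma R_free_left_translate: "R_free p (\<lambda>x. u (g ** x)) = (\<lambda>x. R_free p u (g ** x))"
proof -
  have "R_word Xs (\<lambda>x. u (g ** x)) = (\<lambda>x. R_word Xs u (g ** x))" for Xs
    by (induct Xs) (simp_all add: R_mat_left_translate)
  then show ?thesis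
    by (simp add: R_free_def fun_eq_iff)
qed

text \<open>An ideal that contains the defining relations of the enveloping algebra, so the action of a
  noncommutative polynomial depends on its class only (\<open>R_uea_class\<close>).\<close>

definition annihilator :: "'a::finite coord free_alg set" where
  "annihilator = {p \<in> FA. \<forall>u\<in>C_inf G_grp. R_free p u = (\<lambda>x. 0)}"

lemma annihilator_ideal: "ideal (annihilator :: 'a::finite coord free_alg set) (free_algebra \<gg>)"
  (is "ideal ?A ?R")
proof (rule idealI)
  interpret ring "free_algebra (\<gg> :: 'a mat_m set)"
    by (rule ring_free_algebra)
  show "subgroup ?A (add_monoid ?R)"
  proof (rule add.subgroupI)
    show "\<ominus>\<^bsub>?R\<^esub> p \<in> ?A" if p: "p \<in> ?A" for p
    proof -
      have "\<ominus>\<^bsub>?R\<^esub> p = - p"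
        using p by (intro minus_equality) (auto simp: annihilator_def)
      then show ?thesis
        using p by (auto simp: annihilator_def R_free_uminus fun_eq_iff)
    qed
    show "p \<oplus>\<^bsub>?R\<^esub> q \<in> ?A" if "p \<in> ?A" "q \<in> ?A" for p q
      using that by (auto simp: annihilator_def R_free_add fun_eq_iff)
    have "0 \<in> ?A"
      by (simp add: annihilator_def fun_eq_iff)
    then show "?A \<noteq> {}"
      by blast
  qed (auto simp: annihilator_def)
next
  fix a x assume ax: "a \<in> ?A" "x \<in> carrier ?R"
  have "R_free x (\<lambda>x. 0) = (\<lambda>x. 0)"
    using R_free_cmult[OF ax(2) C_inf_zero, of 0] by simp
  then show "x \<otimes>\<^bsub>?R\<^esub> a \<in> ?A" "a \<otimes>\<^bsub>?R\<^esub> x \<in> ?A"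
    using ax by (auto simp: annihilator_def R_free_mult)
qed (rule ring_free_algebra)

lemma uea_relations_FA: "uea_relations \<gg> \<subseteq> FA"
  unfolding uea_relations_def by auto

lemma uea_relations_annihilator: "uea_relations \<gg> \<subseteq> (annihilator :: 'a::finite coord free_alg set)"
proof
  fix p :: "'a coord free_alg" assume p: "p \<in> uea_relations \<gg>"
  have "R_free p u x = 0" if u: "u \<in> C_inf G_grp" for u x
    using p unfolding uea_relations_def
  proof (elim UnE CollectE exE conjE)
    fix X Y assume "p = gen (X + Y) - gen X - gen Y" "X \<in> \<gg>" "Y \<in> \<gg>"
    then show ?thesis using u by (simp add: R_free_diff R_mat_add_matrix)
  next
    fix r X assume "p = gen (r *\<^sub>R X) - scal (of_real r) * gen X" "X \<in> \<gg>"
    then show ?thesis using u by (simp add: R_free_diff R_mat_scaleR_matrix R_free_mult R_free_scal)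
  next
    fix X Y assume "p = gen X * gen Y - gen Y * gen X - gen (X ** Y - Y ** X)" "X \<in> \<gg>" "Y \<in> \<gg>"
    then show ?thesis using u R_mat_bracket[of X Y u x] by (simp add: R_free_diff R_free_mult)
  qed
  then show "p \<in> annihilator"
    using p uea_relations_FA by (auto simp: annihilator_def)
qed

lemma R_uea_class:
  fixes u :: "'a::finite mat_m \<Rightarrow> complex"
  assumes p: "p \<in> FA" and u: "u \<in> C_inf G_grp"
  shows "R_uea (uea_class \<gg> p) u = R_free p u"
proof -
  interpret ring "free_algebra (\<gg> :: 'a mat_m set)"
    by (rule ring_free_algebra)
  have id: "ideal (uea_ideal \<gg>) (free_algebra (\<gg> :: 'a mat_m set))"
    unfolding uea_ideal_def by (rule genideal_ideal[OF uea_relations_FA])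
  have ann: "uea_ideal \<gg> \<subseteq> (annihilator :: 'a coord free_alg set)"
    unfolding uea_ideal_def by (rule genideal_minimal[OF annihilator_ideal uea_relations_annihilator])
  have cl: "uea_class \<gg> p = (\<lambda>h. h + p) ` uea_ideal \<gg>"
    unfolding uea_class_def a_r_coset_def' free_algebra_simps by (rule UNION_singleton_eq_range)
  have eq: "R_free q u = R_free p u" if "q \<in> uea_class \<gg> p" for q
  proof -
    obtain h where h: "h \<in> uea_ideal \<gg>" "q = h + p"
      using \<open>q \<in> uea_class \<gg> p\<close> unfolding cl by blast
    then have "R_free h u = (\<lambda>x. 0)"
      using ann u by (auto simp: annihilator_def)
    then show ?thesis
      unfolding h(2) fun_eq_iff R_free_add by simp
  qed
  have "0 \<in> uea_ideal (\<gg> :: 'a mat_m set)"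
    using additive_subgroup.zero_closed[OF ideal.axioms(1)[OF id]] unfolding free_algebra_simps .
  then have "p \<in> uea_class \<gg> p"
    unfolding cl by (rule rev_image_eqI) (rule add_0[symmetric])
  then show ?thesis
    unfolding R_uea_def using eq by (intro the_equality) (blast, metis)
qed

section \<open>Commutation relations in the induced module\<close>

abbreviation y_op :: "'a::finite vec_m \<Rightarrow> ('a mat_m \<Rightarrow> complex) \<Rightarrow> 'a mat_m \<Rightarrow> complex" where
  "y_op v \<equiv> R_mat (wedge opp_vec v)"

abbreviation x_op :: "'a::finite vec_m \<Rightarrow> ('a mat_m \<Rightarrow> complex) \<Rightarrow> 'a mat_m \<Rightarrow> complex" where
  "x_op v \<equiv> R_mat (wedge base_vec v)"

abbreviation m_op :: "'a::finite vec_m \<Rightarrow> 'a vec_m \<Rightarrow> ('a mat_m \<Rightarrow> complex) \<Rightarrow> 'a mat_m \<Rightarrow> complex" where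
  "m_op v w \<equiv> R_mat (wedge v w)"

lemma y_op_commute:
  assumes "v \<in> mid_space" "w \<in> mid_space" "\<phi> \<in> C_inf G_grp"
  shows "y_op v (y_op w \<phi>) = y_op w (y_op v \<phi>)"
proof -
  have "wedge opp_vec v ** wedge opp_vec w - wedge opp_vec w ** wedge opp_vec v = 0"
    unfolding wedge_bracket[OF wedge_in_gg] using assms by (simp add: wedge_mult_vec wedge_simps)
  then show ?thesis
    using R_mat_bracket[OF wedge_in_gg wedge_in_gg assms(3), of opp_vec v opp_vec w]
    by (simp add: fun_eq_iff R_mat_mat_zero)
qed

lemma R_mat_scaleR': "X \<in> \<gg> \<Longrightarrow> u \<in> C_inf G_grp \<Longrightarrow> R_mat (r *\<^sub>R X) u = (\<lambda>x. of_real r * R_mat X u x)"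
  by (simp add: fun_eq_iff R_mat_scaleR_matrix)

lemma R_mat_uminus: "X \<in> \<gg> \<Longrightarrow> u \<in> C_inf G_grp \<Longrightarrow> R_mat (- X) u = (\<lambda>x. - R_mat X u x)"
  using R_mat_scaleR'[of X u "-1"] by simp

lemma H_y:
  assumes "v \<in> mid_space" "\<phi> \<in> C_inf G_grp"
  shows "R_mat H_mat (y_op v \<phi>) x = y_op v (R_mat H_mat \<phi>) x - y_op v \<phi> x"
proof -
  have "H_mat ** wedge opp_vec v - wedge opp_vec v ** H_mat = - wedge opp_vec v"
    unfolding wedge_bracket[OF H_mat_gg] using assms by (simp add: H_mat_mult wedge_simps)
  then show ?thesis
    using R_mat_bracket[OF H_mat_gg wedge_in_gg assms(2), of opp_vec v x] assms(2)
    by (simp add: R_mat_uminus)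
qed

lemma m_y:
  assumes "v \<in> mid_space" "w \<in> mid_space" "z \<in> mid_space" "\<phi> \<in> C_inf G_grp"
  shows "m_op v w (y_op z \<phi>) x = y_op z (m_op v w \<phi>) x
     + of_real (bform w z) * y_op v \<phi> x - of_real (bform v z) * y_op w \<phi> x"
proof -
  have "wedge v w ** wedge opp_vec z - wedge opp_vec z ** wedge v w
      = bform w z *\<^sub>R wedge opp_vec v + (- bform v z) *\<^sub>R wedge opp_vec w"
    unfolding wedge_bracket[OF wedge_in_gg] using assms by (simp add: wedge_mult_vec wedge_simps)
  then have "m_op v w (y_op z \<phi>) x = y_op z (m_op v w \<phi>) x
      + R_mat (bform w z *\<^sub>R wedge opp_vec v + (- bform v z) *\<^sub>R wedge opp_vec w) \<phi> x"
    using R_mat_bracket[OF wedge_in_gg wedge_in_gg assms(4), of v w opp_vec z x] by simp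
  also have "R_mat (bform w z *\<^sub>R wedge opp_vec v + (- bform v z) *\<^sub>R wedge opp_vec w) \<phi> x
      = of_real (bform w z) * y_op v \<phi> x - of_real (bform v z) * y_op w \<phi> x"
    using assms(4) by (subst R_mat_add_matrix) (auto simp: R_mat_scaleR_matrix simp del: scaleR_minus_left)
  finally show ?thesis by simp
qed

text \<open>From \<open>[e \<and> w, f \<and> v] = 2 (w \<and> v) + B(w,v) f \<and> e\<close> and \<open>f \<and> e = 2 H\<close>.\<close>

lemma x_y:
  assumes "w \<in> mid_space" "v \<in> mid_space" "\<phi> \<in> C_inf G_grp"
  shows "x_op w (y_op v \<phi>) x = y_op v (x_op w \<phi>) x
     + 2 * m_op w v \<phi> x + 2 * of_real (bform w v) * R_mat H_mat \<phi> x"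
proof -
  have "wedge base_vec w ** wedge opp_vec v - wedge opp_vec v ** wedge base_vec w
      = 2 *\<^sub>R wedge w v + bform w v *\<^sub>R wedge opp_vec base_vec"
    unfolding wedge_bracket[OF wedge_in_gg] using assms by (simp add: wedge_mult_vec wedge_simps)
  also have "wedge opp_vec base_vec = 2 *\<^sub>R H_mat"
    using wedge_commute[of opp_vec base_vec] by (simp add: H_mat_wedge)
  finally have "x_op w (y_op v \<phi>) x = y_op v (x_op w \<phi>) x + R_mat (2 *\<^sub>R wedge w v + (bform w v * 2) *\<^sub>R H_mat) \<phi> x"
    using R_mat_bracket[OF wedge_in_gg wedge_in_gg assms(3), of base_vec w opp_vec v x] by simp
  also have "R_mat (2 *\<^sub>R wedge w v + (bform w v * 2) *\<^sub>R H_mat) \<phi> x = 2 * m_op w v \<phi> x + 2 * of_real (bform w v) * R_mat H_mat \<phi> x"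
    using assms(3) by (subst R_mat_add_matrix) (auto simp: R_mat_scaleR_matrix)
  finally show ?thesis by simp
qed

subsection \<open>The subspace of codimension one\<close>

abbreviation last_vec :: "'a::finite option vec_m" where
  "last_vec \<equiv> axis (Space None) 1"

text \<open>The part of \<open>mid_space\<close> that comes from the smaller group; \<open>last_vec\<close> spans its complement.\<close>

definition low_space :: "'a::finite option vec_m set" where
  "low_space = {v \<in> mid_space. v $ Space None = 0}"

definition low_coords :: "'a::finite option coord set" where
  "low_coords = {Time2, Space1} \<union> range (\<lambda>j. Space (Some j))"

lemma low_space_mid: "v \<in> low_space \<Longrightarrow> v \<in> mid_space"
  by (simp add: low_space_def)

lemma low_axis: "c \<in> low_coords \<Longrightarrow> axis c 1 \<in> low_space"
  by (auto simp: low_coords_def low_space_def axis_at)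

lemma finite_low_coords [simp]: "finite low_coords"
  by (rule finite)

lemma card_low_coords: "card (low_coords :: 'a::finite option coord set) = CARD('a) + 2"
proof -
  have "card (range (\<lambda>j :: 'a. Space (Some j))) = CARD('a)"
    by (rule card_image) (auto simp: inj_on_def)
  then show ?thesis
    by (simp add: low_coords_def card_insert_if image_iff)
qed

lemma last_vec_mid [simp]: "last_vec \<in> mid_space"
  by (simp add: mid_space_def axis_at)

lemma low_space_outside:
  assumes "v \<in> low_space" "d \<notin> low_coords"
  shows "v $ d = 0"
proof (cases d)
  case (Space j)
  then show ?thesis
    using assms by (cases j) (auto simp: low_coords_def low_space_def)
qed (use assms in \<open>auto simp: low_coords_def low_space_def mid_space_def\<close>)

lemma low_expand:
  fixes v :: "'a::finite option vec_m"
  assumes "v \<in> low_space"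
  shows "v = (\<Sum>c\<in>low_coords. v $ c *\<^sub>R axis c 1)"
  unfolding vec_eq_iff
proof
  fix d :: "'a option coord"
  have "(\<Sum>c\<in>low_coords. v $ c * axis c 1 $ d) = v $ d"
  proof (cases "d \<in> low_coords")
    case True
    then show ?thesis
      by (subst sum.remove[of _ d]) (auto simp: axis_at intro!: sum.neutral split: if_splits)
  next
    case False
    then show ?thesis
      using low_space_outside[OF assms False] by (auto simp: axis_at intro!: sum.neutral split: if_splits)
  qed
  then show "v $ d = (\<Sum>c\<in>low_coords. v $ c *\<^sub>R axis c 1) $ d"
    by simp
qed

lemma bform_low:
  fixes v :: "'a::finite option vec_m"
  assumes "v \<in> low_space"
  shows "bform v w = (\<Sum>c\<in>low_coords. csign c * v $ c * w $ c)"
  unfolding bform_def using low_space_outside[OF assms]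
  by (intro sum.mono_neutral_right) auto

definition T_op :: "('a::finite option mat_m \<Rightarrow> complex) \<Rightarrow> 'a option mat_m \<Rightarrow> complex" where
  "T_op = y_op last_vec"

definition Delta_op :: "('a::finite option mat_m \<Rightarrow> complex) \<Rightarrow> 'a option mat_m \<Rightarrow> complex" where
  "Delta_op \<phi> x = (\<Sum>c\<in>low_coords. of_real (csign c) * y_op (axis c 1) (y_op (axis c 1) \<phi>) x)"

lemma T_op_C_inf [intro, simp]: "\<phi> \<in> C_inf G_grp \<Longrightarrow> T_op \<phi> \<in> C_inf G_grp"
  by (simp add: T_op_def)

lemma Delta_op_C_inf [intro, simp]: "\<phi> \<in> C_inf G_grp \<Longrightarrow> Delta_op \<phi> \<in> C_inf G_grp"
  unfolding Delta_op_def[abs_def] by (intro C_inf_sum C_inf_cmult) simp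

lemma y_op_sum:
  assumes "\<phi> \<in> C_inf G_grp"
  shows "y_op (\<Sum>c\<in>I. v c) \<phi> x = (\<Sum>c\<in>I. y_op (v c) \<phi> x)"
  by (induct I rule: infinite_finite_induct)
    (use assms in \<open>auto simp: wedge_simps R_mat_mat_zero R_mat_add_matrix\<close>)

lemma y_op_scaleR: "\<phi> \<in> C_inf G_grp \<Longrightarrow> y_op (r *\<^sub>R v) \<phi> x = of_real r * y_op v \<phi> x"
  by (simp add: wedge_simps R_mat_scaleR_matrix)

lemma y_op_low:
  assumes "w \<in> low_space" "\<phi> \<in> C_inf G_grp"
  shows "y_op w \<phi> x = (\<Sum>c\<in>low_coords. of_real (w $ c) * y_op (axis c 1) \<phi> x)"
  by (subst low_expand[OF assms(1)]) (simp add: y_op_sum[OF assms(2)] y_op_scaleR[OF assms(2)])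

lemma R_mat_Delta_expand:
  assumes "X \<in> \<gg>" "\<phi> \<in> C_inf G_grp"
  shows "R_mat X (Delta_op \<phi>) x = (\<Sum>c\<in>low_coords. of_real (csign c) * R_mat X (y_op (axis c 1) (y_op (axis c 1) \<phi>)) x)"
proof -
  have "R_mat X (Delta_op \<phi>) = (\<lambda>x. \<Sum>c\<in>low_coords. R_mat X (\<lambda>x. of_real (csign c) * y_op (axis c 1) (y_op (axis c 1) \<phi>) x) x)"
    unfolding Delta_op_def[abs_def] using assms by (intro R_mat_sum C_inf_cmult) auto
  then show ?thesis
    using assms by (simp add: R_mat_cmult)
qed

lemma Delta_op_cmult: "\<phi> \<in> C_inf G_grp \<Longrightarrow> Delta_op (\<lambda>x. c * \<phi> x) = (\<lambda>x. c * Delta_op \<phi> x)"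
  by (simp add: fun_eq_iff Delta_op_def R_mat_cmult sum_distrib_left mult_ac)

lemma Delta_op_add:
  "\<phi> \<in> C_inf G_grp \<Longrightarrow> \<psi> \<in> C_inf G_grp \<Longrightarrow> Delta_op (\<lambda>x. \<phi> x + \<psi> x) = (\<lambda>x. Delta_op \<phi> x + Delta_op \<psi> x)"
  by (simp add: fun_eq_iff Delta_op_def R_mat_add sum.distrib distrib_left)

lemma Delta_op_y_commute:
  assumes "w \<in> mid_space" "\<phi> \<in> C_inf G_grp"
  shows "Delta_op (y_op w \<phi>) = y_op w (Delta_op \<phi>)"
proof
  fix x
  have "y_op (axis c 1) (y_op (axis c 1) (y_op w \<phi>)) = y_op w (y_op (axis c 1) (y_op (axis c 1) \<phi>))"
    if "c \<in> low_coords" for c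
    using y_op_commute[OF low_space_mid[OF low_axis[OF that]] assms(1)] assms(2) by simp
  then show "Delta_op (y_op w \<phi>) x = y_op w (Delta_op \<phi>) x"
    using assms(2) by (simp add: R_mat_Delta_expand Delta_op_def)
qed

lemma H_Delta:
  assumes "\<phi> \<in> C_inf G_grp" "R_mat H_mat \<phi> = (\<lambda>x. \<mu> * \<phi> x)"
  shows "R_mat H_mat (Delta_op \<phi>) = (\<lambda>x. (\<mu> - 2) * Delta_op \<phi> x)"
proof
  fix x
  have "R_mat H_mat (y_op v (y_op v \<phi>)) x = (\<mu> - 2) * y_op v (y_op v \<phi>) x" if v: "v \<in> mid_space" for v
  proof -
    have 1: "R_mat H_mat (y_op v \<phi>) = (\<lambda>x. (\<mu> - 1) * y_op v \<phi> x)"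
      using H_y[OF v assms(1)] assms by (simp add: fun_eq_iff R_mat_cmult algebra_simps)
    have "R_mat H_mat (y_op v (y_op v \<phi>)) x = (\<mu> - 1) * y_op v (y_op v \<phi>) x - y_op v (y_op v \<phi>) x"
      unfolding H_y[OF v R_mat_C_inf[OF wedge_in_gg assms(1)]] 1 using assms(1) by (simp add: R_mat_cmult)
    then show ?thesis
      by (simp add: algebra_simps)
  qed
  then show "R_mat H_mat (Delta_op \<phi>) x = (\<mu> - 2) * Delta_op \<phi> x"
    using assms(1) by (simp add: R_mat_Delta_expand Delta_op_def low_space_mid low_axis sum_distrib_left mult_ac)
qed

lemma H_T:
  assumes "\<phi> \<in> C_inf G_grp" "R_mat H_mat \<phi> = (\<lambda>x. \<mu> * \<phi> x)"
  shows "R_mat H_mat (T_op \<phi>) = (\<lambda>x. (\<mu> - 1) * T_op \<phi> x)"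
  using H_y[OF last_vec_mid assms(1)] assms by (simp add: fun_eq_iff T_op_def R_mat_cmult algebra_simps)

lemma R_mat_lincomb2:
  assumes "X \<in> \<gg>" "\<phi> \<in> C_inf G_grp" "\<psi> \<in> C_inf G_grp"
  shows "R_mat X (\<lambda>x. a * \<phi> x + b * \<psi> x) x = a * R_mat X \<phi> x + b * R_mat X \<psi> x"
  using assms by (simp add: R_mat_add R_mat_cmult C_inf_cmult)

text \<open>The operator \<open>\<Delta>\<close> is the quadratic form of \<open>low_space\<close> evaluated on the \<open>y\<^sub>v\<close>, and \<open>v \<and> w\<close> is
  skew for this form.\<close>

lemma m_Delta:
  assumes v: "v \<in> low_space" and w: "w \<in> low_space" and \<phi>: "\<phi> \<in> C_inf G_grp" "m_op v w \<phi> = (\<lambda>x. 0)"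
  shows "m_op v w (Delta_op \<phi>) = (\<lambda>x. 0)"
proof
  fix x
  note vm = low_space_mid[OF v] low_space_mid[OF w]
  have "m_op v w (y_op (axis c 1) (y_op (axis c 1) \<phi>)) x
      = of_real (csign c) * (2 * (of_real (w $ c) * y_op v (y_op (axis c 1) \<phi>) x) - 2 * (of_real (v $ c) * y_op w (y_op (axis c 1) \<phi>) x))"
    if c: "c \<in> low_coords" for c
  proof -
    have z: "axis c 1 \<in> mid_space"
      using low_space_mid[OF low_axis[OF c]] .
    have 1: "m_op v w (y_op (axis c 1) \<phi>) = (\<lambda>x. of_real (csign c * w $ c) * y_op v \<phi> x + of_real (- csign c * v $ c) * y_op w \<phi> x)"
      using m_y[OF vm z \<phi>(1)] by (simp add: \<phi>(2) R_mat_zero fun_eq_iff)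
    have "m_op v w (y_op (axis c 1) (y_op (axis c 1) \<phi>)) x =
       (of_real (csign c * w $ c) * y_op (axis c 1) (y_op v \<phi>) x + of_real (- csign c * v $ c) * y_op (axis c 1) (y_op w \<phi>) x)
       + of_real (csign c * w $ c) * y_op v (y_op (axis c 1) \<phi>) x - of_real (csign c * v $ c) * y_op w (y_op (axis c 1) \<phi>) x"
      using m_y[OF vm z, of "y_op (axis c 1) \<phi>" x] \<phi>(1) unfolding 1
      by (simp add: R_mat_lincomb2 del: of_real_mult of_real_minus)
    then show ?thesis
      unfolding y_op_commute[OF z vm(1) \<phi>(1)] y_op_commute[OF z vm(2) \<phi>(1)] by (simp add: algebra_simps)
  qed
  then have "m_op v w (Delta_op \<phi>) x = (\<Sum>c\<in>low_coords. of_real (csign c) * (of_real (csign c) *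
      (2 * (of_real (w $ c) * y_op v (y_op (axis c 1) \<phi>) x) - 2 * (of_real (v $ c) * y_op w (y_op (axis c 1) \<phi>) x))))"
    using \<phi>(1) by (simp add: R_mat_Delta_expand)
  also have "\<dots> = 2 * (\<Sum>c\<in>low_coords. of_real (w $ c) * y_op (axis c 1) (y_op v \<phi>) x)
      - 2 * (\<Sum>c\<in>low_coords. of_real (v $ c) * y_op (axis c 1) (y_op w \<phi>) x)"
  proof -
    have e: "of_real (csign c) * (of_real (csign c) * z) = (z :: complex)" for c :: "'a option coord" and z
      by (simp add: csign_def)
    show ?thesis
      unfolding e sum_subtractf sum_distrib_left
      using y_op_commute[OF low_space_mid[OF low_axis] vm(1) \<phi>(1)] y_op_commute[OF low_space_mid[OF low_axis] vm(2) \<phi>(1)]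
      by (simp cong: sum.cong)
  qed
  also have "\<dots> = 2 * y_op w (y_op v \<phi>) x - 2 * y_op v (y_op w \<phi>) x"
    using y_op_low[OF w, of "y_op v \<phi>" x] y_op_low[OF v, of "y_op w \<phi>" x] \<phi>(1) by simp
  finally show "m_op v w (Delta_op \<phi>) x = 0"
    using y_op_commute[OF vm \<phi>(1)] by simp
qed

lemma bform_low_last:
  assumes "v \<in> low_space"
  shows "bform v last_vec = 0"
  using assms by (simp add: low_space_def)

lemma m_T:
  assumes v: "v \<in> low_space" and w: "w \<in> low_space" and \<phi>: "\<phi> \<in> C_inf G_grp" "m_op v w \<phi> = (\<lambda>x. 0)"
  shows "m_op v w (T_op \<phi>) = (\<lambda>x. 0)"
  using m_y[OF low_space_mid[OF v] low_space_mid[OF w] last_vec_mid \<phi>(1)]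
  by (simp add: fun_eq_iff T_op_def \<phi>(2) R_mat_zero bform_low_last[OF v] bform_low_last[OF w] del: bform_axis)

text \<open>Each summand \<open>y\<^sub>b y\<^sub>b\<close> of \<open>\<Delta>\<close> is passed with \<open>x_y\<close> twice. The terms with \<open>w \<and> b\<close> and with \<open>H\<close> are
  moved onto \<open>\<phi>\<close>, where they vanish or give the weight. Summed with signs over the \<open>CARD('a) + 2\<close> basis
  vectors \<open>b\<close>, the terms \<open>B(b,b) y\<^sub>w\<close> give \<open>CARD('a) + 2\<close> times \<open>y\<^sub>w\<close> and the terms \<open>B(w,b) y\<^sub>b\<close> give \<open>y\<^sub>w\<close>.\<close>

lemma x_Delta:
  fixes \<phi> :: "'a::finite option mat_m \<Rightarrow> complex"
  assumes w: "w \<in> low_space" and \<phi>: "\<phi> \<in> C_inf G_grp" "R_mat H_mat \<phi> = (\<lambda>x. \<mu> * \<phi> x)"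
    and m: "\<And>v. v \<in> low_space \<Longrightarrow> m_op w v \<phi> = (\<lambda>x. 0)"
  shows "x_op w (Delta_op \<phi>) x = Delta_op (x_op w \<phi>) x + (4 * \<mu> + 2 * of_nat (CARD('a)) ) * y_op w \<phi> x"
proof -
  note wm = low_space_mid[OF w]
  have "x_op w (y_op (axis c 1) (y_op (axis c 1) \<phi>)) x = y_op (axis c 1) (y_op (axis c 1) (x_op w \<phi>)) x
     + of_real (csign c) * (2 * y_op w \<phi> x + (4 * \<mu> - 4) * (of_real (w $ c) * y_op (axis c 1) \<phi> x))"
    if c: "c \<in> low_coords" for c
  proof -
    define b where "b = (axis c 1 :: 'a option vec_m)"
    have b: "b \<in> low_space" "b \<in> mid_space"
      using low_space_mid[OF low_axis[OF c]] low_axis[OF c] by (simp_all add: b_def)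
    have Bb: "bform b b = csign c" "bform w b = csign c * w $ c"
      by (simp_all add: b_def axis_at)
    have 1: "x_op w (y_op b \<phi>) = (\<lambda>x. 1 * y_op b (x_op w \<phi>) x + (2 * of_real (bform w b) * \<mu>) * \<phi> x)"
      using x_y[OF wm b(2) \<phi>(1)] by (simp add: fun_eq_iff m[OF b(1)] \<phi>(2))
    have 2: "m_op w b (y_op b \<phi>) x = of_real (bform b b) * y_op w \<phi> x - of_real (bform w b) * y_op b \<phi> x"
      using m_y[OF wm b(2) b(2) \<phi>(1)] by (simp add: m[OF b(1)] R_mat_zero)
    have 3: "R_mat H_mat (y_op b \<phi>) x = (\<mu> - 1) * y_op b \<phi> x"
      using H_y[OF b(2) \<phi>(1)] \<phi> by (simp add: R_mat_cmult algebra_simps)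
    have "x_op w (y_op b (y_op b \<phi>)) x = (1 * y_op b (y_op b (x_op w \<phi>)) x + (2 * of_real (bform w b) * \<mu>) * y_op b \<phi> x)
       + 2 * (of_real (bform b b) * y_op w \<phi> x - of_real (bform w b) * y_op b \<phi> x)
       + 2 * of_real (bform w b) * ((\<mu> - 1) * y_op b \<phi> x)"
      unfolding x_y[OF wm b(2) R_mat_C_inf[OF wedge_in_gg \<phi>(1)]] 2 3 unfolding 1
      using \<phi>(1) by (subst R_mat_lincomb2) simp_all
    then show ?thesis
      unfolding Bb b_def by (simp add: algebra_simps)
  qed
  then have "x_op w (Delta_op \<phi>) x = (\<Sum>c\<in>low_coords. of_real (csign c) * (y_op (axis c 1) (y_op (axis c 1) (x_op w \<phi>)) x
     + of_real (csign c) * (2 * y_op w \<phi> x + (4 * \<mu> - 4) * (of_real (w $ c) * y_op (axis c 1) \<phi> x))))"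
    using \<phi>(1) by (simp add: R_mat_Delta_expand)
  also have "\<dots> = Delta_op (x_op w \<phi>) x + (\<Sum>c\<in>(low_coords :: 'a option coord set). 2 * y_op w \<phi> x)
      + (4 * \<mu> - 4) * (\<Sum>c\<in>low_coords. of_real (w $ c) * y_op (axis c 1) \<phi> x)"
  proof -
    have e: "of_real (csign c) * (a + of_real (csign c) * z) = of_real (csign c) * a + (z :: complex)" for c :: "'a option coord" and a z
      by (simp add: csign_def)
    show ?thesis
      unfolding e by (simp add: sum.distrib sum_distrib_left Delta_op_def)
  qed
  also have "(\<Sum>c\<in>(low_coords :: 'a option coord set). 2 * y_op w \<phi> x) = (2 * of_nat (CARD('a)) + 4) * y_op w \<phi> x"
    by (simp add: card_low_coords algebra_simps)
  also have "(\<Sum>c\<in>low_coords. of_real (w $ c) * y_op (axis c 1) \<phi> x) = y_op w \<phi> x"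
    using y_op_low[OF w \<phi>(1)] by simp
  finally show ?thesis
    by (simp add: algebra_simps)
qed

text \<open>The infinitesimal form of induction, the only property of \<open>u\<close> that the following computations use:
  \<open>u\<close> behaves like the generator of a generalized Verma module.\<close>

definition lowest :: "complex \<Rightarrow> ('a::finite mat_m \<Rightarrow> complex) set" where
  "lowest l = {u \<in> C_inf G_grp. R_mat H_mat u = (\<lambda>x. l * u x) \<and>
     (\<forall>v\<in>mid_space. x_op v u = (\<lambda>x. 0)) \<and> (\<forall>v\<in>mid_space. \<forall>w\<in>mid_space. m_op v w u = (\<lambda>x. 0))}"

abbreviation Q_op :: "nat \<Rightarrow> nat \<Rightarrow> ('a::finite option mat_m \<Rightarrow> complex) \<Rightarrow> 'a option mat_m \<Rightarrow> complex" where
  "Q_op s k u \<equiv> (Delta_op ^^ s) ((T_op ^^ k) u)"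

lemma Q_op_C_inf [intro, simp]: "u \<in> C_inf G_grp \<Longrightarrow> Q_op s k u \<in> C_inf G_grp"
proof (induct s)
  case 0
  then show ?case by (induct k) auto
qed auto

lemma Q_op_H:
  assumes "u \<in> lowest l"
  shows "R_mat H_mat (Q_op s k u) = (\<lambda>x. (l - of_nat (2 * s + k)) * Q_op s k u x)"
proof (induct s)
  case 0
  have C: "(T_op ^^ k) u \<in> C_inf G_grp" for k
    using assms Q_op_C_inf[of u 0 k] by (simp add: lowest_def)
  have "R_mat H_mat ((T_op ^^ k) u) = (\<lambda>x. (l - of_nat k) * (T_op ^^ k) u x)"
  proof (induct k)
    case 0
    then show ?case using assms by (simp add: lowest_def)
  next
    case (Suc k)
    show ?case using H_T[OF C Suc] by (simp add: algebra_simps)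
  qed
  then show ?case by simp
next
  case (Suc s)
  show ?case
    using H_Delta[OF Q_op_C_inf Suc] assms by (simp add: lowest_def algebra_simps)
qed

lemma Q_op_m:
  assumes "u \<in> lowest l" "v \<in> low_space" "w \<in> low_space"
  shows "m_op v w (Q_op s k u) = (\<lambda>x. 0)"
proof (induct s)
  case 0
  have C: "(T_op ^^ k) u \<in> C_inf G_grp" for k
    using assms Q_op_C_inf[of u 0 k] by (simp add: lowest_def)
  have "m_op v w ((T_op ^^ k) u) = (\<lambda>x. 0)"
  proof (induct k)
    case 0
    then show ?case using assms by (simp add: lowest_def low_space_mid)
  next
    case (Suc k)
    show ?case using m_T[OF assms(2,3) C Suc] by simp
  qed
  then show ?case by simp
next
  case (Suc s)
  show ?case
    using m_Delta[OF assms(2,3) Q_op_C_inf Suc] assms by (simp add: lowest_def)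
qed

text \<open>The operator \<open>w \<and> last_vec\<close> turns one factor \<open>T\<close> after the other into \<open>y\<^sub>w\<close>.\<close>

lemma m_last_T_power:
  assumes u: "u \<in> lowest l" and w: "w \<in> low_space"
  shows "m_op w last_vec ((T_op ^^ k) u) = (\<lambda>x. of_nat k * y_op w ((T_op ^^ (k - 1)) u) x)"
proof (induct k)
  case 0
  then show ?case using assms by (simp add: lowest_def low_space_mid)
next
  case (Suc k)
  have C: "(T_op ^^ k) u \<in> C_inf G_grp" for k
    using assms Q_op_C_inf[of u 0 k] by (simp add: lowest_def)
  have B: "bform last_vec last_vec = 1" "bform w last_vec = 0"
    using bform_low_last[OF w] by (simp_all add: axis_at)
  have "m_op w last_vec (T_op ((T_op ^^ k) u)) x = T_op (m_op w last_vec ((T_op ^^ k) u)) x + y_op w ((T_op ^^ k) u) x" for x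
    using m_y[OF low_space_mid[OF w] last_vec_mid last_vec_mid C, of k x] unfolding B by (simp add: T_op_def)
  moreover have "T_op (m_op w last_vec ((T_op ^^ k) u)) x = of_nat k * y_op w ((T_op ^^ k) u) x" for x
  proof (cases k)
    case (Suc k')
    show ?thesis
      unfolding \<open>m_op w last_vec ((T_op ^^ k) u) = _\<close>
      using C y_op_commute[OF last_vec_mid low_space_mid[OF w] C, of k'] Suc
      by (simp add: T_op_def R_mat_cmult)
  next
    case 0
    show ?thesis
      unfolding \<open>m_op w last_vec ((T_op ^^ k) u) = _\<close> by (simp add: 0 T_op_def R_mat_zero)
  qed
  ultimately show ?case
    by (simp add: fun_eq_iff algebra_simps)
qed

lemma x_T_power:
  assumes u: "u \<in> lowest l" and w: "w \<in> low_space"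
  shows "x_op w ((T_op ^^ k) u) = (\<lambda>x. of_nat (k * (k - 1)) * y_op w ((T_op ^^ (k - 2)) u) x)"
proof (induct k)
  case 0
  then show ?case using assms by (simp add: lowest_def low_space_mid)
next
  case (Suc k)
  have C: "(T_op ^^ k) u \<in> C_inf G_grp" for k
    using assms Q_op_C_inf[of u 0 k] by (simp add: lowest_def)
  have "x_op w (T_op ((T_op ^^ k) u)) x = T_op (x_op w ((T_op ^^ k) u)) x + 2 * (of_nat k * y_op w ((T_op ^^ (k - 1)) u) x)" for x
    using x_y[OF low_space_mid[OF w] last_vec_mid C, of k x] bform_low_last[OF w] m_last_T_power[OF u w, of k]
    by (simp add: T_op_def del: bform_axis)
  moreover have "T_op (x_op w ((T_op ^^ k) u)) x = of_nat (k * (k - 1)) * y_op w ((T_op ^^ (k - 1)) u) x" for x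
  proof (cases "k < 2")
    case False
    then obtain k' where k: "k = Suc (Suc k')"
      by (metis One_nat_def Suc_1 less_Suc0 less_antisym not_less_eq old.nat.exhaust)
    show ?thesis
      unfolding \<open>x_op w ((T_op ^^ k) u) = _\<close>
      using C y_op_commute[OF last_vec_mid low_space_mid[OF w] C, of k'] k
      by (simp add: T_op_def R_mat_cmult del: of_nat_mult of_nat_Suc)
  next
    case True
    then have "k * (k - 1) = 0" by (cases k) auto
    then show ?thesis
      unfolding \<open>x_op w ((T_op ^^ k) u) = _\<close> by (simp only: of_nat_0 mult_zero_left T_op_def R_mat_zero)
  qed
  ultimately have "x_op w (T_op ((T_op ^^ k) u)) x = (of_nat (k * (k - 1)) + 2 * of_nat k) * y_op w ((T_op ^^ (k - 1)) u) x" for x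
    by (simp add: algebra_simps)
  moreover have "of_nat (k * (k - 1)) + 2 * of_nat k = (of_nat (Suc k * k) :: complex)"
    by (cases k) (simp_all add: algebra_simps)
  ultimately show ?case
    by (simp add: fun_eq_iff del: of_nat_mult)
qed

text \<open>Induction on \<open>s\<close> with \<open>x_Delta\<close>, whose coefficients sum to an arithmetic series, starting from
  \<open>x_T_power\<close>. The truncated subtractions are harmless: their terms have the factor \<open>s\<close> or \<open>k (k - 1)\<close>.\<close>

lemma x_Q:
  fixes u :: "'a::finite option mat_m \<Rightarrow> complex"
  assumes u: "u \<in> lowest l" and w: "w \<in> low_space"
  shows "x_op w (Q_op s k u) = (\<lambda>x.
     2 * of_nat s * (2 * l + of_nat (CARD('a)) + 2 - 2 * of_nat k - 2 * of_nat s) * y_op w (Q_op (s - 1) k u) x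
     + of_nat (k * (k - 1)) * y_op w (Q_op s (k - 2) u) x)"
proof (induct s)
  case 0
  then show ?case
    using x_T_power[OF u w, of k] by simp
next
  case (Suc s)
  have uC: "u \<in> C_inf G_grp"
    using u by (simp add: lowest_def)
  have C: "Q_op s k u \<in> C_inf G_grp" for s k
    using uC by simp
  let ?c = "\<lambda>s. 2 * of_nat s * (2 * l + of_nat (CARD('a)) + 2 - 2 * of_nat k - 2 * of_nat s) :: complex"
  have yC: "y_op w (Q_op s k u) \<in> C_inf G_grp" for s k
    using C by simp
  have D: "Delta_op (y_op w (Q_op s k u)) = y_op w (Q_op (Suc s) k u)" for s k
    using Delta_op_y_commute[OF low_space_mid[OF w] C] by simp
  have "Delta_op (x_op w (Q_op s k u)) x = ?c s * y_op w (Q_op s k u) x + of_nat (k * (k - 1)) * y_op w (Q_op (Suc s) (k - 2) u) x" for x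
  proof -
    have "Delta_op (x_op w (Q_op s k u)) x = ?c s * Delta_op (y_op w (Q_op (s - 1) k u)) x
       + of_nat (k * (k - 1)) * Delta_op (y_op w (Q_op s (k - 2) u)) x"
      unfolding Suc
      by (subst Delta_op_add) (use yC in \<open>auto simp: Delta_op_cmult simp del: of_nat_mult\<close>)
    also have "?c s * Delta_op (y_op w (Q_op (s - 1) k u)) x = ?c s * y_op w (Q_op s k u) x"
      unfolding D by (cases s) simp_all
    finally show ?thesis
      unfolding D .
  qed
  note D1 = this
  have D2: "x_op w (Delta_op (Q_op s k u)) x = Delta_op (x_op w (Q_op s k u)) x
      + (4 * (l - of_nat (2 * s + k)) + 2 * of_nat (CARD('a))) * y_op w (Q_op s k u) x" for x
    by (rule x_Delta[OF w C Q_op_H[OF u] Q_op_m[OF u w]])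
  show ?case
  proof
    fix x
    define Y where "Y = y_op w (Q_op s k u) x"
    define A where "A = of_nat (k * (k - 1)) * y_op w (Q_op (Suc s) (k - 2) u) x"
    have "x_op w (Q_op (Suc s) k u) x = ?c s * Y + A + (4 * (l - of_nat (2 * s + k)) + 2 * of_nat (CARD('a))) * Y"
      using D1[of x] D2[of x] by (simp only: funpow.simps o_apply Y_def A_def)
    also have "\<dots> = ?c (Suc s) * Y + A"
      by (simp add: algebra_simps)
    finally show "x_op w (Q_op (Suc s) k u) x = ?c (Suc s) * y_op w (Q_op (Suc s - 1) k u) x
        + of_nat (k * (k - 1)) * y_op w (Q_op (Suc s) (k - 2) u) x"
      unfolding Y_def A_def by simp
  qed
qed

text \<open>The second term that \<open>x_Q\<close> gives for \<open>j - 1\<close> and the first term for \<open>j\<close> are multiples of the same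
  function, since the exponent of \<open>T\<close> drops by 2 from \<open>j - 1\<close> to \<open>j\<close>; the hypothesis says that they cancel.
  The two unpaired terms at the ends of the sum vanish, one having the factor \<open>j = 0\<close> and the other
  the factor \<open>\<epsilon> (\<epsilon> - 1)\<close>.\<close>

lemma x_op_kills:
  fixes u :: "'a::finite option mat_m \<Rightarrow> complex" and a :: "nat \<Rightarrow> complex" and \<epsilon> k :: nat
  assumes u: "u \<in> lowest l" and w: "w \<in> low_space" and \<epsilon>: "\<epsilon> < 2"
    and rec: "\<And>j. 1 \<le> j \<Longrightarrow> j \<le> k \<Longrightarrow>
      of_nat ((2 * (k - j) + \<epsilon> + 2) * (2 * (k - j) + \<epsilon> + 1)) * a (j - 1)
      + 2 * of_nat j * (2 * l + of_nat (CARD('a)) + 2 - 2 * of_nat (2 * (k - j) + \<epsilon>) - 2 * of_nat j) * a j = 0"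
  shows "x_op w (\<lambda>x. \<Sum>j\<le>k. a j * Q_op j (2 * (k - j) + \<epsilon>) u x) = (\<lambda>x. 0)"
proof
  fix x
  have uC: "u \<in> C_inf G_grp"
    using u by (simp add: lowest_def)
  define L where "L j = 2 * (k - j) + \<epsilon>" for j
  define t where "t j = y_op w (Q_op (j - 1) (L j) u) x" for j
  define A where "A j = a j * (2 * of_nat j * (2 * l + of_nat (CARD('a)) + 2 - 2 * of_nat (L j) - 2 * of_nat j)) * t j" for j
  define B where "B j = a j * of_nat (L j * (L j - 1)) * y_op w (Q_op j (L j - 2) u) x" for j
  have "x_op w (\<lambda>x. \<Sum>j\<le>k. a j * Q_op j (2 * (k - j) + \<epsilon>) u x) x = (\<Sum>j\<le>k. a j * x_op w (Q_op j (L j) u) x)"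
    using uC by (simp add: R_mat_sum R_mat_cmult C_inf_cmult L_def)
  also have "\<dots> = (\<Sum>j\<le>k. A j) + (\<Sum>j\<le>k. B j)"
    unfolding x_Q[OF u w] A_def B_def t_def by (simp add: sum.distrib distrib_left mult.assoc del: of_nat_mult)
  also have "(\<Sum>j\<le>k. A j) = (\<Sum>j<k. A (Suc j))"
    by (simp only: lessThan_Suc_atMost[symmetric] sum.lessThan_Suc_shift) (simp add: A_def)
  also have "(\<Sum>j\<le>k. B j) = (\<Sum>j<k. B j)"
  proof -
    have "L k * (L k - 1) = 0"
      using \<epsilon> by (auto simp: L_def less_2_cases_iff)
    then show ?thesis
      by (simp only: lessThan_Suc_atMost[symmetric] sum.lessThan_Suc) (simp add: B_def del: of_nat_mult)
  qed
  also have "(\<Sum>j<k. A (Suc j)) + (\<Sum>j<k. B j) = (\<Sum>j<k. A (Suc j) + B j)"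
    by (simp add: sum.distrib)
  also have "\<dots> = 0"
  proof (rule sum.neutral, intro ballI)
    fix j assume "j \<in> {..<k}"
    then have j: "1 \<le> Suc j" "Suc j \<le> k" by auto
    have L: "L j = L (Suc j) + 2"
      using j by (simp add: L_def)
    define C :: complex where
      "C = 2 * of_nat (Suc j) * (2 * l + of_nat (CARD('a)) + 2 - 2 * of_nat (L (Suc j)) - 2 * of_nat (Suc j))"
    define n :: complex where "n = of_nat ((L (Suc j) + 2) * (L (Suc j) + 1))"
    have "B j = a j * n * t (Suc j)"
      unfolding n_def by (simp add: B_def t_def L del: of_nat_mult)
    moreover have "A (Suc j) = a (Suc j) * C * t (Suc j)"
      by (simp only: A_def C_def)
    ultimately have "A (Suc j) + B j = (n * a j + C * a (Suc j)) * t (Suc j)"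
      by (simp add: algebra_simps)
    moreover have "n * a j + C * a (Suc j) = 0"
      using rec[OF j] unfolding L_def n_def C_def by simp
    ultimately show "A (Suc j) + B j = 0" by simp
  qed
  finally show "x_op w (\<lambda>x. \<Sum>j\<le>k. a j * Q_op j (2 * (k - j) + \<epsilon>) u x) x = 0" .
qed

section \<open>The inclusion of the smaller group\<close>

text \<open>The inverse of \<open>lower\<close>; \<open>lift\<close> and \<open>drop_last\<close> are the corresponding maps of vectors, extension by
  zero and omission of the last coordinate.\<close>

fun up :: "'a coord \<Rightarrow> 'a option coord" where
  "up Time1 = Time1"
| "up Time2 = Time2"
| "up Space1 = Space1"
| "up Space2 = Space2"
| "up (Space j) = Space (Some j)"

lemma lower_up [simp]: "lower (up c) = Some c"
  by (cases c) auto

lemma coord_option_cases [case_names None up]: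
  obtains "c = Space None" | d where "c = up d"
proof (cases c)
  case (Space j)
  then show ?thesis using that by (cases j) (auto intro: that(2)[of "Space _"])
qed (auto intro: that(2)[of Time1] that(2)[of Time2] that(2)[of Space1] that(2)[of Space2])

lemma up_simps [simp]: "up c \<noteq> Space None" "Space None \<noteq> up c" "up c = up d \<longleftrightarrow> c = d" "csign (up c) = csign c"
proof -
  show "up c \<noteq> Space None" by (cases c) auto
  then show "Space None \<noteq> up c" by metis
  show "up c = up d \<longleftrightarrow> c = d" by (cases c; cases d) auto
  show "csign (up c) = csign c" by (cases c) auto
qed

lemma sum_option_coord:
  fixes h :: "'a::finite option coord \<Rightarrow> 'b::comm_monoid_add"
  shows "(\<Sum>c\<in>UNIV. h c) = h (Space None) + (\<Sum>d\<in>UNIV. h (up d))"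
proof -
  have U: "(UNIV :: 'a option coord set) = insert (Space None) (range up)"
    using coord_option_cases by blast
  have "sum h (range up) = (\<Sum>d\<in>UNIV. h (up d))"
    by (subst sum.reindex) (auto simp: inj_on_def)
  then show ?thesis
    unfolding U by (subst sum.insert) auto
qed

definition lift :: "'a::finite vec_m \<Rightarrow> 'a option vec_m" where
  "lift v = (\<chi> c. case lower c of Some d \<Rightarrow> v $ d | None \<Rightarrow> 0)"

definition drop_last :: "'a::finite option vec_m \<Rightarrow> 'a vec_m" where
  "drop_last x = (\<chi> c. x $ up c)"

lemma lift_nth [simp]: "lift v $ up d = v $ d" "lift v $ Space None = 0"
  by (simp_all add: lift_def)

lemma drop_last_nth [simp]: "drop_last x $ d = x $ up d"
  by (simp add: drop_last_def)

lemma vec_option_eqI: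
  assumes "drop_last x = drop_last y" "x $ Space None = y $ Space None"
  shows "x = y"
  unfolding vec_eq_iff
proof
  fix c show "x $ c = y $ c"
    using assms(2) arg_cong[OF assms(1), of "\<lambda>v. v $ d" for d]
    by (cases c rule: coord_option_cases) auto
qed

lemma drop_last_simps [simp]:
  "drop_last (lift v) = v" "drop_last (x + y) = drop_last x + drop_last y"
  "drop_last (x - y) = drop_last x - drop_last y"
  "drop_last (r *\<^sub>R x) = r *\<^sub>R drop_last x" "drop_last (axis (Space None) 1) = 0"
  "drop_last (axis (up c) 1) = axis c 1"
  by (simp_all add: vec_eq_iff axis_at)

lemma lift_eqI: "drop_last x = v \<Longrightarrow> x $ Space None = 0 \<Longrightarrow> lift v = x"
  by (rule vec_option_eqI) auto

lemma linear_lift: "linear lift"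
  by (auto simp: linear_iff intro!: vec_option_eqI)

lemma lift_base [simp]: "lift base_vec = base_vec" "lift opp_vec = opp_vec"
proof -
  have "drop_last base_vec = base_vec" "drop_last opp_vec = opp_vec"
    by (simp_all add: base_vec_def opp_vec_def drop_last_simps(6)[of Time1, simplified] drop_last_simps(6)[of Space2, simplified])
  then show "lift base_vec = base_vec" "lift opp_vec = opp_vec"
    by (auto intro!: lift_eqI simp: base_opp_defs axis_at)
qed

lemma lift_axis [simp]: "lift (axis c 1) = axis (up c) 1"
  by (intro lift_eqI) (auto simp: axis_at)

lemma bform_lift: "bform (lift v) x = bform v (drop_last x)"
  by (simp add: bform_def sum_option_coord)

lemma bform_option: "bform x y = bform (drop_last x) (drop_last y) + x $ Space None * y $ Space None"
  by (simp add: bform_def sum_option_coord)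

lemma lift_mid: "v \<in> mid_space \<Longrightarrow> lift v \<in> low_space"
  using lift_nth(1)[of v Time1] lift_nth(1)[of v Space2] by (simp add: low_space_def mid_space_def)

text \<open>A block matrix is determined by its action in the decomposition \<open>x = lift v + r last_vec\<close>. The
  embeddings of the group and of the Lie algebra are studied through this formula, not through entries.\<close>

lemma block_emb_mult_vec:
  "block_emb r g *v x = lift (g *v drop_last x) + (r * x $ Space None) *\<^sub>R axis (Space None) 1"
proof (rule vec_option_eqI)
  show "drop_last (block_emb r g *v x) = drop_last (lift (g *v drop_last x) + (r * x $ Space None) *\<^sub>R axis (Space None) 1)"
    by (simp add: vec_eq_iff matrix_vector_mult_def block_emb_def sum_option_coord)
  show "(block_emb r g *v x) $ Space None = (lift (g *v drop_last x) + (r * x $ Space None) *\<^sub>R axis (Space None) 1) $ Space None"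
    by (simp add: matrix_vector_mult_def block_emb_def sum_option_coord axis_at)
qed

lemma drop_block_emb [simp]:
  "drop_last (block_emb r g *v x) = g *v drop_last x" "(block_emb r g *v x) $ Space None = r * x $ Space None"
  by (simp_all add: block_emb_mult_vec axis_at)

lemma grp_emb_mult: "grp_emb (g ** h) = grp_emb g ** grp_emb h"
  unfolding matrix_eq by (auto simp flip: matrix_vector_mul_assoc intro!: vec_option_eqI)

lemma grp_emb_one [simp]: "grp_emb (mat 1) = mat 1"
  unfolding matrix_eq by (auto intro!: vec_option_eqI)

lemma grp_emb_lift: "grp_emb g *v lift v = lift (g *v v)"
  by (intro vec_option_eqI) auto

lemma grp_emb_last: "grp_emb g *v last_vec = last_vec"
  by (intro vec_option_eqI) (auto simp: axis_at)

lemma grp_emb_G_iff [simp]: "grp_emb g \<in> G_grp \<longleftrightarrow> g \<in> G_grp"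
proof
  assume "grp_emb g \<in> G_grp"
  then have "bform (grp_emb g *v lift x) (grp_emb g *v lift y) = bform (lift x) (lift y)" for x y
    by (rule G_grp_bform)
  then show "g \<in> G_grp"
    unfolding G_grp_iff grp_emb_lift by (simp add: bform_lift)
next
  assume "g \<in> G_grp"
  then show "grp_emb g \<in> G_grp"
    unfolding G_grp_iff[of "grp_emb g"] by (simp add: bform_option[of "_ *v _"] bform_option[of _ "_ :: 'a option vec_m"] G_grp_bform)
qed

lemma lie_emb_wedge: "lie_emb (wedge a b) = wedge (lift a) (lift b)"
  unfolding matrix_eq by (auto simp: wedge_mult_vec bform_lift intro!: vec_option_eqI)

lemma grp_emb_exp: "grp_emb (mat_exp (t *\<^sub>R X)) = mat_exp (t *\<^sub>R lie_emb X)"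
proof -
  have "mat_exp (t *\<^sub>R lie_emb X) *v z = grp_emb (mat_exp (t *\<^sub>R X)) *v z" for z
  proof -
    let ?\<phi> = "\<lambda>t. grp_emb (mat_exp (t *\<^sub>R X)) *v z"
    have "(?\<phi> has_vector_derivative lie_emb X *v ?\<phi> t) (at t)" for t
    proof -
      have "((\<lambda>t. lift (mat_exp (t *\<^sub>R X) *v drop_last z)) has_vector_derivative
          lift (X *v (mat_exp (t *\<^sub>R X) *v drop_last z))) (at t)"
        using bounded_linear.has_vector_derivative[OF linear_conv_bounded_linear[THEN iffD1, OF linear_lift] mat_exp_orbit] .
      then have "(?\<phi> has_vector_derivative lift (X *v (mat_exp (t *\<^sub>R X) *v drop_last z)) + 0) (at t)"
        unfolding block_emb_mult_vec by (intro has_vector_derivative_add has_vector_derivative_const)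
      moreover have "lie_emb X *v ?\<phi> t = lift (X *v (mat_exp (t *\<^sub>R X) *v drop_last z)) + 0"
        by (intro vec_option_eqI) simp_all
      ultimately show ?thesis by simp
    qed
    from mat_exp_flow[of ?\<phi>, OF this, of t]
    show ?thesis
      by simp
  qed
  then show ?thesis
    by (simp add: matrix_eq)
qed

lemma smooth_on_grp_emb: "smooth_on U (grp_emb :: 'a::finite mat_m \<Rightarrow> _)" if "open U"
proof -
  have "linear (lie_emb :: 'a mat_m \<Rightarrow> _)"
    unfolding linear_iff by (auto simp: matrix_eq matrix_vector_simps intro!: vec_option_eqI)
  then have "smooth_on U (\<lambda>g :: 'a mat_m. lie_emb g + grp_emb 0)"
    by (intro smooth_on_add smooth_on_const smooth_on_bounded_linear that)
      (simp add: linear_conv_bounded_linear)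
  moreover have "lie_emb g + grp_emb 0 = grp_emb g" for g :: "'a mat_m"
    unfolding matrix_eq by (auto simp: matrix_vector_simps intro!: vec_option_eqI)
  ultimately show ?thesis by simp
qed

lemma pullback_C_inf: "u \<in> C_inf G_grp \<Longrightarrow> pullback u \<in> C_inf G_grp"
  unfolding pullback_def[abs_def] by (rule C_inf_compose[OF _ smooth_on_grp_emb]) auto

section \<open>The operators on the induced modules\<close>

lemma Ind_lowest:
  fixes u :: "'a::finite mat_m \<Rightarrow> complex"
  assumes u: "u \<in> Ind (L_grp s) l"
  shows "u \<in> lowest l"
proof -
  have uC: "u \<in> C_inf G_grp" and
    inv: "\<And>g p c. g \<in> G_grp \<Longrightarrow> p \<in> G_grp \<Longrightarrow> c \<in> scalars s \<Longrightarrow> p *v base_vec = c *\<^sub>R base_vec \<Longrightarrow>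
       u (g ** p) = exp (l * of_real (ln \<bar>c\<bar>)) * u g"
    using u unfolding Ind_iff by blast+
  have kill: "R_mat X u = (\<lambda>x. 0)" if X: "X \<in> \<gg>" "X *v base_vec = 0" for X
  proof
    fix x
    show "R_mat X u x = 0"
    proof (cases "x \<in> G_grp")
      case True
      have "u (x ** mat_exp (t *\<^sub>R X)) = u x" for t
        using inv[OF True gg_exp[OF X(1)] scalars_pos[of 1 s]] mat_exp_fixes[OF X(2)] by simp
      then show ?thesis
        by (simp add: R_mat_def)
    qed (use R_mat_outside X uC in blast)
  qed
  have "R_mat H_mat u = (\<lambda>x. l * u x)"
  proof
    fix x
    show "R_mat H_mat u x = l * u x"
    proof (cases "x \<in> G_grp")
      case True
      have "u (x ** mat_exp (t *\<^sub>R H_mat)) = exp (l * of_real t) * u x" for t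
        using inv[OF True gg_exp[OF H_mat_gg] scalars_pos[of "exp t" s] exp_H_base[of t]] by simp
      moreover have "((\<lambda>t. exp (l * of_real t) * u x) has_vector_derivative l * u x) (at 0)"
      proof -
        have "((\<lambda>z. exp (l * z) * u x) has_field_derivative l * u x) (at (of_real 0))"
          by (auto intro!: derivative_eq_intros)
        then show ?thesis by (rule has_vector_derivative_real_field)
      qed
      ultimately show ?thesis
        by (simp add: R_mat_def vector_derivative_at)
    next
      case False
      then show ?thesis
        using R_mat_outside[OF H_mat_gg uC False] C_inf_vanish[OF uC False] by simp
    qed
  qed
  then show ?thesis
    unfolding lowest_def using uC kill by (auto simp: wedge_mult_vec)
qed

lemma Q_lie_emb:
  "lie_emb (Q1m :: 'a::finite mat_m) = wedge opp_vec (axis Time2 1)"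
  "lie_emb (Q2m :: 'a mat_m) = wedge opp_vec (axis Space1 1)"
  "lie_emb (Ym j) = wedge opp_vec (axis (Space (Some j)) 1)"
  by (simp_all add: Qm_wedge lie_emb_wedge)

lemma Delta_FA [intro, simp]: "Delta \<in> FA" and T_last_FA [intro, simp]: "T_last \<in> FA"
  unfolding Delta_def T_last_def unfolding Q_lie_emb unfolding Qm_wedge
  by (intro FA_add FA_uminus FA_power FA_sum FA_gen wedge_in_gg)+

lemma R_free_T_last: "R_free T_last u = T_op u"
  by (simp add: T_last_def T_op_def Qm_wedge)

lemma R_free_Delta:
  assumes "u \<in> C_inf G_grp"
  shows "R_free Delta u = Delta_op u"
proof
  fix x
  have sq: "R_free ((gen (wedge opp_vec v))\<^sup>2) u x = y_op v (y_op v u) x" for v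
    using assms by (simp add: power2_eq_square R_free_mult)
  have "(\<Sum>c\<in>low_coords. h c) = h Time2 + (h Space1 + (\<Sum>j\<in>UNIV. h (Space (Some j))))" for h :: "'a option coord \<Rightarrow> complex"
  proof -
    have "sum h (range (\<lambda>j :: 'a. Space (Some j))) = (\<Sum>j\<in>UNIV. h (Space (Some j)))"
      by (subst sum.reindex) (auto simp: inj_on_def)
    then show ?thesis
      by (simp add: low_coords_def image_iff)
  qed
  then show "R_free Delta u x = Delta_op u x"
    by (simp add: Delta_def Q_lie_emb R_free_add R_free_diff R_free_uminus R_free_sum sq Delta_op_def)
qed

lemma R_free_Delta_T:
  assumes "u \<in> C_inf G_grp"
  shows "R_free (Delta ^ s * T_last ^ k) u = Q_op s k u"
proof -
  have T: "R_free (T_last ^ k) u = (T_op ^^ k) u"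
    by (induct k) (use assms in \<open>simp_all add: R_free_mult FA_power R_free_T_last\<close>)
  have "R_free (Delta ^ s) \<phi> = (Delta_op ^^ s) \<phi>" if \<phi>: "\<phi> \<in> C_inf G_grp" for \<phi> :: "'a option mat_m \<Rightarrow> complex"
  proof (induct s)
    case (Suc s)
    have "R_free (Delta ^ s) \<phi> \<in> C_inf G_grp"
      by (intro R_free_C_inf FA_power Delta_FA \<phi>)
    then show ?case
      using \<phi> Suc by (simp add: R_free_mult FA_power R_free_Delta)
  qed simp
  then show ?thesis
    using assms Q_op_C_inf[OF assms, of 0 k] by (simp add: R_free_mult FA_power T)
qed

definition D_coeff :: "nat \<Rightarrow> nat \<Rightarrow> nat \<Rightarrow> complex \<Rightarrow> complex" where
  "D_coeff n N j l = (if even N then a_coeff n (N div 2) j l else b_coeff n (N div 2) j l)"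

definition D_term :: "nat \<Rightarrow> nat \<Rightarrow> 'a::finite option coord free_alg" where
  "D_term N j = Delta ^ j * T_last ^ (2 * (N div 2 - j) + N mod 2)"

lemma D_term_FA [intro, simp]: "D_term N j \<in> FA"
  unfolding D_term_def by (intro FA_mult FA_power Delta_FA T_last_FA)

lemma D0_eq: "D0 n N l = uea_class \<gg> (\<Sum>j\<le>N div 2. scal (D_coeff n N j l) * D_term N j)"
proof (cases "even N")
  case True
  then have "2 * (N div 2) - 2 * j = 2 * (N div 2 - j) + N mod 2" for j
    by presburger
  then show ?thesis
    by (simp only: D0_def Let_def D_coeff_def D_term_def if_P[OF True] mult.assoc)
next
  case False
  then have "2 * (N div 2) - 2 * j + 1 = 2 * (N div 2 - j) + N mod 2" for j
    by (simp only: diff_mult_distrib2[symmetric]) presburger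
  then show ?thesis
    by (simp only: D0_def Let_def D_coeff_def D_term_def if_not_P[OF False] mult.assoc)
qed

lemma R_uea_D0:
  assumes "u \<in> C_inf G_grp"
  shows "R_uea (D0 n N l) u = (\<lambda>x. \<Sum>j\<le>N div 2. D_coeff n N j l * Q_op j (2 * (N div 2 - j) + N mod 2) u x)"
    and "R_uea (D0 n N l) u \<in> C_inf G_grp"
proof -
  have P: "(\<Sum>j\<le>N div 2. scal (D_coeff n N j l) * D_term N j) \<in> FA"
    by (intro FA_sum FA_mult FA_scal D_term_FA)
  have R: "R_uea (D0 n N l) u = R_free (\<Sum>j\<le>N div 2. scal (D_coeff n N j l) * D_term N j) u"
    unfolding D0_eq using P assms by (rule R_uea_class)
  show "R_uea (D0 n N l) u \<in> C_inf G_grp"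
    unfolding R using P assms by (rule R_free_C_inf)
  show "R_uea (D0 n N l) u = (\<lambda>x. \<Sum>j\<le>N div 2. D_coeff n N j l * Q_op j (2 * (N div 2 - j) + N mod 2) u x)"
  proof -
    have "R_free (D_term N j) u = Q_op j (2 * (N div 2 - j) + N mod 2) u" for j
      unfolding D_term_def by (rule R_free_Delta_T[OF assms])
    then show ?thesis
      unfolding R using assms by (simp add: fun_eq_iff R_free_sum R_free_mult R_free_scal)
  qed
qed

text \<open>Both recursions, multiplied by 2, take this common form in terms of the exponent of \<open>T\<close>.\<close>

lemma D_coeff_rec:
  fixes l :: complex
  assumes n: "n = c + 3" and j: "1 \<le> j" "j \<le> N div 2"
  shows "of_nat ((2 * (N div 2 - j) + N mod 2 + 2) * (2 * (N div 2 - j) + N mod 2 + 1)) * D_coeff n N (j - 1) l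
      + 2 * of_nat j * (2 * l + of_nat c + 2 - 2 * of_nat (2 * (N div 2 - j) + N mod 2) - 2 * of_nat j) * D_coeff n N j l = 0"
proof -
  define i where "i = N div 2 - j"
  have i: "(of_nat (N div 2) :: complex) = of_nat j + of_nat i"
    using j(2) unfolding i_def by (metis le_add_diff_inverse of_nat_add)
  show ?thesis
  proof (cases "even N")
    case True
    then have "N mod 2 = 0" by auto
    with True show ?thesis
      using arg_cong[OF a_coeff_rec[OF j, of n l], of "\<lambda>z. 2 * z"]
      unfolding D_coeff_def i_def[symmetric] i n by (simp add: algebra_simps)
  next
    case False
    then have "N mod 2 = 1" by presburger
    with False show ?thesis
      using arg_cong[OF b_coeff_rec[OF j, of n l], of "\<lambda>z. 2 * z"]
      unfolding D_coeff_def i_def[symmetric] i n by (simp add: algebra_simps)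
  qed
qed

lemma D_killed_by_x:
  fixes u :: "'a::finite option mat_m \<Rightarrow> complex"
  assumes n: "n = CARD('a) + 3" and u: "u \<in> lowest l" and w: "w \<in> low_space"
  shows "x_op w (R_uea (D0 n N l) u) = (\<lambda>x. 0)"
proof -
  have "u \<in> C_inf G_grp"
    using u by (simp add: lowest_def)
  then show ?thesis
    unfolding R_uea_D0(1)[OF \<open>u \<in> C_inf G_grp\<close>]
    by (intro x_op_kills[OF u w _ D_coeff_rec[OF n]]) auto
qed

subsection \<open>Behaviour under the Levi subgroup\<close>

context
  fixes p :: "'a::finite option mat_m" and c :: real
  assumes p: "p \<in> G_grp" and c: "c \<noteq> 0"
    and pe: "p *v base_vec = c *\<^sub>R base_vec" and pf: "p *v opp_vec = (1/c) *\<^sub>R opp_vec"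
    and pl: "p *v last_vec = last_vec"
begin

lemma p_low:
  assumes v: "v \<in> low_space"
  shows "p *v v \<in> low_space"
proof -
  have "bform base_vec (p *v v) = 0" "bform opp_vec (p *v v) = 0"
    using G_grp_bform[OF p, of base_vec v] G_grp_bform[OF p, of opp_vec v] low_space_mid[OF v] c
    unfolding pe pf by (simp_all add: bform_simps)
  moreover have "bform last_vec (p *v v) = 0"
    using G_grp_bform[OF p, of last_vec v] v unfolding pl by (simp add: low_space_def)
  ultimately show ?thesis
    unfolding low_space_def mem_Collect_eq mid_space_iff by simp
qed

lemma pinv_low:
  assumes v: "v \<in> low_space"
  shows "matrix_inv p *v v \<in> low_space"
proof -
  have "bform base_vec (matrix_inv p *v v) = 0" "bform opp_vec (matrix_inv p *v v) = 0"
    using G_grp_bform[OF p, of base_vec "matrix_inv p *v v"] G_grp_bform[OF p, of opp_vec "matrix_inv p *v v"] low_space_mid[OF v] p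
    unfolding pe pf by (simp_all add: bform_simps)
  moreover have "bform last_vec (matrix_inv p *v v) = 0"
    using G_grp_bform[OF p, of last_vec "matrix_inv p *v v"] v p unfolding pl by (simp add: low_space_def)
  ultimately show ?thesis
    unfolding low_space_def mem_Collect_eq mid_space_iff by simp
qed

lemma translate_y:
  assumes \<phi>: "\<phi> \<in> C_inf G_grp"
  shows "y_op v \<phi> (x ** p) = of_real (1/c) * y_op (p *v v) (\<lambda>x. \<phi> (x ** p)) x"
proof -
  have "p ** wedge opp_vec v = ((1/c) *\<^sub>R wedge opp_vec (p *v v)) ** p"
    using wedge_conj[OF p, of opp_vec v] by (simp add: pf wedge_simps)
  from R_mat_right_translate[OF this, of \<phi>]
  show ?thesis
    using C_inf_right_translate[OF \<phi> p] by (simp add: R_mat_scaleR' fun_eq_iff)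
qed

lemma translate_T:
  assumes "\<phi> \<in> C_inf G_grp"
  shows "T_op \<phi> (x ** p) = of_real (1/c) * T_op (\<lambda>x. \<phi> (x ** p)) x"
  using translate_y[OF assms, of last_vec] by (simp add: T_op_def pl)

text \<open>The images of an orthogonal basis form an orthogonal basis of the same signs. What is needed here is
  the statement about rows of the matrix, so it is read off from \<open>p\<^sup>-\<^sup>1\<close>.\<close>

lemma p_frame:
  assumes d: "d \<in> low_coords" "d' \<in> low_coords"
  shows "(\<Sum>b\<in>low_coords. csign b * ((p *v axis b 1) $ d * (p *v axis b 1) $ d')) = (if d = d' then csign d else 0)"
proof -
  define q where "q = matrix_inv p"
  have pb: "(p *v axis b 1) $ d = csign d * (csign b * (q *v axis d 1) $ b)" for b d
  proof -
    have "csign d * (p *v axis b 1) $ d = bform (p *v axis b 1) (p *v (q *v axis d 1))"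
      using p by (simp add: q_def)
    also have "\<dots> = csign b * (q *v axis d 1) $ b"
      unfolding G_grp_bform[OF p] by simp
    finally show ?thesis
      by (metis csign_sq(2))
  qed
  have "(\<Sum>b\<in>low_coords. csign b * ((p *v axis b 1) $ d * (p *v axis b 1) $ d'))
     = (\<Sum>b\<in>low_coords. csign d * csign d' * (csign b * (q *v axis d 1) $ b * (q *v axis d' 1) $ b))"
  proof (intro sum.cong refl)
    fix b :: "'a option coord"
    have "csign b * csign b = 1" by simp
    then show "csign b * ((p *v axis b 1) $ d * (p *v axis b 1) $ d') =
        csign d * csign d' * (csign b * (q *v axis d 1) $ b * (q *v axis d' 1) $ b)"
      unfolding pb by (simp add: mult_ac)
  qed
  also have "\<dots> = csign d * csign d' * bform (q *v axis d 1) (q *v axis d' 1)"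
    using bform_low[OF pinv_low[OF low_axis[OF d(1)]], of "q *v axis d' 1"]
    by (simp add: q_def sum_distrib_left mult.assoc)
  also have "bform (q *v axis d 1) (q *v axis d' 1) = bform (axis d 1) (axis d' 1)"
    unfolding q_def by (rule G_grp_bform[OF G_grp_inv[OF p]])
  finally show ?thesis
    by (auto simp: axis_at)
qed

text \<open>The operator \<open>\<Delta>\<close> does not depend on the orthogonal basis in which it is written.\<close>

lemma Delta_op_frame:
  assumes \<psi>: "\<psi> \<in> C_inf G_grp"
  shows "(\<Sum>b\<in>low_coords. of_real (csign b) * y_op (p *v axis b 1) (y_op (p *v axis b 1) \<psi>) x) = Delta_op \<psi> x"
proof -
  let ?z = "\<lambda>d d'. y_op (axis d' 1) (y_op (axis d 1) \<psi>) x"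
  have 1: "y_op v (y_op v \<psi>) x = (\<Sum>d\<in>low_coords. \<Sum>d'\<in>low_coords. of_real (v $ d * v $ d') * ?z d d')"
    if v: "v \<in> low_space" for v
  proof -
    have "y_op v (y_op v \<psi>) x = (\<Sum>d\<in>low_coords. of_real (v $ d) * y_op (axis d 1) (y_op v \<psi>) x)"
      using v \<psi> by (intro y_op_low) auto
    also have "\<dots> = (\<Sum>d\<in>low_coords. of_real (v $ d) * y_op v (y_op (axis d 1) \<psi>) x)"
      using y_op_commute[OF low_space_mid[OF low_axis] low_space_mid[OF v] \<psi>] by (intro sum.cong refl) simp
    also have "\<dots> = (\<Sum>d\<in>low_coords. of_real (v $ d) * (\<Sum>d'\<in>low_coords. of_real (v $ d') * ?z d d'))"
      using v \<psi> by (intro sum.cong refl arg_cong[where f = "\<lambda>z. _ * z"] y_op_low) auto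
    finally show ?thesis
      by (simp add: sum_distrib_left mult.assoc)
  qed
  have "(\<Sum>b\<in>low_coords. of_real (csign b) * y_op (p *v axis b 1) (y_op (p *v axis b 1) \<psi>) x)
     = (\<Sum>b\<in>low_coords. \<Sum>d\<in>low_coords. \<Sum>d'\<in>low_coords.
         of_real (csign b * ((p *v axis b 1) $ d * (p *v axis b 1) $ d')) * ?z d d')"
    by (intro sum.cong refl) (simp add: 1[OF p_low[OF low_axis]] sum_distrib_left mult.assoc)
  also have "\<dots> = (\<Sum>d\<in>low_coords. \<Sum>d'\<in>low_coords. \<Sum>b\<in>low_coords.
         of_real (csign b * ((p *v axis b 1) $ d * (p *v axis b 1) $ d')) * ?z d d')"
    by (subst sum.swap) (intro sum.cong refl sum.swap)
  also have "\<dots> = (\<Sum>d\<in>low_coords. \<Sum>d'\<in>low_coords. of_real (if d = d' then csign d else 0) * ?z d d')"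
    by (intro sum.cong refl) (simp add: p_frame[symmetric] sum_distrib_right)
  also have "\<dots> = (\<Sum>d\<in>low_coords. of_real (csign d) * ?z d d)"
  proof (intro sum.cong refl)
    fix d :: "'a option coord" assume d: "d \<in> low_coords"
    show "(\<Sum>d'\<in>low_coords. of_real (if d = d' then csign d else 0) * ?z d d') = of_real (csign d) * ?z d d"
      by (subst sum.remove[OF finite_low_coords d]) (auto intro!: sum.neutral split: if_splits)
  qed
  finally show ?thesis
    by (simp add: Delta_op_def)
qed

lemma translate_Delta:
  assumes \<phi>: "\<phi> \<in> C_inf G_grp"
  shows "Delta_op \<phi> (x ** p) = of_real (1/c) ^ 2 * Delta_op (\<lambda>x. \<phi> (x ** p)) x"
proof -
  note tr = C_inf_right_translate[OF \<phi> p]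
  define r where "r = complex_of_real (1/c)"
  note ty = translate_y[folded r_def]
  have "y_op v (y_op v \<phi>) (x ** p) = r\<^sup>2 * y_op (p *v v) (y_op (p *v v) (\<lambda>x. \<phi> (x ** p))) x" for v
  proof -
    have "(\<lambda>x. y_op v \<phi> (x ** p)) = (\<lambda>x. r * y_op (p *v v) (\<lambda>x. \<phi> (x ** p)) x)"
      using ty[OF \<phi>] by (simp add: fun_eq_iff)
    then show ?thesis
      using ty[of "y_op v \<phi>" v x] \<phi> tr by (simp add: R_mat_cmult power2_eq_square mult.assoc)
  qed
  then have "Delta_op \<phi> (x ** p) = r\<^sup>2 *
      (\<Sum>b\<in>low_coords. of_real (csign b) * y_op (p *v axis b 1) (y_op (p *v axis b 1) (\<lambda>x. \<phi> (x ** p))) x)"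
    unfolding Delta_op_def by (simp add: sum_distrib_left mult_ac)
  then show ?thesis
    unfolding Delta_op_frame[OF tr] r_def .
qed

lemma translate_Q:
  assumes u: "u \<in> C_inf G_grp"
  shows "Q_op s k u (x ** p) = of_real (1/c) ^ (2 * s + k) * Q_op s k (\<lambda>x. u (x ** p)) x"
proof (induct s arbitrary: x)
  case 0
  note tr = C_inf_right_translate[OF u p]
  have "(T_op ^^ k) u (x ** p) = of_real (1/c) ^ k * (T_op ^^ k) (\<lambda>x. u (x ** p)) x" for x
  proof (induct k arbitrary: x)
    case (Suc k)
    have C: "(T_op ^^ k) u \<in> C_inf G_grp" "(T_op ^^ k) (\<lambda>x. u (x ** p)) \<in> C_inf G_grp"
      using Q_op_C_inf[OF u, of 0 k] Q_op_C_inf[OF tr, of 0 k] by simp_all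
    have "(\<lambda>x. (T_op ^^ k) u (x ** p)) = (\<lambda>x. of_real (1/c) ^ k * (T_op ^^ k) (\<lambda>x. u (x ** p)) x)"
      using Suc by (simp add: fun_eq_iff)
    then show ?case
      using translate_T[OF C(1), of x] C(2) by (simp add: T_op_def R_mat_cmult)
  qed simp
  then show ?case by simp
next
  case (Suc s)
  note tr = C_inf_right_translate[OF u p]
  have "(\<lambda>x. Q_op s k u (x ** p)) = (\<lambda>x. of_real (1/c) ^ (2 * s + k) * Q_op s k (\<lambda>x. u (x ** p)) x)"
    using Suc by (simp add: fun_eq_iff)
  then show ?case
    using translate_Delta[OF Q_op_C_inf[OF u], of s k x] Delta_op_cmult[OF Q_op_C_inf[OF tr]]
    by (simp add: power2_eq_square)
qed

end

lemma Q_op_cmult: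
  assumes u: "u \<in> C_inf G_grp"
  shows "Q_op s k (\<lambda>x. c * u x) = (\<lambda>x. c * Q_op s k u x)"
proof (induct s)
  case 0
  have "(T_op ^^ k) (\<lambda>x. c * u x) = (\<lambda>x. c * (T_op ^^ k) u x)"
  proof (induct k)
    case (Suc k)
    then show ?case
      using Q_op_C_inf[OF u, of 0 k] by (simp add: T_op_def R_mat_cmult)
  qed simp
  then show ?case by simp
next
  case (Suc s)
  then show ?case
    using Delta_op_cmult[OF Q_op_C_inf[OF u]] by simp
qed

text \<open>The degree \<open>2 j + k\<close> equals \<open>N\<close> in every term, so the whole sum is multiplied by \<open>c\<close> to the power \<open>-N\<close>.
  For a negative \<open>c\<close>, which occurs for lines, this agrees with a power of \<open>\<bar>c\<bar>\<close> since \<open>N\<close> is even.\<close>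

lemma D_levi:
  fixes u :: "'a::finite option mat_m \<Rightarrow> complex"
  assumes u: "u \<in> Ind (L_grp s) l" and N: "even N \<or> \<not> s"
    and p: "p \<in> G_grp" "c \<in> scalars s" "p *v base_vec = c *\<^sub>R base_vec"
      "p *v opp_vec = (1/c) *\<^sub>R opp_vec" "p *v last_vec = last_vec"
    and x: "x \<in> G_grp"
  shows "R_uea (D0 n N l) u (x ** p) = exp ((l - of_nat N) * of_real (ln \<bar>c\<bar>)) * R_uea (D0 n N l) u x"
proof -
  have c: "c \<noteq> 0"
    using p(2) by (rule scalars_nonzero)
  have uC: "u \<in> C_inf G_grp"
    using u by (simp add: Ind_iff)
  have "(\<lambda>x. u (x ** p)) = (\<lambda>x. exp (l * of_real (ln \<bar>c\<bar>)) * u x)"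
  proof
    fix x
    show "u (x ** p) = exp (l * of_real (ln \<bar>c\<bar>)) * u x"
    proof (cases "x \<in> G_grp")
      case True
      then show ?thesis
        using u p unfolding Ind_iff by blast
    next
      case False
      then show ?thesis
        using C_inf_vanish[OF uC False] C_inf_vanish[OF C_inf_right_translate[OF uC p(1)] False] by simp
    qed
  qed
  then have Q: "Q_op j k u (x ** p) = of_real (1/c) ^ (2 * j + k) * (exp (l * of_real (ln \<bar>c\<bar>)) * Q_op j k u x)" for j k
    unfolding translate_Q[OF p(1) c p(3-5) uC] by (simp add: Q_op_cmult[OF uC])
  have NN: "2 * j + (2 * (N div 2 - j) + N mod 2) = N" if "j \<le> N div 2" for j
    using that by presburger
  have "of_real (1/c) ^ N = (of_real (1/\<bar>c\<bar>) :: complex) ^ N"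
  proof (cases "c > 0")
    case False
    then have "even N"
      using N p(2) by (auto simp: scalars_def)
    then have "(1/c) ^ N = (1/\<bar>c\<bar>) ^ N"
      by (simp add: power_divide power_even_abs)
    then show ?thesis
      by (metis of_real_power)
  qed simp
  also have "1/\<bar>c\<bar> = exp (- ln \<bar>c\<bar>)"
    using c by (simp add: exp_minus inverse_eq_divide)
  also have "(of_real (exp (- ln \<bar>c\<bar>)) :: complex) ^ N = exp (of_nat N * of_real (- ln \<bar>c\<bar>))"
    by (simp only: exp_of_real[symmetric] exp_of_nat_mult[symmetric])
  finally have "of_real (1/c) ^ N * exp (l * of_real (ln \<bar>c\<bar>)) = exp ((l - of_nat N) * of_real (ln \<bar>c\<bar>))"
    by (simp add: exp_add[symmetric] algebra_simps)
  then have *: "of_real (1/c) ^ N * (exp (l * of_real (ln \<bar>c\<bar>)) * z) = exp ((l - of_nat N) * of_real (ln \<bar>c\<bar>)) * z" for z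
    by (simp add: mult.assoc[symmetric])
  have "R_uea (D0 n N l) u (x ** p) = (\<Sum>j\<le>N div 2. D_coeff n N j l *
      (exp ((l - of_nat N) * of_real (ln \<bar>c\<bar>)) * Q_op j (2 * (N div 2 - j) + N mod 2) u x))"
    unfolding R_uea_D0(1)[OF uC] Q by (intro sum.cong refl) (simp only: atMost_iff NN *)
  also have "\<dots> = exp ((l - of_nat N) * of_real (ln \<bar>c\<bar>)) * R_uea (D0 n N l) u x"
    unfolding R_uea_D0(1)[OF uC] by (simp add: sum_distrib_left mult_ac)
  finally show ?thesis .
qed

text \<open>Invariance under \<open>N\<^sup>+\<close> follows by integration along one-parameter groups of the smaller group: the
  derivative of the restricted function is \<open>x\<^sub>w\<close> with \<open>w\<close> in \<open>low_space\<close>, to which \<open>D_killed_by_x\<close> applies.\<close>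

lemma D_op_Ind:
  fixes u :: "'a::finite option mat_m \<Rightarrow> complex"
  assumes n: "n = CARD('a) + 3" and u: "u \<in> Ind (L_grp s) l" and N: "even N \<or> \<not> s"
  shows "D_op n N l u \<in> Ind (L_grp s) (l - of_nat N)"
proof -
  have uC: "u \<in> C_inf G_grp"
    using u by (simp add: Ind_iff)
  define F where "F = R_uea (D0 n N l) u"
  have FC: "F \<in> C_inf G_grp"
    unfolding F_def by (rule R_uea_D0(2)[OF uC])
  have D: "D_op n N l u = pullback F"
    by (simp add: D_op_def F_def)
  have ma: "F (grp_emb (g ** m ** a)) = \<xi> (l - of_nat N) a * F (grp_emb g)"
    if h: "g \<in> G_grp" "m \<in> L_grp s" "a \<in> A_grp" for g m a :: "'a mat_m"
  proof -
    obtain t where t: "a = mat_exp (t *\<^sub>R H_mat)"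
      using h(3) by (auto simp: A_grp_eq)
    obtain \<sigma> where \<sigma>: "\<sigma> = 1 \<or> \<sigma> = -1" "\<sigma> \<in> scalars s" "m *v base_vec = \<sigma> *\<^sub>R base_vec" "m *v opp_vec = \<sigma> *\<^sub>R opp_vec"
      using h(2) by (auto simp: L_grp_iff)
    define c where "c = \<sigma> * exp t"
    define p where "p = grp_emb (m ** a)"
    have mae: "(m ** a) *v base_vec = c *\<^sub>R base_vec" "(m ** a) *v opp_vec = (1/c) *\<^sub>R opp_vec"
      using \<sigma> by (auto simp: t c_def exp_H_base exp_H_opp matrix_vector_simps exp_minus inverse_eq_divide simp flip: matrix_vector_mul_assoc)
    have "p *v base_vec = c *\<^sub>R base_vec" "p *v opp_vec = (1/c) *\<^sub>R opp_vec"
      using grp_emb_lift[of "m ** a" base_vec] grp_emb_lift[of "m ** a" opp_vec]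
      unfolding mae p_def by (simp_all add: linear_cmul[OF linear_lift])
    moreover have "p *v last_vec = last_vec"
      unfolding p_def by (rule grp_emb_last)
    moreover have "p \<in> G_grp"
      using h L_grp_G A_grp_G unfolding p_def by auto
    moreover have "c \<in> scalars s"
      unfolding c_def using scalars_mult[OF \<sigma>(2) scalars_pos[of "exp t"]] by simp
    ultimately have "F (grp_emb g ** p) = exp ((l - of_nat N) * of_real (ln \<bar>c\<bar>)) * F (grp_emb g)"
      unfolding F_def using h(1) by (intro D_levi[OF u N]) auto
    moreover have "ln \<bar>c\<bar> = t"
      using \<sigma>(1) by (auto simp: c_def abs_mult)
    ultimately show ?thesis
      by (simp add: p_def grp_emb_mult matrix_mul_assoc t \<xi>_exp)
  qed
  have \<eta>: "F (grp_emb (g ** \<eta>)) = F (grp_emb g)"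
    if h: "g \<in> G_grp" "\<eta> \<in> Np_grp" for g \<eta> :: "'a mat_m"
  proof -
    obtain v where v: "v \<in> mid_space" "\<eta> = mat_exp (1 *\<^sub>R wedge base_vec v)"
      using h(2) by (auto simp: Np_grp_eq)
    have e: "grp_emb \<eta> = mat_exp (1 *\<^sub>R wedge base_vec (lift v))"
      unfolding v(2) grp_emb_exp lie_emb_wedge by simp
    have "((\<lambda>t. F (grp_emb g ** mat_exp (t *\<^sub>R wedge base_vec (lift v)))) has_vector_derivative 0) (at t)" for t
      using R_mat_has_vector_derivative[OF wedge_in_gg[of base_vec "lift v"] FC, of "grp_emb g" t] h(1)
        D_killed_by_x[OF n Ind_lowest[OF u] lift_mid[OF v(1)], of N]
      by (simp add: F_def)
    from has_vector_derivative_zero_imp_eq[OF this, of 1 0]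
    show ?thesis
      by (simp add: grp_emb_mult e)
  qed
  show ?thesis
    unfolding D Ind_def
  proof (intro CollectI conjI ballI)
    show "pullback F \<in> C_inf G_grp"
      by (rule pullback_C_inf[OF FC])
    fix g m a \<eta>' :: "'a mat_m"
    assume h: "g \<in> G_grp" "m \<in> L_grp s" "a \<in> A_grp" "\<eta>' \<in> Np_grp"
    have "g ** m ** a \<in> G_grp"
      by (intro G_grp_mult h(1) L_grp_G[OF h(2)] A_grp_G[OF h(3)])
    then show "pullback F (g ** m ** a ** \<eta>') = \<xi> (l - of_nat N) a * pullback F g"
      unfolding pullback_def using \<eta>[OF _ h(4)] ma[OF h(1-3)] by simp
  qed
qed

section \<open>Polynomial dependence on the parameter\<close>

lemma a_aux_poly: "\<exists>q. \<forall>l. a_aux n k l i = poly q l"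
proof (induct i)
  case 0
  then show ?case by (intro exI[of _ 1]) simp
next
  case (Suc i)
  then obtain q where q: "\<And>l. a_aux n k l i = poly q l" by blast
  let ?r = "[:of_nat n - 1 - 4 * of_nat k + 2 * (of_nat k - of_nat i), 2:] :: complex poly"
  have r: "poly ?r l = of_nat n - 1 + 2 * l - 4 * of_nat k + 2 * (of_nat k - of_nat i)" for l
    by (simp add: algebra_simps)
  show ?case
    by (intro exI[of _ "smult (- (of_nat k - of_nat i) / ((of_nat i + 1) * (2 * of_nat i + 1))) (?r * q)"])
      (simp only: a_aux.simps q poly_smult poly_mult r divide_inverse mult.assoc mult.left_commute mult.commute, simp)
qed

lemma b_aux_poly: "\<exists>q. \<forall>l. b_aux n k l i = poly q l"
proof (induct i)
  case 0
  then show ?case by (intro exI[of _ 1]) simp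
next
  case (Suc i)
  then obtain q where q: "\<And>l. b_aux n k l i = poly q l" by blast
  let ?r = "[:of_nat n - 3 - 4 * of_nat k + 2 * (of_nat k - of_nat i), 2:] :: complex poly"
  have r: "poly ?r l = of_nat n - 3 + 2 * l - 4 * of_nat k + 2 * (of_nat k - of_nat i)" for l
    by (simp add: algebra_simps)
  show ?case
    by (intro exI[of _ "smult (- (of_nat k - of_nat i) / ((of_nat i + 1) * (2 * of_nat i + 3))) (?r * q)"])
      (simp only: b_aux.simps q poly_smult poly_mult r divide_inverse mult.assoc mult.left_commute mult.commute, simp)
qed

lemma D_coeff_poly: "\<exists>q. \<forall>l. D_coeff n N j l = poly q l"
  unfolding D_coeff_def a_coeff_def b_coeff_def using a_aux_poly b_aux_poly by (cases "even N") auto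

lemma scal_add: "scal (a + b) = scal a + scal b"
  by (simp add: scal_def single_add)

lemma scal_sum: "scal (sum f I) = (\<Sum>i\<in>I. scal (f i))"
  by (induct I rule: infinite_finite_induct) (auto simp: scal_add, auto simp: scal_def)

lemma scal_mult: "scal (a * b) = scal a * scal b"
  by (simp add: scal_def mult_single)

lemma D0_polynomial_family: "polynomial_family \<gg> (D0 n N)"
proof -
  have "\<forall>j. \<exists>q. \<forall>l. D_coeff n N j l = poly q l"
    using D_coeff_poly by blast
  then obtain q where q: "\<And>j l. D_coeff n N j l = poly (q j) l"
    by metis
  \<comment> \<open>Any common bound of the degrees of the coefficients.\<close>
  define d where "d = (\<Sum>j\<le>N div 2. degree (q j))"
  define e :: "nat \<Rightarrow> 'a option coord free_alg" where "e i = (\<Sum>j\<le>N div 2. scal (coeff (q j) i) * D_term N j)" for i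
  have eq: "(\<Sum>j\<le>N div 2. scal (D_coeff n N j l) * D_term N j) = (\<Sum>i\<le>d. scal (l ^ i) * e i)" for l
  proof -
    have "poly (q j) l = (\<Sum>i\<le>d. l ^ i * coeff (q j) i)" if j: "j \<le> N div 2" for j
    proof -
      have "degree (q j) \<le> d"
        unfolding d_def using j by (intro member_le_sum) auto
      then have "poly (q j) l = (\<Sum>i\<le>d. coeff (q j) i * l ^ i)"
        unfolding poly_altdef by (intro sum.mono_neutral_left) (auto simp: coeff_eq_0)
      then show ?thesis by (simp add: mult.commute)
    qed
    then have "(\<Sum>j\<le>N div 2. scal (D_coeff n N j l) * D_term N j)
        = (\<Sum>j\<le>N div 2. \<Sum>i\<le>d. scal (l ^ i) * (scal (coeff (q j) i) * D_term N j))"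
      by (intro sum.cong refl) (simp add: q scal_sum scal_mult sum_distrib_right mult.assoc)
    also have "\<dots> = (\<Sum>i\<le>d. scal (l ^ i) * e i)"
      by (subst sum.swap) (simp add: e_def sum_distrib_left)
    finally show ?thesis .
  qed
  have "e i \<in> FA" for i
    unfolding e_def by (intro FA_sum FA_mult FA_scal D_term_FA)
  then show ?thesis
    unfolding polynomial_family_def D0_eq eq by blast
qed

section \<open>The maximal compact subgroup\<close>

definition time_part :: "'a::finite vec_m \<Rightarrow> 'a vec_m" where
  "time_part x = (\<chi> c. if time_like c then x $ c else 0)"

definition space_part :: "'a::finite vec_m \<Rightarrow> 'a vec_m" where
  "space_part x = x - time_part x"

definition radius :: "'a::finite vec_m \<Rightarrow> real" where
  "radius x = norm (time_part x)"

lemma time_part_nth [simp]: "time_part x $ c = (if time_like c then x $ c else 0)"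
  by (simp add: time_part_def)

lemma time_part_simps:
  "time_part (x + y) = time_part x + time_part y" "time_part (r *\<^sub>R x) = r *\<^sub>R time_part x"
  "space_part (r *\<^sub>R x) = r *\<^sub>R space_part x" "time_part (time_part x) = time_part x"
  "time_part (space_part x) = 0" "space_part (time_part x) = 0" "space_part (space_part x) = space_part x"
  "time_part x + space_part x = x"
  by (auto simp: vec_eq_iff space_part_def)

lemma bounded_linear_time_part: "bounded_linear time_part"
  unfolding linear_conv_bounded_linear[symmetric] linear_iff by (simp add: time_part_simps)

lemma bounded_linear_space_part: "bounded_linear space_part"
  unfolding space_part_def[abs_def] by (intro bounded_linear_sub bounded_linear_ident bounded_linear_time_part)

lemma bform_inner: "bform x y = x \<bullet> y - 2 * (time_part x \<bullet> time_part y)"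
  by (auto simp: bform_def inner_vec_def csign_def sum_distrib_left simp flip: sum_subtractf intro!: sum.cong)

lemma inner_time_space [simp]: "time_part x \<bullet> space_part y = 0" "space_part y \<bullet> time_part x = 0"
  by (auto simp: inner_vec_def space_part_def intro!: sum.neutral)

lemma bform_parts: "bform x x = (norm (space_part x))\<^sup>2 - (radius x)\<^sup>2"
proof -
  have "x \<bullet> x = (time_part x + space_part x) \<bullet> (time_part x + space_part x)"
    by (simp add: time_part_simps)
  then show ?thesis
    by (simp add: bform_inner radius_def power2_norm_eq_inner inner_add_left inner_add_right)
qed

lemma cone_norm: "x \<in> cone \<Longrightarrow> norm (space_part x) = radius x"
  by (simp add: cone_def qform_bform bform_parts radius_def)

lemma cone_radius_pos:
  assumes "x \<in> cone" "x \<noteq> 0"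
  shows "0 < radius x"
proof (rule ccontr)
  assume "\<not> 0 < radius x"
  then have "radius x = 0"
    by (simp add: radius_def)
  then have "time_part x = 0" "space_part x = 0"
    using cone_norm[OF assms(1)] by (simp_all add: radius_def)
  then show False
    using assms(2) time_part_simps(8)[of x] by simp
qed

lemma radius_scaleR: "radius (r *\<^sub>R x) = \<bar>r\<bar> * radius x"
  by (simp add: radius_def time_part_simps)

lemma base_parts [simp]: "time_part base_vec = axis Time1 1" "space_part base_vec = axis Space2 1"
  by (auto simp: vec_eq_iff base_vec_def space_part_def time_like_def axis_at)

lemma radius_base [simp]: "radius base_vec = 1"
  by (simp add: radius_def)

lemma K_grp_time_part:
  assumes "k \<in> K_grp"
  shows "time_part (k *v x) = k *v time_part x"
  unfolding vec_eq_iff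
proof
  fix c
  have z: "k $ c $ d = 0" if "time_like c \<noteq> time_like d" for d
    using assms that by (auto simp: K_grp_def)
  show "time_part (k *v x) $ c = (k *v time_part x) $ c"
    using z by (auto simp: matrix_vector_mult_def intro!: sum.cong sum.neutral)
qed

lemma K_grp_inner:
  assumes "k \<in> K_grp"
  shows "(k *v x) \<bullet> (k *v y) = x \<bullet> y"
proof -
  have "orthogonal_transformation ((*v) k)"
    using assms by (simp add: K_grp_def orthogonal_transformation_matrix matrix_vector_mul_linear)
  then show ?thesis
    by (simp add: orthogonal_transformation_def)
qed

lemma K_grp_G: "k \<in> K_grp \<Longrightarrow> k \<in> G_grp"
  by (simp add: G_grp_iff bform_inner K_grp_time_part K_grp_inner)

lemma K_grp_radius: "k \<in> K_grp \<Longrightarrow> radius (k *v x) = radius x"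
  by (simp add: radius_def K_grp_time_part norm_eq_sqrt_inner K_grp_inner)

lemma K_grp_mult:
  assumes "k \<in> K_grp" "h \<in> K_grp"
  shows "k ** h \<in> K_grp"
proof -
  have "k $ a $ c * h $ c $ b = 0" if "time_like a \<noteq> time_like b" for a b c
    using assms that by (cases "time_like a = time_like c") (auto simp: K_grp_def)
  then have "(k ** h) $ a $ b = 0" if "time_like a \<noteq> time_like b" for a b
    using that by (auto simp: matrix_matrix_mult_def simp del: mult_eq_0_iff intro!: sum.neutral)
  then show ?thesis
    using assms by (auto simp: K_grp_def orthogonal_matrix_mul)
qed

section \<open>Reflections\<close>

text \<open>Written with \<open>inverse\<close>, whose value at 0 is 0, so that the reflection in the zero vector is the
  identity.\<close>

definition reflection :: "'a::finite vec_m \<Rightarrow> 'a mat_m" where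
  "reflection w = mat 1 - (2 * inverse (w \<bullet> w)) *\<^sub>R (\<chi> i j. w $ i * w $ j)"

lemma reflection_mult_vec: "reflection w *v x = x - (2 * inverse (w \<bullet> w) * (w \<bullet> x)) *\<^sub>R w"
proof -
  have "(\<chi> i j. w $ i * w $ j) *v x = (w \<bullet> x) *\<^sub>R w"
    by (simp add: vec_eq_iff matrix_vector_mult_def inner_vec_def sum_distrib_left mult_ac)
  then show ?thesis
    by (simp add: reflection_def matrix_vector_simps)
qed

lemma reflection_inner: "(reflection w *v x) \<bullet> (reflection w *v y) = x \<bullet> y"
proof (cases "w = 0")
  case False
  then have "w \<bullet> w \<noteq> 0" by simp
  then show ?thesis
    by (simp add: reflection_mult_vec inner_diff_left inner_diff_right inner_commute[of x w] field_simps)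
qed (simp add: reflection_mult_vec)

lemma reflection_orthogonal: "orthogonal_matrix (reflection w)"
proof -
  have "orthogonal_transformation ((*v) (reflection w))"
    by (simp add: orthogonal_transformation_def reflection_inner matrix_vector_mul_linear)
  then show ?thesis
    by (simp add: orthogonal_transformation_matrix)
qed

lemma reflection_K:
  assumes "time_part w = 0 \<or> space_part w = 0"
  shows "reflection w \<in> K_grp"
proof -
  have "w $ a * w $ b = 0" if "time_like a \<noteq> time_like b" for a b
    using assms
  proof
    assume "time_part w = 0"
    then have "time_part w $ c = 0" for c by simp
    then show ?thesis using that by (metis mult_eq_0_iff time_part_nth)
  next
    assume "space_part w = 0"
    then have "w $ c = time_part w $ c" for c
      using time_part_simps(8)[of w] by simp
    then show ?thesis using that by (metis mult_eq_0_iff time_part_nth)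
  qed
  then show ?thesis
    using reflection_orthogonal by (auto simp: K_grp_def reflection_def mat_def)
qed

lemma reflection_fix: "w \<bullet> x = 0 \<Longrightarrow> reflection w *v x = x"
  by (simp add: reflection_mult_vec)

lemma reflection_swap:
  assumes "norm x = norm y"
  shows "reflection (y - x) *v x = y"
proof (cases "x = y")
  case False
  have xy: "x \<bullet> x = y \<bullet> y"
    using assms by (simp add: norm_eq)
  have "(y - x) \<bullet> (y - x) = - 2 * ((y - x) \<bullet> x)"
    using xy by (simp add: inner_diff_left inner_diff_right inner_commute)
  moreover have "(y - x) \<bullet> (y - x) \<noteq> 0"
    using False by simp
  ultimately have "2 * inverse ((y - x) \<bullet> (y - x)) * ((y - x) \<bullet> x) = -1"
    by (simp add: field_simps)
  then show ?thesis
    unfolding reflection_mult_vec by simp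
qed (simp add: reflection_mult_vec)

lemma reflection_scaleR: "r \<noteq> 0 \<Longrightarrow> reflection (r *\<^sub>R w) *v x = reflection w *v x"
  by (simp add: reflection_mult_vec, simp add: field_simps)

text \<open>A point of the cone has time and space parts of equal length. One reflection in each of the two
  factors takes the parts of \<open>e\<close> to those of \<open>x\<close>, up to the common length.\<close>

lemma K_grp_transitive:
  assumes x: "x \<in> cone" "x \<noteq> 0"
  shows "\<exists>k\<in>K_grp. x = radius x *\<^sub>R (k *v base_vec)"
proof -
  define r where "r = radius x"
  have r: "0 < r"
    using cone_radius_pos[OF x] by (simp add: r_def)
  define t where "t = (1/r) *\<^sub>R time_part x"
  define y where "y = (1/r) *\<^sub>R space_part x"
  have n: "norm (axis Time1 1 :: 'a vec_m) = norm t" "norm (axis Space2 1 :: 'a vec_m) = norm y"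
    using r cone_norm[OF x(1)] by (simp_all add: t_def y_def r_def radius_def)
  define k where "k = reflection (t - axis Time1 1) ** reflection (y - axis Space2 1)"
  have parts: "t = time_part t" "y = space_part y" "(axis Time1 1 :: 'a vec_m) = time_part (axis Time1 1)"
    "(axis Space2 1 :: 'a vec_m) = space_part (axis Space2 1)"
    by (simp_all add: t_def y_def time_part_simps)
       (auto simp: vec_eq_iff axis_at space_part_def time_like_def)
  have sp: "space_part (t - axis Time1 1) = 0" "time_part (y - axis Space2 1) = 0"
    by (simp_all add: t_def y_def space_part_def time_part_def vec_eq_iff axis_at time_like_def)
  have orth: "(y - axis Space2 1) \<bullet> axis Time1 1 = 0" "(t - axis Time1 1) \<bullet> y = 0"
    using parts by (metis inner_diff_left inner_time_space diff_self)+
  have "k *v base_vec = reflection (t - axis Time1 1) *v (axis Time1 1 + y)"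
    unfolding k_def base_vec_def
    by (simp add: matrix_vector_mul_assoc[symmetric] matrix_vector_simps reflection_fix[OF orth(1)] reflection_swap[OF n(2)])
  also have "\<dots> = t + y"
    by (simp add: matrix_vector_simps reflection_fix[OF orth(2)] reflection_swap[OF n(1)])
  also have "r *\<^sub>R (t + y) = x"
    using r by (simp add: t_def y_def time_part_simps flip: scaleR_add_right)
  finally have "x = r *\<^sub>R (k *v base_vec)"
    by simp
  moreover have "k \<in> K_grp"
    unfolding k_def using sp by (intro K_grp_mult reflection_K) auto
  ultimately show ?thesis
    unfolding r_def by blast
qed

lemma G_grp_cone: "g \<in> G_grp \<Longrightarrow> g *v base_vec \<in> cone" "g \<in> G_grp \<Longrightarrow> g *v base_vec \<noteq> 0"
proof -
  assume g: "g \<in> G_grp"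
  show "g *v base_vec \<in> cone"
    by (simp add: cone_def qform_bform G_grp_bform[OF g])
  show "g *v base_vec \<noteq> 0"
    using G_grp_inverse_vec(1)[OF g, of base_vec] base_vec_neq_0 by (metis matrix_vector_mult_0_right)
qed

lemma G_grp_polar:
  assumes g: "g \<in> G_grp"
  obtains k p r where "k \<in> K_grp" "p \<in> G_grp" "0 < r" "p *v base_vec = r *\<^sub>R base_vec" "g = k ** p"
proof -
  obtain k where k: "k \<in> K_grp" "g *v base_vec = radius (g *v base_vec) *\<^sub>R (k *v base_vec)"
    using K_grp_transitive[OF G_grp_cone[OF g]] by blast
  note kG = K_grp_G[OF k(1)]
  have "(matrix_inv k ** g) *v base_vec = radius (g *v base_vec) *\<^sub>R base_vec"
    using arg_cong[OF k(2), of "\<lambda>x. matrix_inv k *v x"] kG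
    by (simp add: matrix_vector_simps flip: matrix_vector_mul_assoc)
  moreover have "g = k ** (matrix_inv k ** g)"
    using kG by (simp add: matrix_mul_assoc)
  ultimately show thesis
    using that k(1) G_grp_mult[OF G_grp_inv[OF kG] g] cone_radius_pos[OF G_grp_cone[OF g]] by blast
qed

lemma smooth_on_continuous_on:
  assumes "smooth_on U f" "open U"
  shows "continuous_on U f"
  using smooth_on_derivative[OF assms] has_derivative_continuous continuous_at_imp_continuous_on by metis

lemma smooth_on_reflection:
  assumes w: "smooth_on U w" and U: "open U" and pos: "\<And>x. x \<in> U \<Longrightarrow> 0 < w x \<bullet> w x"
  shows "smooth_on U (\<lambda>x. reflection (w x))"
  unfolding reflection_def
  by (intro smooth_on_diff smooth_on_const smooth_on_scaleR smooth_on_mult smooth_on_inverse_pos pos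
      smooth_on_bilinear[OF bounded_bilinear_inner] smooth_on_vec_lambda
      smooth_on_bounded_linear_comp[OF bounded_linear_vec_nth] w U)

text \<open>The reflection in \<open>y - x\<close> takes \<open>x\<close> to \<open>y\<close> but is not smooth where \<open>y = x\<close>. Near a given \<open>t0\<close> the
  problem disappears after a detour: first \<open>t0\<close> is sent to \<open>-t0\<close>, and then \<open>-t0\<close> to \<open>t\<close> by the
  reflection in \<open>t + t0\<close>, a vector that stays away from 0.\<close>

lemma smooth_local_section:
  assumes g0: "g0 \<in> (G_grp :: 'a::finite mat_m set)"
  obtains U \<sigma> where "open U" "g0 \<in> U" "smooth_on U \<sigma>" "\<And>g. g \<in> U \<Longrightarrow> 0 < radius (g *v base_vec)"
    "smooth_on U (\<lambda>g. radius (g *v base_vec))"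
    "\<And>g. g \<in> U \<Longrightarrow> g \<in> G_grp \<Longrightarrow> \<sigma> g \<in> K_grp \<and> g *v base_vec = radius (g *v base_vec) *\<^sub>R (\<sigma> g *v base_vec)"
proof -
  obtain k0 where k0: "k0 \<in> K_grp" "g0 *v base_vec = radius (g0 *v base_vec) *\<^sub>R (k0 *v base_vec)"
    using K_grp_transitive[OF G_grp_cone[OF g0]] by blast
  define t0 where "t0 = time_part (k0 *v base_vec)"
  define y0 where "y0 = space_part (k0 *v base_vec)"
  have n0: "norm t0 = 1" "norm y0 = 1"
    using K_grp_radius[OF k0(1), of base_vec] cone_norm[OF G_grp_cone(1)[OF K_grp_G[OF k0(1)]]]
    by (simp_all add: t0_def y0_def radius_def)
  let ?x = "\<lambda>g :: 'a mat_m. g *v base_vec"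
  \<comment> \<open>These are \<open>t + t0\<close> and its spatial analogue scaled by the radius, which leaves the reflections unchanged and spares a division.\<close>
  define w1 where "w1 g = time_part (?x g) + radius (?x g) *\<^sub>R t0" for g
  define w2 where "w2 g = space_part (?x g) + radius (?x g) *\<^sub>R y0" for g
  define \<sigma> where "\<sigma> g = reflection (w1 g) ** reflection (w2 g) ** (reflection t0 ** reflection y0 ** k0)" for g
  have lin: "bounded_linear ?x"
    by (rule bounded_bilinear.bounded_linear_left[OF bounded_bilinear_matrix_vector_mult])
  define q where "q g = time_part (?x g) \<bullet> time_part (?x g)" for g
  have sx: "smooth_on W (\<lambda>g. time_part (?x g))" "smooth_on W (\<lambda>g. space_part (?x g))" for W
    by (intro smooth_on_bounded_linear bounded_linear_compose[OF _ lin, unfolded o_def] bounded_linear_time_part bounded_linear_space_part)+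
  have sq: "smooth_on W q" if "open W" for W
    unfolding q_def using that by (intro smooth_on_bilinear[OF bounded_bilinear_inner] sx)
  define U0 where "U0 = q -` {0<..}"
  have U0: "open U0"
    using continuous_open_preimage[OF smooth_on_continuous_on[OF sq[OF open_UNIV] open_UNIV] open_UNIV, of "{0<..}"]
    by (simp add: U0_def)
  have rq: "radius (?x g) = sqrt (q g)" for g
    by (simp add: radius_def q_def norm_eq_sqrt_inner)
  have sr: "smooth_on U0 (\<lambda>g. radius (?x g))"
    unfolding rq by (intro smooth_on_sqrt_pos sq U0) (simp add: U0_def)
  have sw: "smooth_on U0 w1" "smooth_on U0 w2"
    unfolding w1_def w2_def by (intro smooth_on_add smooth_on_scaleR smooth_on_const sr sx U0)+
  define U where "U = U0 \<inter> (\<lambda>g. w1 g \<bullet> w1 g) -` {0<..} \<inter> (U0 \<inter> (\<lambda>g. w2 g \<bullet> w2 g) -` {0<..})"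
  have "open U"
    unfolding U_def
    by (intro open_Int continuous_open_preimage smooth_on_continuous_on smooth_on_bilinear[OF bounded_bilinear_inner] sw U0 open_greaterThan)
  have UU0: "U \<subseteq> U0" by (auto simp: U_def)
  have rpos: "0 < radius (?x g)" if "g \<in> U" for g
    using that UU0 by (auto simp: rq U0_def)
  have g0U: "g0 \<in> U"
  proof -
    have r0: "0 < radius (?x g0)"
      using cone_radius_pos[OF G_grp_cone[OF g0]] .
    have "time_part (?x g0) = radius (?x g0) *\<^sub>R t0" "space_part (?x g0) = radius (?x g0) *\<^sub>R y0"
      using arg_cong[OF k0(2), of time_part] arg_cong[OF k0(2), of space_part]
      by (simp_all add: t0_def y0_def time_part_simps)
    then have "w1 g0 = (2 * radius (?x g0)) *\<^sub>R t0" "w2 g0 = (2 * radius (?x g0)) *\<^sub>R y0"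
      by (simp_all add: w1_def w2_def flip: scaleR_add_left)
    moreover have "t0 \<noteq> 0" "y0 \<noteq> 0"
      using n0 by auto
    ultimately have "0 < w1 g0 \<bullet> w1 g0" "0 < w2 g0 \<bullet> w2 g0"
      using r0 by simp_all
    moreover have "0 < q g0"
      using r0 by (simp add: rq)
    ultimately show ?thesis
      by (simp add: U_def U0_def)
  qed
  have s\<sigma>: "smooth_on U \<sigma>"
    unfolding \<sigma>_def
    by (intro smooth_on_matrix_mult smooth_on_reflection smooth_on_const smooth_on_subset[OF sw(1) UU0]
        smooth_on_subset[OF sw(2) UU0] \<open>open U\<close>) (auto simp: U_def)
  have tt: "time_part t0 = t0" "space_part t0 = 0" "space_part y0 = y0" "time_part y0 = 0"
    by (simp_all add: t0_def y0_def time_part_simps)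
  have \<sigma>: "\<sigma> g \<in> K_grp \<and> ?x g = radius (?x g) *\<^sub>R (\<sigma> g *v base_vec)" if g: "g \<in> U" "g \<in> G_grp" for g
  proof
    define r where "r = radius (?x g)"
    have r: "0 < r" using rpos[OF g(1)] by (simp add: r_def)
    have p1: "space_part (w1 g) = 0" "time_part (w2 g) = 0"
      unfolding w1_def w2_def space_part_def using tt
      by (simp_all add: time_part_simps space_part_def[symmetric])
    show "\<sigma> g \<in> K_grp"
      unfolding \<sigma>_def using p1 tt by (intro K_grp_mult reflection_K k0(1)) auto
    define t where "t = (1/r) *\<^sub>R time_part (?x g)"
    define y where "y = (1/r) *\<^sub>R space_part (?x g)"
    have n: "norm (- t0) = norm t" "norm (- y0) = norm y"
      using r cone_norm[OF G_grp_cone(1)[OF g(2)]] n0 by (simp_all add: t_def y_def r_def radius_def)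
    have w: "w1 g = r *\<^sub>R (t - (- t0))" "w2 g = r *\<^sub>R (y - (- y0))"
      using r by (simp_all add: w1_def w2_def t_def y_def r_def[symmetric] scaleR_add_right)
    have R: "reflection (w1 g) *v (- t0) = t" "reflection (w2 g) *v (- y0) = y"
      unfolding w reflection_scaleR[OF less_imp_neq[OF r, symmetric]]
      by (fact reflection_swap[OF n(1)], fact reflection_swap[OF n(2)])
    have orth: "v \<bullet> z = 0" if "space_part v = 0" "time_part z = 0" for v z :: "'a vec_m"
    proof -
      have "v = time_part v" "z = space_part z"
        using that time_part_simps(8)[of v] time_part_simps(8)[of z] by simp_all
      then show ?thesis by (metis inner_time_space(1))
    qed
    have py: "time_part y = 0" "space_part t = 0"
      by (simp_all add: t_def y_def time_part_simps)
    have fix1: "reflection (w1 g) *v y = y"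
      by (intro reflection_fix orth p1 py)
    have fix2: "reflection (w2 g) *v (- t0) = - t0"
      using orth[OF tt(2) p1(2)] by (intro reflection_fix) (simp add: inner_commute)
    have neg: "reflection t0 *v t0 = - t0" "reflection y0 *v y0 = - y0"
      using n0 by (simp_all add: reflection_mult_vec power2_norm_eq_inner[symmetric] scaleR_2)
    have fix3: "reflection y0 *v t0 = t0" "reflection t0 *v (- y0) = - y0"
      using orth[OF tt(2,4)] by (simp_all add: reflection_fix inner_commute)
    have "k0 *v base_vec = t0 + y0"
      by (simp add: t0_def y0_def time_part_simps)
    then have "\<sigma> g *v base_vec = reflection (w1 g) *v (reflection (w2 g) *v (reflection t0 *v (reflection y0 *v (t0 + y0))))"
      by (simp add: \<sigma>_def flip: matrix_vector_mul_assoc)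
    also have "\<dots> = reflection (w1 g) *v (reflection (w2 g) *v (- t0 + - y0))"
      by (simp only: matrix_vector_simps(2) neg fix3)
    also have "\<dots> = t + y"
      by (simp only: matrix_vector_simps(2) fix2 R fix1)
    finally show "?x g = radius (?x g) *\<^sub>R (\<sigma> g *v base_vec)"
      using r by (simp add: t_def y_def r_def[symmetric] time_part_simps flip: scaleR_add_right)
  qed
  show thesis
    using that[OF \<open>open U\<close> g0U s\<sigma> rpos smooth_on_subset[OF sr UU0] \<sigma>] by blast
qed

section \<open>The compact realization\<close>

text \<open>The point of the Einstein universe, or of its double cover of rays, given by a vector of the cone.\<close>

definition pt :: "bool \<Rightarrow> 'a::finite vec_m \<Rightarrow> 'a vec_m set" where
  "pt s x = (if s then span {x} else ray x)"

definition E_set :: "bool \<Rightarrow> 'a::finite vec_m set set" where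
  "E_set s = (if s then Ein else Ein_hat)"

lemma E_set_eq: "E_set s = pt s ` (cone - {0})"
  by (auto simp: E_set_def pt_def Ein_def Ein_hat_def)

lemma pt_image: "(*v) g ` pt s x = pt s (g *v x)"
proof (cases s)
  case True
  then show ?thesis
    using linear_span_image[OF matrix_vector_mul_linear, of g "{x}"] by (simp add: pt_def)
next
  case False
  have "(*v) g ` ray x = ray (g *v x)"
    unfolding ray_def by (auto simp: matrix_vector_simps image_iff)
      (metis matrix_vector_simps(8))
  then show ?thesis using False by (simp add: pt_def)
qed

lemma pt_eq:
  assumes "x \<noteq> 0" "y \<noteq> 0"
  shows "pt s x = pt s y \<longleftrightarrow> (\<exists>c\<in>scalars s. x = c *\<^sub>R y)"
proof
  assume eq: "pt s x = pt s y"
  have "x \<in> pt s x"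
    unfolding pt_def ray_def by (auto intro: span_base exI[of _ 1])
  then have "x \<in> pt s y" using eq by simp
  then obtain c where "x = c *\<^sub>R y" "s \<or> 0 \<le> c"
    by (auto simp: pt_def ray_def span_singleton split: if_splits)
  then show "\<exists>c\<in>scalars s. x = c *\<^sub>R y"
    using assms by (intro bexI[of _ c]) (auto simp: scalars_def)
next
  assume "\<exists>c\<in>scalars s. x = c *\<^sub>R y"
  then obtain c where c: "c \<in> scalars s" "x = c *\<^sub>R y" by blast
  have sub: "pt s (c *\<^sub>R y) \<subseteq> pt s y" if "c \<in> scalars s" for c and y :: "'a vec_m"
    using that by (auto simp: pt_def ray_def span_singleton scalars_def split: if_splits)
  have "y = inverse c *\<^sub>R x"
    using c scalars_nonzero by auto
  then show "pt s x = pt s y"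
    using sub[OF c(1), of y] sub[OF scalars_inverse[OF c(1)], of x] c(2) by auto
qed

lemma K_lift_pt: "k \<in> K_grp \<Longrightarrow> K_lift (pt s base_vec) f k = f (pt s (k *v base_vec))"
  by (simp add: K_lift_def pt_image)

lemma K_lift_outside: "k \<notin> K_grp \<Longrightarrow> K_lift e f k = 0"
  by (simp add: K_lift_def)

abbreviation C_inf_pt :: "bool \<Rightarrow> ('a::finite vec_m set \<Rightarrow> complex) set" where
  "C_inf_pt s \<equiv> C_inf_E (E_set s) (pt s base_vec)"

lemma E_set_K:
  assumes "X \<in> E_set s"
  shows "\<exists>k\<in>K_grp. X = pt s (k *v base_vec)"
proof -
  obtain x where x: "x \<in> cone" "x \<noteq> 0" "X = pt s x"
    using assms by (auto simp: E_set_eq)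
  obtain k where k: "k \<in> K_grp" "x = radius x *\<^sub>R (k *v base_vec)"
    using K_grp_transitive[OF x(1,2)] by blast
  have "pt s x = pt s (k *v base_vec)"
    using pt_eq[OF x(2) G_grp_cone(2)[OF K_grp_G[OF k(1)]]] k(2) scalars_pos[OF cone_radius_pos[OF x(1,2)]] by blast
  then show ?thesis
    using k(1) x(3) by blast
qed

lemma K_E_set: "g \<in> G_grp \<Longrightarrow> pt s (g *v base_vec) \<in> E_set s"
  using G_grp_cone by (auto simp: E_set_eq)

lemma K_lift_inj:
  assumes "f \<in> C_inf_pt s" "h \<in> C_inf_pt s"
    and eq: "\<And>k. k \<in> K_grp \<Longrightarrow> K_lift (pt s base_vec) f k = K_lift (pt s base_vec) h k"
  shows "f = h"
proof
  fix X
  show "f X = h X"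
  proof (cases "X \<in> E_set s")
    case True
    then show ?thesis
      using E_set_K[OF True] eq K_lift_pt by metis
  next
    case False
    then show ?thesis
      using assms by (simp add: C_inf_E_def)
  qed
qed

text \<open>The homogeneous extension of a function on the Einstein universe, as a function on the group. It
  inverts \<open>delta\<close>.\<close>

definition Ind_extend :: "bool \<Rightarrow> complex \<Rightarrow> ('a::finite vec_m set \<Rightarrow> complex) \<Rightarrow> 'a mat_m \<Rightarrow> complex" where
  "Ind_extend s l f g = (if g \<in> G_grp
     then exp (l * of_real (ln (radius (g *v base_vec)))) * f (pt s (g *v base_vec)) else 0)"

lemma extend_K: "k \<in> K_grp \<Longrightarrow> Ind_extend s l f k = f (pt s (k *v base_vec))"
  by (simp add: Ind_extend_def K_grp_G K_grp_radius)

lemma extend_Ind: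
  assumes f: "f \<in> C_inf_pt s"
  shows "Ind_extend s l f \<in> Ind (L_grp s) l"
  unfolding Ind_iff
proof (intro conjI ballI impI)
  show "Ind_extend s l f \<in> C_inf G_grp"
  proof (rule C_infI)
    fix g0 :: "'a mat_m" assume g0: "g0 \<in> G_grp"
    obtain U \<sigma> where U: "open U" "g0 \<in> U" "smooth_on U \<sigma>" "\<And>g. g \<in> U \<Longrightarrow> 0 < radius (g *v base_vec)"
      "smooth_on U (\<lambda>g. radius (g *v base_vec))"
      "\<And>g. g \<in> U \<Longrightarrow> g \<in> G_grp \<Longrightarrow> \<sigma> g \<in> K_grp \<and> g *v base_vec = radius (g *v base_vec) *\<^sub>R (\<sigma> g *v base_vec)"
      using smooth_local_section[OF g0] by blast
    have "K_lift (pt s base_vec) f \<in> C_inf K_grp"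
      using f by (simp add: C_inf_E_def)
    then obtain V v where V: "open V" "\<sigma> g0 \<in> V" "smooth_on V v"
      "\<And>k. k \<in> V \<Longrightarrow> k \<in> K_grp \<Longrightarrow> v k = K_lift (pt s base_vec) f k"
      using C_inf_local U(2,6) g0 by metis
    define W where "W = U \<inter> \<sigma> -` V"
    have W: "open W" "W \<subseteq> U"
      unfolding W_def using continuous_open_preimage[OF smooth_on_continuous_on[OF U(3,1)] U(1) V(1)] by auto
    have "smooth_on W (\<lambda>g. exp (l * of_real (ln (radius (g *v base_vec)))) * v (\<sigma> g))"
      using W U(4) V
      by (intro smooth_on_mult smooth_on_powr_pos smooth_on_compose[OF V(3,1)] smooth_on_subset[OF U(5)] smooth_on_subset[OF U(3)])
        (auto simp: W_def)
    moreover have "exp (l * of_real (ln (radius (g *v base_vec)))) * v (\<sigma> g) = Ind_extend s l f g"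
      if g: "g \<in> W" "g \<in> G_grp" for g
    proof -
      have \<sigma>: "\<sigma> g \<in> K_grp" "g *v base_vec = radius (g *v base_vec) *\<^sub>R (\<sigma> g *v base_vec)"
        using U(6) g W(2) by blast+
      have "pt s (g *v base_vec) = pt s (\<sigma> g *v base_vec)"
        using pt_eq[OF G_grp_cone(2)[OF g(2)] G_grp_cone(2)[OF K_grp_G[OF \<sigma>(1)]]] \<sigma>(2)
          scalars_pos[OF U(4)] g(1) W(2) by blast
      then show ?thesis
        using g V(4)[of "\<sigma> g"] \<sigma>(1) by (simp add: Ind_extend_def K_lift_pt W_def)
    qed
    moreover have "g0 \<in> W"
      using U(2) V(2) by (simp add: W_def)
    ultimately show "\<exists>U v. open U \<and> g0 \<in> U \<and> smooth_on U v \<and> (\<forall>g\<in>U \<inter> G_grp. v g = Ind_extend s l f g)"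
      using W(1) by blast
  qed (simp add: Ind_extend_def)
next
  fix g p :: "'a mat_m" and c
  assume h: "g \<in> G_grp" "p \<in> G_grp" "c \<in> scalars s" "p *v base_vec = c *\<^sub>R base_vec"
  have gp: "(g ** p) *v base_vec = c *\<^sub>R (g *v base_vec)"
    by (simp add: h(4) matrix_vector_simps flip: matrix_vector_mul_assoc)
  have gpG: "g ** p \<in> G_grp" using h by blast
  have "pt s ((g ** p) *v base_vec) = pt s (g *v base_vec)"
    using pt_eq[OF G_grp_cone(2)[OF gpG] G_grp_cone(2)[OF h(1)]] gp h(3) by blast
  moreover have "ln (radius ((g ** p) *v base_vec)) = ln \<bar>c\<bar> + ln (radius (g *v base_vec))"
    using cone_radius_pos[OF G_grp_cone[OF h(1)]] scalars_nonzero[OF h(3)]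
    by (simp add: gp radius_scaleR ln_mult)
  ultimately show "Ind_extend s l f (g ** p) = exp (l * of_real (ln \<bar>c\<bar>)) * Ind_extend s l f g"
    using h(1) gpG by (simp add: Ind_extend_def distrib_left exp_add)
qed

lemma K_grp_C_inf_restrict:
  assumes "u \<in> C_inf G_grp"
  shows "(\<lambda>k. if k \<in> K_grp then u k else 0) \<in> C_inf K_grp"
proof (rule C_infI)
  fix k :: "'a mat_m" assume k: "k \<in> K_grp"
  obtain U v where "open U" "k \<in> U" "smooth_on U v" "\<And>y. y \<in> U \<Longrightarrow> y \<in> G_grp \<Longrightarrow> v y = u y"
    using C_inf_local[OF assms K_grp_G[OF k]] by blast
  then show "\<exists>U v. open U \<and> k \<in> U \<and> smooth_on U v \<and> (\<forall>y\<in>U \<inter> K_grp. v y = (if y \<in> K_grp then u y else 0))"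
    using K_grp_G by (intro exI[of _ U] exI[of _ v]) auto
qed simp

abbreviation delta_pt :: "bool \<Rightarrow> ('a::finite mat_m \<Rightarrow> complex) \<Rightarrow> 'a vec_m set \<Rightarrow> complex" where
  "delta_pt s \<equiv> delta (E_set s) (pt s base_vec)"

lemma K_descend_props:
  assumes f: "f \<in> C_inf_pt s" and eq: "K_lift (pt s base_vec) f = h"
  shows "K_descend (E_set s) (pt s base_vec) h = f"
  unfolding K_descend_def
  by (rule inv_into_f_eq, rule inj_onI, rule K_lift_inj[where s = s], assumption, assumption, simp,
      rule f, rule eq)

text \<open>Two elements of the compact group with the same point differ by an element of the parabolic subgroup
  for which \<open>\<bar>c\<bar> = 1\<close>, as the compact group preserves the radius. So an induced function descends.\<close>

lemma delta_props:
  assumes u: "u \<in> Ind (L_grp s) l"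
  shows "delta_pt s u \<in> C_inf_pt s" "\<And>k. k \<in> K_grp \<Longrightarrow> K_lift (pt s base_vec) (delta_pt s u) k = u k"
proof -
  define f where "f X = (if X \<in> E_set s then u (SOME k. k \<in> K_grp \<and> X = pt s (k *v base_vec)) else 0)" for X
  have "f (pt s (k *v base_vec)) = u k" if k: "k \<in> K_grp" for k
  proof -
    define k' where "k' = (SOME k'. k' \<in> K_grp \<and> pt s (k *v base_vec) = pt s (k' *v base_vec))"
    have k': "k' \<in> K_grp" "pt s (k *v base_vec) = pt s (k' *v base_vec)"
      unfolding k'_def using someI[of "\<lambda>k'. k' \<in> K_grp \<and> pt s (k *v base_vec) = pt s (k' *v base_vec)" k] k by auto
    note kG = K_grp_G[OF k] K_grp_G[OF k'(1)]
    obtain c where c: "c \<in> scalars s" "k' *v base_vec = c *\<^sub>R (k *v base_vec)"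
      using pt_eq[OF G_grp_cone(2)[OF kG(2)] G_grp_cone(2)[OF kG(1)]] k'(2) by metis
    have "\<bar>c\<bar> = 1"
      using arg_cong[OF c(2), of radius] by (simp add: radius_scaleR K_grp_radius k k'(1))
    moreover have "(matrix_inv k ** k') *v base_vec = c *\<^sub>R base_vec"
      using kG by (simp add: c(2) matrix_vector_simps flip: matrix_vector_mul_assoc)
    then have "u (k ** (matrix_inv k ** k')) = exp (l * of_real (ln \<bar>c\<bar>)) * u k"
      using u kG c(1) unfolding Ind_iff by blast
    ultimately have "u k' = u k"
      using kG by (simp add: matrix_mul_assoc)
    then show ?thesis
      using K_E_set[OF kG(1)] by (simp add: f_def k'_def)
  qed
  then have Kf: "K_lift (pt s base_vec) f = (\<lambda>k. if k \<in> K_grp then u k else 0)"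
    by (auto simp: K_lift_pt K_lift_outside fun_eq_iff)
  have f: "f \<in> C_inf_pt s"
    unfolding C_inf_E_def mem_Collect_eq Kf
    using K_grp_C_inf_restrict[of u] u by (auto simp: f_def Ind_iff)
  have "delta_pt s u = f"
    unfolding delta_def by (rule K_descend_props[OF f Kf])
  then show "delta_pt s u \<in> C_inf_pt s" "\<And>k. k \<in> K_grp \<Longrightarrow> K_lift (pt s base_vec) (delta_pt s u) k = u k"
    using f Kf by simp_all
qed

lemma Ind_determined:
  assumes u: "u \<in> Ind (L_grp s) l" and w: "w \<in> Ind (L_grp s) l"
    and eq: "\<And>k. k \<in> K_grp \<Longrightarrow> u k = w k"
  shows "u = w"
proof
  fix g
  show "u g = w g"
  proof (cases "g \<in> G_grp")
    case True
    obtain k p r where k: "k \<in> K_grp" "p \<in> G_grp" "0 < r" "p *v base_vec = r *\<^sub>R base_vec" "g = k ** p"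
      using G_grp_polar[OF True] .
    have "u (k ** p) = exp (l * of_real (ln \<bar>r\<bar>)) * u k" "w (k ** p) = exp (l * of_real (ln \<bar>r\<bar>)) * w k"
      using u w K_grp_G[OF k(1)] k(2,4) scalars_pos[OF k(3)] unfolding Ind_iff by blast+
    then show ?thesis
      using eq[OF k(1)] k(5) by simp
  next
    case False
    then show ?thesis
      using u w C_inf_vanish unfolding Ind_iff by metis
  qed
qed

lemma delta_eqI:
  assumes u: "u \<in> Ind (L_grp s) l" and f: "f \<in> C_inf_pt s"
    and eq: "\<And>k. k \<in> K_grp \<Longrightarrow> f (pt s (k *v base_vec)) = u k"
  shows "delta_pt s u = f"
  by (rule K_lift_inj[OF delta_props(1)[OF u] f], subst delta_props(2)[OF u], assumption)
    (simp add: K_lift_pt eq)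

lemma delta_at: "u \<in> Ind (L_grp s) l \<Longrightarrow> k \<in> K_grp \<Longrightarrow> delta_pt s u (pt s (k *v base_vec)) = u k"
  using delta_props(2)[of u s l k] by (simp add: K_lift_pt)

lemma delta_extend:
  assumes "f \<in> C_inf_pt s"
  shows "delta_pt s (Ind_extend s l f) = f"
  by (rule delta_eqI[OF extend_Ind[OF assms] assms]) (simp add: extend_K)

lemma delta_inj: "inj_on (delta_pt s) (Ind (L_grp s) l :: ('a::finite mat_m \<Rightarrow> complex) set)"
proof (rule inj_onI)
  fix u w :: "'a mat_m \<Rightarrow> complex"
  assume h: "u \<in> Ind (L_grp s) l" "w \<in> Ind (L_grp s) l" "delta_pt s u = delta_pt s w"
  show "u = w"
    using delta_at[OF h(1)] delta_at[OF h(2)] h(3) by (intro Ind_determined[OF h(1,2)]) metis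
qed

lemma inv_delta:
  assumes "f \<in> C_inf_pt s"
  shows "inv_into (Ind (L_grp s) l) (delta_pt s) f = Ind_extend s l f"
  by (rule inv_into_f_eq) (rule delta_inj, rule extend_Ind[OF assms], rule delta_extend[OF assms])

lemma extend_delta:
  assumes "u \<in> Ind (L_grp s) l"
  shows "Ind_extend s l (delta_pt s u) = u"
  using inv_into_f_f[OF delta_inj assms] inv_delta[OF delta_props(1)[OF assms]] by metis

lemma C_inf_pt_lincomb:
  assumes "f \<in> C_inf_pt s" "h \<in> C_inf_pt s"
  shows "(\<lambda>x. c * f x + d * h x) \<in> C_inf_pt s"
proof -
  have "K_lift e (\<lambda>x. c * f x + d * h x) = (\<lambda>k. c * K_lift e f k + d * K_lift e h k)" for e
    by (auto simp: K_lift_def)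
  then show ?thesis
    using assms by (auto simp: C_inf_E_def C_inf_add C_inf_cmult)
qed

lemma Ind_lincomb:
  assumes "u \<in> Ind (L_grp s) l" "w \<in> Ind (L_grp s) l"
  shows "(\<lambda>x. c * u x + d * w x) \<in> Ind (L_grp s) l"
  using assms unfolding Ind_iff by (auto simp: C_inf_add C_inf_cmult algebra_simps)

lemma delta_lincomb:
  assumes u: "u \<in> Ind (L_grp s) l" and w: "w \<in> Ind (L_grp s) l"
  shows "delta_pt s (\<lambda>x. c * u x + d * w x) = (\<lambda>X. c * delta_pt s u X + d * delta_pt s w X)"
  by (rule delta_eqI[OF Ind_lincomb[OF u w] C_inf_pt_lincomb[OF delta_props(1)[OF u] delta_props(1)[OF w]]])
    (simp add: delta_at[OF u] delta_at[OF w])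

lemma Ind_left_translate:
  assumes u: "u \<in> Ind (L_grp s) l" and g: "g \<in> G_grp"
  shows "(\<lambda>x. u (g ** x)) \<in> Ind (L_grp s) l"
  using u g C_inf_left_translate[of u g] G_grp_mult[OF g] unfolding Ind_iff by (simp add: matrix_mul_assoc)

text \<open>Whatever decomposition \<open>x = k m a \<eta>\<close> is chosen, the factor \<open>\<xi>(a)\<close> and the value at \<open>k\<close> recombine to
  the value of the induced function at \<open>x\<close>.\<close>

lemma pi_c_delta:
  assumes u: "u \<in> Ind (L_grp s) l" and g: "g \<in> G_grp"
  shows "pi_c (L_grp s) (E_set s) (pt s base_vec) l g (delta_pt s u) = delta_pt s (\<lambda>x. u (matrix_inv g ** x))"
proof -
  have "K_lift (pt s base_vec) (delta_pt s u) (\<kappa> (L_grp s) x) * \<xi> l (a_part (L_grp s) x) = u x"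
    if x: "x \<in> G_grp" for x
  proof -
    obtain k p r where k: "k \<in> K_grp" "p \<in> G_grp" "0 < r" "p *v base_vec = r *\<^sub>R base_vec" "x = k ** p"
      using G_grp_polar[OF x] .
    obtain m \<eta> where m: "m \<in> L_grp s" "\<eta> \<in> Np_grp" "p = m ** mat_exp (ln \<bar>r\<bar> *\<^sub>R H_mat) ** \<eta>"
      using parabolic_decompose[OF k(2,4) scalars_pos[OF k(3)]] by blast
    have "x = k ** m ** mat_exp (ln \<bar>r\<bar> *\<^sub>R H_mat) ** \<eta>"
      unfolding k(5) m(3) by (simp add: matrix_mul_assoc)
    then have "\<exists>z. case z of (k, m, a, \<eta>) \<Rightarrow> k \<in> K_grp \<and> m \<in> L_grp s \<and> a \<in> A_grp \<and> \<eta> \<in> Np_grp \<and> x = k ** m ** a ** \<eta>"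
      using k(1) m(1,2) unfolding A_grp_eq by (intro exI[of _ "(k, m, mat_exp (ln \<bar>r\<bar> *\<^sub>R H_mat), \<eta>)"]) auto
    from someI_ex[OF this] obtain k' m' a' \<eta>' where d: "decomp (L_grp s) x = (k', m', a', \<eta>')"
      "k' \<in> K_grp" "m' \<in> L_grp s" "a' \<in> A_grp" "\<eta>' \<in> Np_grp" "x = k' ** m' ** a' ** \<eta>'"
      unfolding decomp_def[symmetric] by (cases "decomp (L_grp s) x") auto
    have "u x = \<xi> l a' * u k'"
      using u d(3-5) K_grp_G[OF d(2)] unfolding d(6) Ind_def by blast
    then show ?thesis
      using d(1,2) delta_props(2)[OF u d(2)] by (simp add: \<kappa>_def a_part_def)
  qed
  then have "(\<lambda>k. if k \<in> K_grp then K_lift (pt s base_vec) (delta_pt s u) (\<kappa> (L_grp s) (matrix_inv g ** k))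
       * \<xi> l (a_part (L_grp s) (matrix_inv g ** k)) else 0) = (\<lambda>k. if k \<in> K_grp then u (matrix_inv g ** k) else 0)"
    using G_grp_mult[OF G_grp_inv[OF g] K_grp_G] by auto
  then show ?thesis
    unfolding pi_c_def delta_def by simp
qed

text \<open>The operator is the restriction of the action of one fixed noncommutative polynomial. Linearity and
  compatibility with left translations are inherited from such actions.\<close>

lemma D_op_R_free:
  obtains P :: "'a::finite option coord free_alg" where "P \<in> FA"
    "\<And>u. u \<in> C_inf G_grp \<Longrightarrow> D_op n N l u = pullback (R_free P u)"
proof
  let ?P = "\<Sum>j\<le>N div 2. scal (D_coeff n N j l) * D_term N j :: 'a option coord free_alg"
  show P: "?P \<in> FA"
    by (intro FA_sum FA_mult FA_scal D_term_FA)
  show "D_op n N l u = pullback (R_free ?P u)" if "u \<in> C_inf G_grp" for u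
    unfolding D_op_def D0_eq R_uea_class[OF P that] ..
qed

lemma D_op_lincomb:
  fixes u :: "'a::finite option mat_m \<Rightarrow> complex"
  assumes u: "u \<in> C_inf G_grp" and w: "w \<in> C_inf G_grp"
  shows "D_op n N l (\<lambda>x. c * u x + d * w x) = (\<lambda>x. c * D_op n N l u x + d * D_op n N l w x)"
proof -
  obtain P :: "'a option coord free_alg" where P: "P \<in> FA"
    and D: "\<And>u. u \<in> C_inf G_grp \<Longrightarrow> D_op n N l u = pullback (R_free P u)"
    using D_op_R_free by blast
  show ?thesis
    using u w P by (simp add: D pullback_def fun_eq_iff C_inf_add C_inf_cmult R_free_add_fun R_free_cmult)
qed

lemma D_op_left_translate:
  fixes u :: "'a::finite option mat_m \<Rightarrow> complex"
  assumes u: "u \<in> C_inf G_grp" and g: "g \<in> G_grp"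
  shows "D_op n N l (\<lambda>x. u (matrix_inv (grp_emb g) ** x)) = (\<lambda>x. D_op n N l u (matrix_inv g ** x))"
proof -
  obtain P :: "'a option coord free_alg" where P: "P \<in> FA"
    and D: "\<And>u. u \<in> C_inf G_grp \<Longrightarrow> D_op n N l u = pullback (R_free P u)"
    using D_op_R_free by blast
  have gi: "matrix_inv (grp_emb g) = grp_emb (matrix_inv g)"
    using g by (intro right_inverse_unique[symmetric]) (simp_all flip: grp_emb_mult)
  have "(\<lambda>x. u (grp_emb (matrix_inv g) ** x)) \<in> C_inf G_grp"
    using u g by (intro C_inf_left_translate) simp_all
  then show ?thesis
    unfolding gi using u by (simp add: D pullback_def fun_eq_iff R_free_left_translate grp_emb_mult)
qed

lemma compact_equivariant:
  assumes n: "n = CARD('a::finite) + 3" and N: "even N \<or> \<not> s"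
  shows "equivariant_operator (G_grp :: 'a mat_m set)
     (C_inf_pt s) (\<lambda>g. pi_c (L_grp s) (E_set s) (pt s base_vec) l (grp_emb g))
     (C_inf_pt s) (pi_c (L_grp s) (E_set s) (pt s base_vec) (l - of_nat N))
     (delta_pt s \<circ> D_op n N l \<circ> inv_into (Ind (L_grp s) l) (delta_pt s))"
proof -
  define T where "T = delta_pt s \<circ> D_op n N l \<circ> inv_into (Ind (L_grp s) l) (delta_pt s :: ('a option mat_m \<Rightarrow> complex) \<Rightarrow> _)"
  have T: "T f = delta_pt s (D_op n N l (Ind_extend s l f))" if "f \<in> C_inf_pt s" for f
    by (simp add: T_def inv_delta[OF that])
  have D: "D_op n N l u \<in> Ind (L_grp s) (l - of_nat N)" if "u \<in> Ind (L_grp s) l" for u :: "'a option mat_m \<Rightarrow> complex"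
    by (rule D_op_Ind[OF n that N])
  have C: "Ind_extend s l f \<in> C_inf G_grp" if "f \<in> C_inf_pt s" for f :: "'a option vec_m set \<Rightarrow> complex"
    using extend_Ind[OF that, of l] by (simp add: Ind_iff)
  show ?thesis
    unfolding equivariant_operator_def T_def[symmetric]
  proof (intro conjI ballI allI)
    show "T \<in> C_inf_pt s \<rightarrow> C_inf_pt s"
      using T delta_props(1)[OF D[OF extend_Ind]] by simp
    show "T (\<lambda>x. c * f x + d * h x) = (\<lambda>y. c * T f y + d * T h y)"
      if f: "f \<in> C_inf_pt s" and h: "h \<in> C_inf_pt s" for f h c d
    proof -
      have "Ind_extend s l (\<lambda>x. c * f x + d * h x) = (\<lambda>x. c * Ind_extend s l f x + d * Ind_extend s l h x)"
        by (auto simp: Ind_extend_def fun_eq_iff algebra_simps)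
      then show ?thesis
        unfolding T[OF C_inf_pt_lincomb[OF f h]] T[OF f] T[OF h]
        by (simp add: D_op_lincomb[OF C[OF f] C[OF h]] delta_lincomb[OF D[OF extend_Ind[OF f]] D[OF extend_Ind[OF h]]])
    qed
    show "T (pi_c (L_grp s) (E_set s) (pt s base_vec) l (grp_emb g) f)
        = pi_c (L_grp s) (E_set s) (pt s base_vec) (l - of_nat N) g (T f)"
      if g: "g \<in> G_grp" and f: "f \<in> C_inf_pt s" for g f
    proof -
      define u where "u = Ind_extend s l f"
      have u: "u \<in> Ind (L_grp s) l" and fu: "f = delta_pt s u"
        unfolding u_def using extend_Ind[OF f] delta_extend[OF f] by simp_all
      have eg: "grp_emb g \<in> G_grp" using g by simp
      have tr: "(\<lambda>x. u (matrix_inv (grp_emb g) ** x)) \<in> Ind (L_grp s) l"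
        by (rule Ind_left_translate[OF u G_grp_inv[OF eg]])
      have "T (pi_c (L_grp s) (E_set s) (pt s base_vec) l (grp_emb g) f)
          = T (delta_pt s (\<lambda>x. u (matrix_inv (grp_emb g) ** x)))"
        unfolding fu pi_c_delta[OF u eg] ..
      also have "\<dots> = delta_pt s (D_op n N l (\<lambda>x. u (matrix_inv (grp_emb g) ** x)))"
        unfolding T[OF delta_props(1)[OF tr]] extend_delta[OF tr] ..
      also have "\<dots> = delta_pt s (\<lambda>x. D_op n N l u (matrix_inv g ** x))"
        unfolding D_op_left_translate[OF C[OF f, folded u_def] g] ..
      also have "\<dots> = pi_c (L_grp s) (E_set s) (pt s base_vec) (l - of_nat N) g (delta_pt s (D_op n N l u))"
        by (rule pi_c_delta[OF D[OF u] g, symmetric])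
      also have "delta_pt s (D_op n N l u) = T f"
        unfolding T[OF f] u_def ..
      finally show ?thesis .
    qed
  qed
qed

theorem theorem3:
  fixes n :: nat
  assumes "n \<ge> 4" and "CARD('a::finite) = n - 3"
  shows
    "(\<forall>N. even N \<longrightarrow>
        polynomial_family \<gg> (D0 n N :: complex \<Rightarrow> 'a option coord free_alg set) \<and>
        (\<forall>l. (D_op n N l :: ('a option mat_m \<Rightarrow> complex) \<Rightarrow> 'a mat_m \<Rightarrow> complex)
               \<in> Ind M_grp l \<rightarrow> Ind M_grp (l - of_nat N) \<and>
             equivariant_operator (G_grp :: 'a mat_m set)
               C_inf_Ein (\<lambda>g. pi_Ein l (grp_emb g))
               C_inf_Ein (pi_Ein (l - of_nat N))
               (Dc_op n N l)))
     \<and>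
     (\<forall>N.
        polynomial_family \<gg> (D0 n N :: complex \<Rightarrow> 'a option coord free_alg set) \<and>
        (\<forall>l. (D_op n N l :: ('a option mat_m \<Rightarrow> complex) \<Rightarrow> 'a mat_m \<Rightarrow> complex)
               \<in> Ind M_hat l \<rightarrow> Ind M_hat (l - of_nat N) \<and>
             equivariant_operator (G_grp :: 'a mat_m set)
               C_inf_Ein_hat (\<lambda>g. pi_Ein_hat l (grp_emb g))
               C_inf_Ein_hat (pi_Ein_hat (l - of_nat N))
               (Dc_hat_op n N l)))"
proof -
  have n: "n = CARD('a) + 3"
    using assms by simp
  have lines: "equivariant_operator (G_grp :: 'a mat_m set) C_inf_Ein (\<lambda>g. pi_Ein l (grp_emb g))
      C_inf_Ein (pi_Ein (l - of_nat N)) (Dc_op n N l)" if "even N" for N l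
    using compact_equivariant[OF n, of N True l] that
    by (simp add: C_inf_Ein_def pi_Ein_def Dc_op_def delta_Ein_def L_grp_def E_set_def pt_def)
  have rays: "equivariant_operator (G_grp :: 'a mat_m set) C_inf_Ein_hat (\<lambda>g. pi_Ein_hat l (grp_emb g))
      C_inf_Ein_hat (pi_Ein_hat (l - of_nat N)) (Dc_hat_op n N l)" for N l
    using compact_equivariant[OF n, of N False l]
    by (simp add: C_inf_Ein_hat_def pi_Ein_hat_def Dc_hat_op_def delta_Ein_hat_def L_grp_def E_set_def pt_def)
  have L: "L_grp True = M_grp" "L_grp False = M_hat"
    by (simp_all add: L_grp_def)
  have D: "(D_op n N l :: ('a option mat_m \<Rightarrow> complex) \<Rightarrow> 'a mat_m \<Rightarrow> complex)
      \<in> Ind (L_grp s) l \<rightarrow> Ind (L_grp s) (l - of_nat N)" if "even N \<or> \<not> s" for N l s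
    by (intro funcsetI D_op_Ind[OF n _ that])
  show ?thesis
  proof (intro conjI allI impI)
    show "polynomial_family \<gg> (D0 n N :: complex \<Rightarrow> 'a option coord free_alg set)" for N
      by (rule D0_polynomial_family)
    then show "polynomial_family \<gg> (D0 n N :: complex \<Rightarrow> 'a option coord free_alg set)" for N .
    show "(D_op n N l :: ('a option mat_m \<Rightarrow> complex) \<Rightarrow> 'a mat_m \<Rightarrow> complex)
        \<in> Ind M_grp l \<rightarrow> Ind M_grp (l - of_nat N)" if "even N" for N l
      using D[of N True l] that unfolding L by simp
    show "(D_op n N l :: ('a option mat_m \<Rightarrow> complex) \<Rightarrow> 'a mat_m \<Rightarrow> complex)
        \<in> Ind M_hat l \<rightarrow> Ind M_hat (l - of_nat N)" for N l
      using D[of N False l] unfolding L by simp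
  qed (fact lines rays)+
qed

end
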